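(* Let $(X,f)$ be a topological dynamical system and let $L\ge 1$ be an integer. Assume that there exists a subsystem $(Y,f^L)$ of $(X,f^L)$ such that (1) $(Y,f^L)$ satisfies the modified almost specification property and $h_{\mathrm{top}}(f^L,Y)>0$; (2) $X=\bigcup_{i=0}^{L-1}f^i(Y)$. Then for any non-trivial weight $\vartheta\in\ell^\infty(\mathbb N)$, \[ h_{\mathrm{top}}(f,\mathcal N_\vartheta(f,X))=h_{\mathrm{top}}(f,X)=\frac1L h_{\mathrm{top}}(f^L,Y)>0 . \] In particular, $(X,f)$ is Bohr chaotic.
   Context: A topological dynamical system $(X,f)$ consists of a compact metric space $(X,d)$ and a continuous map $f:X\to X$. A subsystem $(Y,f^L)$ of $(X,f^L)$ is a nonempty compact set $Y\subset X$ with $f^L(Y)\subset Y$. Mistake function: given $\varepsilon_0>0$, a function $g:\mathbb N^+\times(0,\varepsilon_0]\to\mathbb N$ with $g(m,\varepsilon)\le g(m+1,\varepsilon)$ for all $m$ and $\lim_{n\to\infty}g(n,\varepsilon)/n=0$ for each $\varepsilon\in(0,\varepsilon_0]$; set $g(n,\varepsilon)=g(n,\varepsilon_0)$ for $\varepsilon>\varepsilon_0$. For a system $(Z,T)$, the mistake dynamical ball is $B_n(T;g(n,\varepsilon);x,\varepsilon)=\{y\in Z:\ \exists\,\emptyset\ne\Lambda\subset\{0,\dots,n-1\},\ |\Lambda|\ge n-g(n,\varepsilon),\ d(T^ix,T^iy)<\varepsilon\ \forall i\in\Lambda\}$. $(Z,T)$ satisfies the modified almost specification property if there are a mistake function $g$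 and a function $k_g:(0,\infty)\to\mathbb N^+$ such that for any $m\ge1$, any $\varepsilon>0$, any $x_1,\dots,x_m\in\bigcap_{i=0}^\infty T^i(Z)$ and any integer $n\ge k_g(\varepsilon)$, one has $\bigcap_{j=1}^m T^{-(j-1)n}\big(B_n(T;g(n,\varepsilon);x_j,\varepsilon)\big)\neq\emptyset$. A bounded real sequence $\vartheta=(\vartheta_n)_{n\ge 0}$ is a non-trivial weight if $\limsup_{N\to\infty}\frac1N\sum_{n=0}^{N-1}|\vartheta_n|>0$. $\mathcal N_\vartheta(f,X)$ is the set of $x\in X$ for which there is a continuous $\varphi:X\to\mathbb R$ with $\limsup_{N\to\infty}\frac1N\left|\sum_{n=0}^{N-1}\vartheta_n\varphi(f^nx)\right|>0$. $(X,f)$ is Bohr chaotic if $\mathcal N_\vartheta(f,X)\neq\emptyset$ for every non-trivial weight $\vartheta$. Bowen topological entropy of a subset $E\subset X$ (for a map $f$): let $B_u(f;x,r)=\{z\in X: d(f^ix,f^iz)<r,\ 0\le i\le u-1\}$. For $t\ge0$ let $C(E;t,n,r,f)$ be the infimum of $\sum e^{-tu}$ over all finite or countable covers of $E$ by sets $B_u(f;x,r)$ with $u\ge n$; let $C(E;t,r,f)=\lim_{n\to\infty}C(E;t,n,r,f)$, $h_{\mathrm{top}}(E;r,f)=\inf\{t:C(E;t,r,f)=0\}$ and $h_{\mathrm{top}}(f,E)=\lim_{r\to0}h_{\mathrm{top}}(E;r,f)$. For a subsystem this equals the classical topological entropy. *)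

theory Defs
  imports "HOL-Analysis.Analysis"
begin

section \<open>Topological dynamical systems\<close>

text \<open>
  A compact metric space is represented as a compact subset of a metric type, and only the
  behaviour of the map on that subset matters.
\<close>

definition tds :: "'a::metric_space set \<Rightarrow> ('a \<Rightarrow> 'a) \<Rightarrow> bool" where
  "tds X f \<longleftrightarrow> compact X \<and> continuous_on X f \<and> f ` X \<subseteq> X"

definition subsystem :: "'a::metric_space set \<Rightarrow> ('a \<Rightarrow> 'a) \<Rightarrow> 'a set \<Rightarrow> bool" where
  "subsystem X T Y \<longleftrightarrow> Y \<noteq> {} \<and> compact Y \<and> Y \<subseteq> X \<and> T ` Y \<subseteq> Y"


section \<open>The modified almost specification property\<close>

definition mistake_function :: "real \<Rightarrow> (nat \<Rightarrow> real \<Rightarrow> nat) \<Rightarrow> bool" where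
  "mistake_function \<epsilon>0 g \<longleftrightarrow>
     0 < \<epsilon>0 \<and>
     (\<forall>\<epsilon>\<in>{0<..\<epsilon>0}.
        (\<forall>m\<ge>1. g m \<epsilon> \<le> g (m + 1) \<epsilon>) \<and>
        (\<lambda>n. real (g n \<epsilon>) / real n) \<longlonglongrightarrow> 0)"

text \<open>Extension to all positive \<open>\<epsilon>\<close>: constantly \<open>g n \<epsilon>0\<close> beyond \<open>\<epsilon>0\<close>.\<close>

definition mistake_ext :: "real \<Rightarrow> (nat \<Rightarrow> real \<Rightarrow> nat) \<Rightarrow> nat \<Rightarrow> real \<Rightarrow> nat" where
  "mistake_ext \<epsilon>0 g n \<epsilon> = (if \<epsilon> \<le> \<epsilon>0 then g n \<epsilon> else g n \<epsilon>0)"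

text \<open>
  The condition \<open>n \<le> card \<Lambda> + k\<close> expresses that the cardinality of \<open>\<Lambda>\<close> is at least \<open>n - k\<close>
  without truncated subtraction.
\<close>

definition mistake_ball ::
  "'a::metric_space set \<Rightarrow> ('a \<Rightarrow> 'a) \<Rightarrow> nat \<Rightarrow> nat \<Rightarrow> 'a \<Rightarrow> real \<Rightarrow> 'a set" where
  "mistake_ball Z T n k x \<epsilon> =
     {y \<in> Z. \<exists>\<Lambda>. \<Lambda> \<noteq> {} \<and> \<Lambda> \<subseteq> {..<n} \<and> n \<le> card \<Lambda> + k \<and>
        (\<forall>i\<in>\<Lambda>. dist ((T ^^ i) x) ((T ^^ i) y) < \<epsilon>)}"

definition modified_almost_specification ::
  "'a::metric_space set \<Rightarrow> ('a \<Rightarrow> 'a) \<Rightarrow> bool" where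
  "modified_almost_specification Z T \<longleftrightarrow>
     (\<exists>\<epsilon>0 g kg.
        mistake_function \<epsilon>0 g \<and> (\<forall>\<epsilon>>0. (1::nat) \<le> kg \<epsilon>) \<and>
        (\<forall>m\<ge>1. \<forall>\<epsilon>>0. \<forall>x :: nat \<Rightarrow> 'a.
           (\<forall>j\<in>{1..m}. x j \<in> (\<Inter>i. (T ^^ i) ` Z)) \<longrightarrow>
           (\<forall>n\<ge>kg \<epsilon>.
              (\<Inter>j\<in>{1..m}.
                 {z \<in> Z. (T ^^ ((j - 1) * n)) z
                           \<in> mistake_ball Z T n (mistake_ext \<epsilon>0 g n \<epsilon>) (x j) \<epsilon>}) \<noteq> {})))"


section \<open>Weights and Bohr chaoticity\<close>

text \<open>The averages at \<open>N = 0\<close> are \<open>0\<close> and do not affect the upper limits.\<close>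

definition nontrivial_weight :: "(nat \<Rightarrow> real) \<Rightarrow> bool" where
  "nontrivial_weight \<theta> \<longleftrightarrow>
     bounded (range \<theta>) \<and>
     limsup (\<lambda>N. ereal ((\<Sum>n<N. \<bar>\<theta> n\<bar>) / real N)) > 0"

definition correlated_points ::
  "(nat \<Rightarrow> real) \<Rightarrow> ('a::metric_space \<Rightarrow> 'a) \<Rightarrow> 'a set \<Rightarrow> 'a set" where
  "correlated_points \<theta> f X =
     {x \<in> X. \<exists>\<phi> :: 'a \<Rightarrow> real. continuous_on X \<phi> \<and>
        limsup (\<lambda>N. ereal (\<bar>\<Sum>n<N. \<theta> n * \<phi> ((f ^^ n) x)\<bar> / real N)) > 0}"

definition bohr_chaotic :: "'a::metric_space set \<Rightarrow> ('a \<Rightarrow> 'a) \<Rightarrow> bool" where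
  "bohr_chaotic X f \<longleftrightarrow> (\<forall>\<theta>. nontrivial_weight \<theta> \<longrightarrow> correlated_points \<theta> f X \<noteq> {})"


section \<open>Bowen topological entropy of subsets\<close>

definition bowen_ball ::
  "'a::metric_space set \<Rightarrow> ('a \<Rightarrow> 'a) \<Rightarrow> nat \<Rightarrow> 'a \<Rightarrow> real \<Rightarrow> 'a set" where
  "bowen_ball X f u x r = {z \<in> X. \<forall>i<u. dist ((f ^^ i) x) ((f ^^ i) z) < r}"

text \<open>
  A countable cover of \<open>E\<close> by Bowen balls is given by the set \<open>I\<close> of its centre/length pairs,
  since the length \<open>u\<close> need not be determined by the ball as a set.
\<close>

definition bowen_covers ::
  "'a::metric_space set \<Rightarrow> ('a \<Rightarrow> 'a) \<Rightarrow> 'a set \<Rightarrow> nat \<Rightarrow> real \<Rightarrow> ('a \<times> nat) set set" where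
  "bowen_covers X f E n r =
     {I. countable I \<and> I \<subseteq> X \<times> {n..} \<and> E \<subseteq> (\<Union>(x, u)\<in>I. bowen_ball X f u x r)}"

definition bowen_C_n ::
  "'a::metric_space set \<Rightarrow> ('a \<Rightarrow> 'a) \<Rightarrow> 'a set \<Rightarrow> real \<Rightarrow> nat \<Rightarrow> real \<Rightarrow> ennreal" where
  "bowen_C_n X f E t n r =
     (INF I\<in>bowen_covers X f E n r. \<Sum>\<^sub>\<infinity>(x, u)\<in>I. ennreal (exp (- t * real u)))"

definition bowen_C ::
  "'a::metric_space set \<Rightarrow> ('a \<Rightarrow> 'a) \<Rightarrow> 'a set \<Rightarrow> real \<Rightarrow> real \<Rightarrow> ennreal" where
  "bowen_C X f E t r = lim (\<lambda>n. bowen_C_n X f E t n r)"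

text \<open>The infimum is taken in the extended reals, so it is \<open>\<infinity>\<close> if there is no such \<open>t\<close>.\<close>

definition htop_scale ::
  "'a::metric_space set \<Rightarrow> ('a \<Rightarrow> 'a) \<Rightarrow> 'a set \<Rightarrow> real \<Rightarrow> ereal" where
  "htop_scale X f E r = Inf (ereal ` {t. 0 \<le> t \<and> bowen_C X f E t r = 0})"

definition htop :: "'a::metric_space set \<Rightarrow> ('a \<Rightarrow> 'a) \<Rightarrow> 'a set \<Rightarrow> ereal" where
  "htop X f E = Lim (at_right 0) (\<lambda>r. htop_scale X f E r)"

text \<open>Both limits exist by monotonicity, so \<open>lim\<close> and \<open>Lim\<close> above are meaningful.\<close>

lemma bowen_C_n_mono: "n \<le> n' \<Longrightarrow> bowen_C_n X f E t n r \<le> bowen_C_n X f E t n' r"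
  unfolding bowen_C_n_def bowen_covers_def by (intro INF_superset_mono) auto

lemma bowen_C_n_tendsto: "(\<lambda>n. bowen_C_n X f E t n r) \<longlonglongrightarrow> bowen_C X f E t r"
proof -
  have "(\<lambda>n. bowen_C_n X f E t n r) \<longlonglongrightarrow> (SUP n. bowen_C_n X f E t n r)"
    by (intro LIMSEQ_SUP) (auto simp: incseq_def bowen_C_n_mono)
  then show ?thesis
    unfolding bowen_C_def by (metis limI)
qed

lemma bowen_C_antimono:
  assumes "r \<le> r'"
  shows "bowen_C X f E t r' \<le> bowen_C X f E t r"
proof -
  have ball: "bowen_ball X f u x r \<subseteq> bowen_ball X f u x r'" for u x
    using assms unfolding bowen_ball_def by force
  have "bowen_covers X f E n r \<subseteq> bowen_covers X f E n r'" for n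
    unfolding bowen_covers_def using ball by fastforce
  then have "bowen_C_n X f E t n r' \<le> bowen_C_n X f E t n r" for n
    unfolding bowen_C_n_def by (intro INF_superset_mono) auto
  then show ?thesis
    by (intro LIMSEQ_le[OF bowen_C_n_tendsto bowen_C_n_tendsto]) auto
qed

lemma htop_scale_antimono:
  assumes "r \<le> r'"
  shows "htop_scale X f E r' \<le> htop_scale X f E r"
  unfolding htop_scale_def
proof (intro Inf_superset_mono image_mono subsetI)
  fix t assume "t \<in> {t. 0 \<le> t \<and> bowen_C X f E t r = 0}"
  then show "t \<in> {t. 0 \<le> t \<and> bowen_C X f E t r' = 0}"
    using bowen_C_antimono[OF assms, of X f E t] by auto
qed

lemma htop_scale_tendsto: "(htop_scale X f E \<longlongrightarrow> htop X f E) (at_right 0)"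
proof -
  have "(htop_scale X f E \<longlongrightarrow> (SUP r\<in>{0<..}. htop_scale X f E r)) (at_right 0)"
  proof (rule order_tendstoI)
    fix a assume "a < (SUP r\<in>{0<..}. htop_scale X f E r)"
    then obtain s where s: "s > 0" "a < htop_scale X f E s"
      by (auto simp: less_SUP_iff)
    have "\<forall>\<^sub>F r in at_right 0. r < s"
      using s(1) by (auto simp: eventually_at_right_field)
    then show "\<forall>\<^sub>F r in at_right 0. a < htop_scale X f E r"
      by eventually_elim (meson htop_scale_antimono less_imp_le less_le_trans s(2))
  next
    fix a assume a: "(SUP r\<in>{0<..}. htop_scale X f E r) < a"
    have "\<forall>\<^sub>F r::real in at_right 0. r > 0"
      by (auto simp: eventually_at_right_field intro: exI[of _ 1])
    then show "\<forall>\<^sub>F r in at_right 0. htop_scale X f E r < a"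
      by eventually_elim (metis SUP_upper a greaterThan_iff le_less_trans)
  qed
  then show ?thesis
    unfolding htop_def by (metis tendsto_Lim trivial_limit_at_right_real)
qed

end

theory Submission
  imports Defs "HOL-Probability.Infinite_Product_Measure"
begin

text \<open>
  Let \<open>h\<close> be the exponential growth rate of \<open>(n, r)\<close>-separated sets of the attractor. For a long block
  length \<open>p\<close>, counting codes yields a block \<open>A\<close> and about \<open>exp (h * p)\<close> further blocks, pairwise
  far apart in Hamming distance along the orbits, such that \<open>A\<close> is not Hamming-close to any window of a
  concatenation of these blocks except to its own occurrences: a block that overlaps \<open>A\<close> along a
  positive proportion of its length is determined, up to few codes, by its remaining entries, and a block
  close to a small shift of itself is nearly periodic. As all these properties are stated in Hamming
  distance, they survive the mistakes of the specification property, and a Hamming bump function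
  around \<open>A\<close> detects the occurrences of \<open>A\<close> in a shadowing orbit exactly. Hence \<open>A\<close> can be
  inserted at a sparse periodic set of places according to the sign of the weight, which forces
  correlation, while the free choice of the other blocks preserves almost all of the entropy.
\<close>

section \<open>Bowen entropy and iterates\<close>

text \<open>Specification shadows only points of the core of \<open>Y\<close>, the intersection of
  its images under the iterates of \<open>f ^^ L\<close>, whereas the entropy is that of all of
  \<open>X\<close>. The union \<open>V\<close> of the first \<open>L\<close> images of the core
  under \<open>f\<close> is the attractor: by compactness \<open>X\<close> enters every
  neighbourhood of \<open>V\<close> in finite time, so separated sets of \<open>V\<close> already
  account for covers of \<open>X\<close>. All counting is done at one fixed scale. There suitable
  long blocks number at least \<open>exp ((h - \<gamma>) * p)\<close> and at most a multiple of
  \<open>exp ((h + \<gamma>) * p)\<close>, and this two-sided control makes the exclusions possible: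
  being determined along a fraction \<beta> of its length costs a block a factor of about
  \<open>exp (- h * \<beta> * p)\<close>, which beats all errors of order \<gamma> and the linear
  number of shifts. The weight is arbitrary, so the bump function has to vanish off the marked times
  and not merely be small on average; otherwise the other terms could cancel the correlation. Since
  shadowing works without gaps, the marked times can be placed in whichever residue class carries a
  positive share of the weight with one sign.\<close>

lemma sum_le_infsum_ennreal:
  fixes c :: "'i \<Rightarrow> ennreal"
  assumes "finite F" "F \<subseteq> J"
  shows "sum c F \<le> infsum c J"
  by (subst nonneg_infsum_complete) (use assms in \<open>auto intro!: SUP_upper\<close>)

text \<open>Covers are sets of pairs, so a family may repeat a pair; dropping repetitions only
  lowers the sum. Asking for a bound on finite partial sums spares the callers any computation with
  infinite sums.\<close>

lemma bowen_C_n_le_family: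
  assumes "countable J"
    and "\<And>j. j \<in> J \<Longrightarrow> x j \<in> X" "\<And>j. j \<in> J \<Longrightarrow> n \<le> u j"
    and "E \<subseteq> (\<Union>j\<in>J. bowen_ball X f (u j) (x j) r)"
    and b: "\<And>F. finite F \<Longrightarrow> F \<subseteq> J \<Longrightarrow> (\<Sum>j\<in>F. ennreal (exp (- t * real (u j)))) \<le> b"
  shows "bowen_C_n X f E t n r \<le> b"
proof -
  define I where "I = (\<lambda>j. (x j, u j)) ` J"
  have "I \<in> bowen_covers X f E n r"
    unfolding bowen_covers_def I_def using assms by auto
  then have "bowen_C_n X f E t n r \<le> (\<Sum>\<^sub>\<infinity>(x, u)\<in>I. ennreal (exp (- t * real u)))"
    unfolding bowen_C_n_def by (rule INF_lower)
  also have "\<dots> \<le> b"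
  proof (subst nonneg_infsum_complete, simp, rule SUP_least, clarify)
    fix G assume "finite G" "G \<subseteq> I"
    then obtain F where F: "finite F" "F \<subseteq> J" "G = (\<lambda>j. (x j, u j)) ` F" "inj_on (\<lambda>j. (x j, u j)) F"
      unfolding I_def subset_image_inj by (metis finite_imageD)
    have "(\<Sum>(x, u)\<in>G. ennreal (exp (- t * real u))) = (\<Sum>j\<in>F. ennreal (exp (- t * real (u j))))"
      unfolding F(3) by (subst sum.reindex[OF F(4)]) simp
    then show "(\<Sum>(x, u)\<in>G. ennreal (exp (- t * real u))) \<le> b"
      using b F by simp
  qed
  finally show ?thesis .
qed

lemma bowen_C_n_le: "bowen_C_n X f E t n r \<le> bowen_C X f E t r"
proof (rule LIMSEQ_le_const[OF bowen_C_n_tendsto])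
  show "\<exists>N. \<forall>k\<ge>N. bowen_C_n X f E t n r \<le> bowen_C_n X f E t k r"
    using bowen_C_n_mono by blast
qed

lemma bowen_C_le:
  assumes "\<And>n. bowen_C_n X f E t n r \<le> b"
  shows "bowen_C X f E t r \<le> b"
  by (rule LIMSEQ_le_const2[OF bowen_C_n_tendsto]) (use assms in auto)

lemma htop_scale_le_htop:
  assumes "0 < r"
  shows "htop_scale X f E r \<le> htop X f E"
proof (rule tendsto_lowerbound[OF htop_scale_tendsto])
  have "\<forall>\<^sub>F s in at_right 0. s < r"
    using assms by (auto simp: eventually_at_right_field)
  then show "\<forall>\<^sub>F s in at_right 0. htop_scale X f E r \<le> htop_scale X f E s"
    by eventually_elim (simp add: htop_scale_antimono)
qed simp

lemma htop_le:
  assumes "\<And>r. 0 < r \<Longrightarrow> htop_scale X f E r \<le> b"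
  shows "htop X f E \<le> b"
proof (rule tendsto_upperbound[OF htop_scale_tendsto])
  have "\<forall>\<^sub>F r::real in at_right 0. 0 < r"
    by (auto simp: eventually_at_right_field intro: exI[of _ 1])
  then show "\<forall>\<^sub>F r in at_right 0. htop_scale X f E r \<le> b"
    by eventually_elim (rule assms)
qed simp

lemma htop_mono:
  assumes "E \<subseteq> E'"
  shows "htop X f E \<le> htop X f E'"
proof (rule htop_le)
  fix r :: real assume "0 < r"
  have "bowen_covers X f E' n r \<subseteq> bowen_covers X f E n r" for n
    unfolding bowen_covers_def using assms by auto
  then have "bowen_C_n X f E t n r \<le> bowen_C_n X f E' t n r" for t n
    unfolding bowen_C_n_def by (intro INF_superset_mono) auto
  then have le: "bowen_C X f E t r \<le> bowen_C X f E' t r" for t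
    by (intro LIMSEQ_le[OF bowen_C_n_tendsto bowen_C_n_tendsto]) auto
  have "bowen_C X f E t r = 0" if "bowen_C X f E' t r = 0" for t
    using le[of t] that by simp
  then have "htop_scale X f E r \<le> htop_scale X f E' r"
    unfolding htop_scale_def by (intro Inf_superset_mono image_mono subsetI) auto
  then show "htop_scale X f E r \<le> htop X f E'"
    using htop_scale_le_htop[OF \<open>0 < r\<close>] order_trans by blast
qed

lemma htop_scale_leI:
  assumes "0 \<le> t" "bowen_C X f E t r = 0"
  shows "htop_scale X f E r \<le> ereal t"
  unfolding htop_scale_def using assms by (intro Inf_lower) auto

lemma htop_scale_geI:
  assumes "\<And>s. 0 \<le> s \<Longrightarrow> s < t \<Longrightarrow> bowen_C X f E s r \<noteq> 0"
  shows "ereal t \<le> htop_scale X f E r"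
  unfolding htop_scale_def using assms by (intro Inf_greatest) (force simp: not_less)

section \<open>Comparison of the entropies of \<open>f\<close> and \<open>f ^^ L\<close>\<close>

lemma funpow_mem:
  assumes "f ` X \<subseteq> X" "x \<in> X"
  shows "(f ^^ i) x \<in> X"
  using assms by (induction i) auto

lemma continuous_on_funpow:
  assumes "continuous_on X f" "f ` X \<subseteq> X"
  shows "continuous_on X (f ^^ i)"
proof (induction i)
  case (Suc i)
  have "(f ^^ i) ` X \<subseteq> X" using funpow_mem[OF assms(2)] by auto
  then show ?case
    unfolding funpow.simps by (intro continuous_on_compose Suc continuous_on_subset[OF assms(1)])
qed (simp add: continuous_on_id id_def)

text \<open>An \<open>f\<close>-ball of length \<open>u\<close> lies in the
  \<open>f ^^ L\<close>-ball with the same centre and length \<open>u / L\<close> rounded up, since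
  the times \<open>L * i\<close> used there stay below \<open>u\<close>. Rounding up also makes the
  new weight at most the old one, so no constant is lost.\<close>

lemma htop_funpow_le:
  assumes L: "1 \<le> L"
  shows "htop X (f ^^ L) E \<le> ereal (real L) * htop X f E"
proof (rule htop_le)
  fix r :: real assume r: "0 < r"
  have "ereal (1 / real L) * htop_scale X (f ^^ L) E r \<le> htop_scale X f E r"
    unfolding htop_scale_def[of X f]
  proof (rule Inf_greatest, clarify)
    fix t :: real assume t: "0 \<le> t" "bowen_C X f E t r = 0"
    have "bowen_C X (f ^^ L) E (t * L) r \<le> bowen_C X f E t r"
    proof (rule bowen_C_le)
      fix n
      have "bowen_C_n X (f ^^ L) E (t * L) n r \<le> bowen_C_n X f E t (n * L) r"
        unfolding bowen_C_n_def[of X f]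
      proof (rule INF_greatest)
        fix I assume I: "I \<in> bowen_covers X f E (n * L) r"
        have ceil: "u \<le> ((u + L - 1) div L) * L" for u
          using L div_mult_mod_eq[of "u + L - 1" L] mod_less_divisor[of L "u + L - 1"] by linarith
        show "bowen_C_n X (f ^^ L) E (t * L) n r \<le> (\<Sum>\<^sub>\<infinity>(x, u)\<in>I. ennreal (exp (- t * real u)))"
        proof (rule bowen_C_n_le_family[where J = I and x = fst and u = "\<lambda>j. (snd j + L - 1) div L"])
          show "countable I" "\<And>j. j \<in> I \<Longrightarrow> fst j \<in> X"
            using I by (auto simp: bowen_covers_def)
          show "n \<le> (snd j + L - 1) div L" if "j \<in> I" for j
          proof -
            have "n * L \<le> snd j" using I that by (auto simp: bowen_covers_def)
            then have "n * L \<le> snd j + L - 1" using L by linarith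
            then show ?thesis using L by (simp add: less_eq_div_iff_mult_less_eq)
          qed
          have "bowen_ball X f u x r \<subseteq> bowen_ball X (f ^^ L) ((u + L - 1) div L) x r" for u x
          proof
            fix z assume z: "z \<in> bowen_ball X f u x r"
            have "dist (((f ^^ L) ^^ i) x) (((f ^^ L) ^^ i) z) < r" if "i < (u + L - 1) div L" for i
            proof -
              have "L * i < u"
              proof -
                have "Suc i * L \<le> ((u + L - 1) div L) * L"
                  using that by (intro mult_le_mono1) simp
                then have "Suc i * L \<le> u + L - 1"
                  by (rule order_trans[OF _ div_times_less_eq_dividend])
                then show ?thesis using L mult.commute[of i L] by (simp only: mult_Suc)
              qed
              then show ?thesis
                using z by (simp add: funpow_mult bowen_ball_def)
            qed
            then show "z \<in> bowen_ball X (f ^^ L) ((u + L - 1) div L) x r"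
              using z by (simp add: bowen_ball_def)
          qed
          then have "(\<Union>(x, u)\<in>I. bowen_ball X f u x r)
              \<subseteq> (\<Union>j\<in>I. bowen_ball X (f ^^ L) ((snd j + L - 1) div L) (fst j) r)"
            unfolding case_prod_beta by (intro UN_mono) auto
          then show "E \<subseteq> (\<Union>j\<in>I. bowen_ball X (f ^^ L) ((snd j + L - 1) div L) (fst j) r)"
            using I unfolding bowen_covers_def by blast
          fix F assume F: "finite F" "F \<subseteq> I"
          have "(\<Sum>j\<in>F. ennreal (exp (- (t * real L) * real ((snd j + L - 1) div L))))
              \<le> (\<Sum>j\<in>F. (\<lambda>(x, u). ennreal (exp (- t * real u))) j)"
          proof (rule sum_mono)
            fix j assume "j \<in> F"
            have "real (snd j) \<le> real L * real ((snd j + L - 1) div L)"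
              using ceil[of "snd j"] by (metis mult.commute of_nat_le_iff of_nat_mult)
            then have "t * real (snd j) \<le> t * (real L * real ((snd j + L - 1) div L))"
              using t(1) by (rule mult_left_mono)
            then show "ennreal (exp (- (t * real L) * real ((snd j + L - 1) div L)))
              \<le> (\<lambda>(x, u). ennreal (exp (- t * real u))) j"
              by (auto simp: case_prod_beta mult.assoc intro!: ennreal_leI)
          qed
          also have "\<dots> \<le> (\<Sum>\<^sub>\<infinity>(x, u)\<in>I. ennreal (exp (- t * real u)))"
            by (rule sum_le_infsum_ennreal[OF F])
          finally show "(\<Sum>j\<in>F. ennreal (exp (- (t * real L) * real ((snd j + L - 1) div L))))
              \<le> (\<Sum>\<^sub>\<infinity>(x, u)\<in>I. ennreal (exp (- t * real u)))" .
        qed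
      qed
      also have "\<dots> \<le> bowen_C X f E t r" by (rule bowen_C_n_le)
      finally show "bowen_C_n X (f ^^ L) E (t * L) n r \<le> bowen_C X f E t r" .
    qed
    then have "htop_scale X (f ^^ L) E r \<le> ereal (t * L)"
      using t by (intro htop_scale_leI) auto
    then have "ereal (1 / real L) * htop_scale X (f ^^ L) E r \<le> ereal (1 / real L) * ereal (t * L)"
      by (intro ereal_mult_left_mono) auto
    then show "ereal (1 / real L) * htop_scale X (f ^^ L) E r \<le> ereal t"
      using L by simp
  qed
  also have "\<dots> \<le> htop X f E" by (rule htop_scale_le_htop[OF r])
  finally have "ereal (real L) * (ereal (1 / real L) * htop_scale X (f ^^ L) E r)
      \<le> ereal (real L) * htop X f E"
    by (intro ereal_mult_left_mono) auto
  moreover have "ereal (real L) * (ereal (1 / real L) * h) = h" for h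
    using L by (cases h) auto
  ultimately show "htop_scale X (f ^^ L) E r \<le> ereal (real L) * htop X f E" by simp
qed

lemma uniform_funpow:
  assumes X: "compact X" "continuous_on X f" "f ` X \<subseteq> X" and "0 < (e::real)"
  obtains d where "0 < d" "\<And>x y l. x \<in> X \<Longrightarrow> y \<in> X \<Longrightarrow> l < (N::nat) \<Longrightarrow> dist x y < d \<Longrightarrow>
    dist ((f ^^ l) x) ((f ^^ l) y) < e"
proof -
  have "\<exists>d>0. \<forall>x\<in>X. \<forall>y\<in>X. \<forall>l<N. dist x y < d \<longrightarrow> dist ((f ^^ l) x) ((f ^^ l) y) < e"
  proof (induction N)
    case 0 then show ?case by (intro exI[of _ 1]) auto
  next
    case (Suc N)
    then obtain d where d: "d > 0" "\<forall>x\<in>X. \<forall>y\<in>X. \<forall>l<N. dist x y < d \<longrightarrow> dist ((f ^^ l) x) ((f ^^ l) y) < e"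
      by auto
    have "uniformly_continuous_on X (f ^^ N)"
      using X by (intro compact_uniformly_continuous continuous_on_funpow)
    then obtain d' where d': "d' > 0" "\<forall>x\<in>X. \<forall>y\<in>X. dist y x < d' \<longrightarrow> dist ((f ^^ N) y) ((f ^^ N) x) < e"
      using assms(4) unfolding uniformly_continuous_on_def by meson
    show ?case
      using d d' by (intro exI[of _ "min d d'"]) (auto simp: less_Suc_eq)
  qed
  then show ?thesis using that by blast
qed

text \<open>A cover of \<open>Y\<close> by \<open>f ^^ L\<close>-balls of length \<open>u\<close> is
  pushed forward by \<open>f ^^ i\<close> for every \<open>i < L\<close> and gives a cover of
  \<open>X\<close> by \<open>f\<close>-balls of length \<open>u * L\<close>. The sum grows by the
  factor \<open>L\<close>, which does not matter because only its vanishing counts.\<close>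

lemma htop_le_funpow:
  assumes X: "compact X" "continuous_on X f" "f ` X \<subseteq> X" and L: "1 \<le> L"
    and XY: "X = (\<Union>i\<in>{..<L}. (f ^^ i) ` Y)" and "Y \<subseteq> X"
  shows "htop X f X \<le> ereal (1 / real L) * htop X (f ^^ L) Y"
proof (rule htop_le)
  fix r :: real assume r: "0 < r"
  \<comment> \<open>Time \<open>k\<close> of the point \<open>(f ^^ i) y\<close> lies
    \<open>k mod L + i < 2 * L\<close> steps after the controlled time \<open>L * (k div L)\<close>
    of \<open>y\<close>.\<close>
  obtain r' where r': "0 < r'" "\<And>x y l. x \<in> X \<Longrightarrow> y \<in> X \<Longrightarrow> l < 2 * L \<Longrightarrow> dist x y < r' \<Longrightarrow>
    dist ((f ^^ l) x) ((f ^^ l) y) < r"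
    using uniform_funpow[OF X r, of "2 * L"] by metis
  have "ereal (real L) * htop_scale X f X r \<le> htop_scale X (f ^^ L) Y r'"
    unfolding htop_scale_def[of X "f ^^ L"]
  proof (rule Inf_greatest, clarify)
    fix t :: real assume t: "0 \<le> t" "bowen_C X (f ^^ L) Y t r' = 0"
    have "bowen_C X f X (t / L) r \<le> of_nat L * bowen_C X (f ^^ L) Y t r'"
    proof (rule bowen_C_le)
      fix n
      have "bowen_C_n X f X (t / L) n r \<le> of_nat L * b" if b: "b = bowen_C_n X (f ^^ L) Y t n r'" for b
      proof -
        have "bowen_C_n X f X (t / L) n r \<le> of_nat L * (\<Sum>\<^sub>\<infinity>(x, u)\<in>I. ennreal (exp (- t * real u)))"
          if I: "I \<in> bowen_covers X (f ^^ L) Y n r'" for I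
        proof (rule bowen_C_n_le_family[where J = "I \<times> {..<L}" and x = "\<lambda>(j, i). (f ^^ i) (fst j)"
              and u = "\<lambda>(j, i). snd j * L"])
          show "countable (I \<times> {..<L})" using I by (auto simp: bowen_covers_def)
          show "(case j of (j, i) \<Rightarrow> (f ^^ i) (fst j)) \<in> X" if "j \<in> I \<times> {..<L}" for j
            using that I funpow_mem[OF X(3)] by (auto simp: bowen_covers_def)
          show "n \<le> (case j of (j, i) \<Rightarrow> snd j * L)" if "j \<in> I \<times> {..<L}" for j
          proof -
            have "n \<le> snd (fst j)" using I that by (auto simp: bowen_covers_def)
            also have "\<dots> \<le> snd (fst j) * L" using L by simp
            finally show ?thesis by (auto simp: case_prod_beta)
          qed
          show "X \<subseteq> (\<Union>j\<in>I \<times> {..<L}. bowen_ball X f (case j of (j, i) \<Rightarrow> snd j * L)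
                 (case j of (j, i) \<Rightarrow> (f ^^ i) (fst j)) r)"
          proof
            fix z assume "z \<in> X"
            then obtain i y where i: "i < L" "y \<in> Y" "z = (f ^^ i) y" using XY by auto
            obtain x u where xu: "(x, u) \<in> I" "y \<in> bowen_ball X (f ^^ L) u x r'"
              using I i(2) unfolding bowen_covers_def by blast
            have xX: "x \<in> X" "y \<in> X" using xu I by (auto simp: bowen_covers_def bowen_ball_def)
            have "dist ((f ^^ k) ((f ^^ i) x)) ((f ^^ k) z) < r" if k: "k < u * L" for k
            proof -
              have q: "k div L < u" using k L by (simp add: less_mult_imp_div_less)
              have "dist (((f ^^ L) ^^ (k div L)) x) (((f ^^ L) ^^ (k div L)) y) < r'"
                using xu(2) q by (simp add: bowen_ball_def)
              moreover have "((f ^^ L) ^^ (k div L)) w \<in> X" if "w \<in> X" for w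
                by (simp add: funpow_mult funpow_mem[OF X(3) that])
              moreover have "k mod L + i < 2 * L"
                using i(1) mod_less_divisor[of L k] by linarith
              ultimately have "dist ((f ^^ (k mod L + i)) (((f ^^ L) ^^ (k div L)) x))
                  ((f ^^ (k mod L + i)) (((f ^^ L) ^^ (k div L)) y)) < r"
                using r'(2) xX by blast
              moreover have "(f ^^ (k mod L + i)) (((f ^^ L) ^^ (k div L)) w) = (f ^^ k) ((f ^^ i) w)" for w
              proof -
                have "k mod L + i + L * (k div L) = k + i" by simp
                then show ?thesis
                  by (metis comp_apply funpow_add funpow_mult)
              qed
              ultimately show ?thesis using i(3) by simp
            qed
            then have "z \<in> bowen_ball X f (u * L) ((f ^^ i) x) r"
              using \<open>z \<in> X\<close> by (simp add: bowen_ball_def)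
            then show "z \<in> (\<Union>j\<in>I \<times> {..<L}. bowen_ball X f (case j of (j, i) \<Rightarrow> snd j * L)
                 (case j of (j, i) \<Rightarrow> (f ^^ i) (fst j)) r)"
              using xu(1) i(1) by force
          qed
          fix F assume F: "finite F" "F \<subseteq> I \<times> {..<L}"
          have "(\<Sum>j\<in>F. ennreal (exp (- (t / real L) * real (case j of (j, i) \<Rightarrow> snd j * L))))
              = (\<Sum>j\<in>F. ennreal (exp (- t * real (snd (fst j)))))"
            using L by (intro sum.cong) (auto simp: field_simps)
          also have "\<dots> \<le> (\<Sum>j\<in>fst ` F \<times> {..<L}. ennreal (exp (- t * real (snd (fst j)))))"
            using F by (intro sum_mono2) force+
          also have "\<dots> = (\<Sum>i\<in>fst ` F. \<Sum>j<L. ennreal (exp (- t * real (snd i))))"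
            by (subst sum.cartesian_product) (auto simp: case_prod_beta)
          also have "\<dots> = of_nat L * (\<Sum>i\<in>fst ` F. (\<lambda>(x, u). ennreal (exp (- t * real u))) i)"
            by (simp only: sum_constant card_lessThan sum_distrib_left case_prod_beta)
          also have "\<dots> \<le> of_nat L * (\<Sum>\<^sub>\<infinity>(x, u)\<in>I. ennreal (exp (- t * real u)))"
            using F by (intro mult_left_mono sum_le_infsum_ennreal) auto
          finally show "(\<Sum>j\<in>F. ennreal (exp (- (t / real L) * real (case j of (j, i) \<Rightarrow> snd j * L))))
             \<le> of_nat L * (\<Sum>\<^sub>\<infinity>(x, u)\<in>I. ennreal (exp (- t * real u)))" .
        qed
        \<comment> \<open>Dividing by \<open>L\<close> isolates the Bowen sum on the right, so that
          the infimum over covers can be taken there.\<close>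
        then have "bowen_C_n X f X (t / L) n r / of_nat L \<le> b"
          unfolding b bowen_C_n_def[of X "f ^^ L"] using L
          by (intro INF_greatest) (simp add: divide_le_posI_ennreal mult.commute)
        then have "of_nat L * (bowen_C_n X f X (t / L) n r / of_nat L) \<le> of_nat L * b"
          by (intro mult_left_mono) auto
        moreover have "of_nat L * (a / of_nat L) = a" for a :: ennreal
          unfolding ennreal_times_divide mult.commute[of "of_nat L"]
          by (rule mult_divide_eq_ennreal) (use L in auto)
        ultimately show ?thesis by simp
      qed
      also have "of_nat L * bowen_C_n X (f ^^ L) Y t n r' \<le> of_nat L * bowen_C X (f ^^ L) Y t r'"
        by (intro mult_left_mono bowen_C_n_le) auto
      finally show "bowen_C_n X f X (t / L) n r \<le> of_nat L * bowen_C X (f ^^ L) Y t r'" by simp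
    qed
    then have "htop_scale X f X r \<le> ereal (t / L)"
      using t by (intro htop_scale_leI) auto
    then have "ereal (real L) * htop_scale X f X r \<le> ereal (real L) * ereal (t / L)"
      by (intro ereal_mult_left_mono) auto
    then show "ereal (real L) * htop_scale X f X r \<le> ereal t" using L by simp
  qed
  also have "\<dots> \<le> htop X (f ^^ L) Y" by (rule htop_scale_le_htop[OF r'(1)])
  finally have "ereal (1 / real L) * (ereal (real L) * htop_scale X f X r)
      \<le> ereal (1 / real L) * htop X (f ^^ L) Y"
    by (intro ereal_mult_left_mono) auto
  moreover have "ereal (1 / real L) * (ereal (real L) * h) = h" for h
    using L by (cases h) auto
  ultimately show "htop_scale X f X r \<le> ereal (1 / real L) * htop X (f ^^ L) Y" by simp
qed

section \<open>Hamming codes of orbits\<close>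

text \<open>Hamming distance of two orbit segments at threshold \<open>r\<close>. Unlike the Bowen
  metric it changes little when few entries are replaced; the price is that its triangle inequality
  halves the threshold.\<close>

definition mismatch :: "('a::metric_space \<Rightarrow> 'a) \<Rightarrow> real \<Rightarrow> nat \<Rightarrow> 'a \<Rightarrow> 'a \<Rightarrow> nat" where
  "mismatch f r n x y = card {i. i < n \<and> r \<le> dist ((f ^^ i) x) ((f ^^ i) y)}"

definition separated :: "('a::metric_space \<Rightarrow> 'a) \<Rightarrow> nat \<Rightarrow> real \<Rightarrow> 'a set \<Rightarrow> bool" where
  "separated f n r E \<longleftrightarrow>
     (\<forall>x\<in>E. \<forall>y\<in>E. x \<noteq> y \<longrightarrow> (\<exists>i<n. r \<le> dist ((f ^^ i) x) ((f ^^ i) y)))"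

lemma separated_subset: "separated f n r E \<Longrightarrow> D \<subseteq> E \<Longrightarrow> separated f n r D"
  unfolding separated_def by blast

text \<open>\<open>c\<close> numbers the cells of a finite partition in which points of the same
  cell are closer than \<open>r\<close>; these numbers are the alphabet of the codes below. The
  bound \<open>Suc (card Z)\<close> keeps \<open>1 \<le> K\<close> for empty
  \<open>X\<close>.\<close>

lemma compact_cells:
  fixes X :: "'a::metric_space set"
  assumes "compact X" "0 < r"
  shows "\<exists>K (c :: 'a \<Rightarrow> nat). 1 \<le> K \<and> (\<forall>x\<in>X. c x < K) \<and>
    (\<forall>x\<in>X. \<forall>y\<in>X. c x = c y \<longrightarrow> dist x y < r)"
proof -
  obtain Z where Z: "finite Z" "Z \<subseteq> X" "X \<subseteq> (\<Union>z\<in>Z. ball z (r / 2))"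
    using compactE_image[OF assms(1), of X "\<lambda>z. ball z (r / 2)"] assms(2) by force
  obtain g where g: "bij_betw g Z {0..<card Z}"
    using ex_bij_betw_finite_nat[OF Z(1)] by auto
  define w where "w = (\<lambda>x. SOME z. z \<in> Z \<and> x \<in> ball z (r / 2))"
  have w: "w x \<in> Z" "x \<in> ball (w x) (r / 2)" if "x \<in> X" for x
  proof -
    have "\<exists>z. z \<in> Z \<and> x \<in> ball z (r / 2)" using Z(3) that by blast
    from someI_ex[OF this] show "w x \<in> Z" "x \<in> ball (w x) (r / 2)" by (auto simp: w_def)
  qed
  show ?thesis
  proof (intro exI[of _ "Suc (card Z)"] exI[of _ "\<lambda>x. g (w x)"] conjI ballI impI)
    show "g (w x) < Suc (card Z)" if "x \<in> X" for x
      using bij_betwE[OF g] w(1)[OF that] by (auto simp: less_Suc_eq)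
    fix x y assume xy: "x \<in> X" "y \<in> X" "g (w x) = g (w y)"
    then have "w x = w y" using g w(1) by (auto simp: bij_betw_def inj_on_def)
    then show "dist x y < r"
      using w(2)[OF xy(1)] w(2)[OF xy(2)] dist_triangle_half_r[of "w x" x r y] by auto
  qed simp
qed

section \<open>Counting points with sparse errors\<close>

lemma card_le_fibres:
  fixes N :: real
  assumes "finite E" "finite S" "\<And>x. x \<in> E \<Longrightarrow> code x \<in> S"
    and "\<And>s. s \<in> S \<Longrightarrow> real (card {x \<in> E. code x = s}) \<le> N"
  shows "real (card E) \<le> real (card S) * N"
proof -
  have "(\<Union>s\<in>S. {x \<in> E. code x = s}) = E" using assms(3) by auto
  then have "card E \<le> (\<Sum>s\<in>S. card {x \<in> E. code x = s})"
    using card_UN_le[OF assms(2), of "\<lambda>s. {x \<in> E. code x = s}"] by simp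
  then have "real (card E) \<le> (\<Sum>s\<in>S. real (card {x \<in> E. code x = s}))"
    unfolding of_nat_sum[symmetric] of_nat_le_iff .
  also have "\<dots> \<le> real (card S) * N"
    using assms(4) by (intro sum_bounded_above) auto
  finally show ?thesis .
qed

text \<open>The weight \<open>x\<close> per nonzero entry is the usual exponential Chebyshev trick.\<close>

lemma card_sparse_functions:
  fixes x :: real
  assumes "finite I" "0 < x" "x \<le> 1"
  shows "real (card {w \<in> I \<rightarrow>\<^sub>E {..K}. card {i \<in> I. w i \<noteq> 0} \<le> q}) * x ^ q \<le> (1 + real K * x) ^ card I"
proof -
  let ?W = "{w \<in> I \<rightarrow>\<^sub>E {..K}. card {i \<in> I. w i \<noteq> 0} \<le> q}"
  let ?g = "\<lambda>k::nat. if k = 0 then 1 else x"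
  have fin: "finite (I \<rightarrow>\<^sub>E {..K})" using assms(1) by (intro finite_PiE) auto
  have "x ^ q \<le> (\<Prod>i\<in>I. ?g (w i))" if "w \<in> ?W" for w
  proof -
    have "(\<Prod>i\<in>I. ?g (w i)) = (\<Prod>i\<in>{i \<in> I. w i \<noteq> 0}. x)"
      using assms(1) by (subst prod.inter_filter) (auto intro!: prod.cong)
    also have "\<dots> = x ^ card {i \<in> I. w i \<noteq> 0}" by simp
    finally show ?thesis using that assms by (simp add: power_decreasing)
  qed
  then have "real (card ?W) * x ^ q \<le> (\<Sum>w\<in>?W. \<Prod>i\<in>I. ?g (w i))"
    by (intro sum_bounded_below) auto
  also have "\<dots> \<le> (\<Sum>w\<in>I \<rightarrow>\<^sub>E {..K}. \<Prod>i\<in>I. ?g (w i))"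
    using fin assms by (intro sum_mono2) (auto intro!: prod_nonneg)
  also have "\<dots> = (\<Prod>i\<in>I. \<Sum>k\<in>{..K}. ?g k)"
    using assms(1) by (subst prod_sum_PiE) auto
  also have "(\<Sum>k\<in>{..K}. ?g k) = 1 + real K * x"
    by (simp add: atMost_atLeast0 sum.atLeast_Suc_atMost)
  finally show ?thesis by simp
qed

text \<open>
  A point is coded by its error positions with respect to \<open>v\<close> and the cells visited there;
  points with equal codes are within \<open>r\<close> of each other along all of \<open>I\<close>.
\<close>

lemma hamming_count:
  fixes u :: "'b \<Rightarrow> nat \<Rightarrow> 'a::metric_space" and N x :: real
  assumes "finite I" "finite E" "0 < x" "x \<le> 1" "0 \<le> N"
    and c: "\<And>y. y \<in> X \<Longrightarrow> c y < K"
      "\<And>y z. y \<in> X \<Longrightarrow> z \<in> X \<Longrightarrow> c y = c z \<Longrightarrow> dist y z < r"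
    and u: "\<And>F i. F \<in> E \<Longrightarrow> i \<in> I \<Longrightarrow> u F i \<in> X"
    and q: "\<And>F. F \<in> E \<Longrightarrow> card {i \<in> I. r / 2 \<le> dist (u F i) (v i)} \<le> q"
    and N: "\<And>D. D \<subseteq> E \<Longrightarrow> (\<And>F G i. F \<in> D \<Longrightarrow> G \<in> D \<Longrightarrow> i \<in> I \<Longrightarrow> dist (u F i) (u G i) < r) \<Longrightarrow>
        real (card D) \<le> N"
  shows "real (card E) * x ^ q \<le> (1 + real K * x) ^ card I * N"
proof -
  define W where "W = {w \<in> I \<rightarrow>\<^sub>E {..K}. card {i \<in> I. w i \<noteq> 0} \<le> q}"
  define code where "code F = restrict (\<lambda>i. if r / 2 \<le> dist (u F i) (v i) then Suc (c (u F i)) else 0) I" for F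
  have "real (card E) \<le> real (card W) * N"
  proof (rule card_le_fibres[where code = code])
    have "finite (I \<rightarrow>\<^sub>E {..K})" using assms(1) by (intro finite_PiE) auto
    then show "finite W" unfolding W_def by simp
    show "code F \<in> W" if "F \<in> E" for F
    proof -
      have "{i \<in> I. code F i \<noteq> 0} = {i \<in> I. r / 2 \<le> dist (u F i) (v i)}"
        by (auto simp: code_def)
      then show ?thesis
        using q[OF that] c(1)[OF u[OF that]] by (auto simp: W_def code_def Suc_le_eq)
    qed
    fix s assume "s \<in> W"
    show "real (card {F \<in> E. code F = s}) \<le> N"
    proof (rule N)
      fix F G i assume FG: "F \<in> {F \<in> E. code F = s}" "G \<in> {F \<in> E. code F = s}" "i \<in> I"
      then have eq: "code F i = code G i" by simp
      show "dist (u F i) (u G i) < r"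
      proof (cases "r / 2 \<le> dist (u F i) (v i)")
        case True
        then have "c (u F i) = c (u G i)" using eq FG(3) by (auto simp: code_def split: if_splits)
        then show ?thesis using c(2) u FG by auto
      next
        case False
        then have "\<not> r / 2 \<le> dist (u G i) (v i)" using eq FG(3) by (auto simp: code_def split: if_splits)
        then show ?thesis
          using False dist_triangle_half_l[of "u F i" "v i" r "u G i"] by simp
      qed
    qed auto
  qed (use assms in auto)
  then have "real (card E) * x ^ q \<le> real (card W) * N * x ^ q"
    using assms by (intro mult_right_mono) auto
  also have "\<dots> = (real (card W) * x ^ q) * N" by simp
  also have "\<dots> \<le> (1 + real K * x) ^ card I * N"
    unfolding W_def using card_sparse_functions[OF assms(1,3,4)] assms by (intro mult_right_mono) auto
  finally show ?thesis .
qed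

text \<open>The Chebyshev weight \<open>x\<close> is taken so small that
  \<open>(1 + K * x) ^ n\<close> uses at most half of the exponent \<open>\<kappa> * p\<close>; then
  \<eta> is taken so small that the loss \<open>q * (- ln x)\<close> from \<open>x ^ q\<close> uses
  at most the other half.\<close>

lemma hamming_rate:
  fixes \<kappa> :: real and K :: nat
  assumes "0 < \<kappa>"
  shows "\<exists>x \<eta> :: real. 0 < x \<and> x \<le> 1 \<and> 0 < \<eta> \<and>
    (\<forall>p n q. n \<le> p \<longrightarrow> real q \<le> \<eta> * real p \<longrightarrow> (1 + real K * x) ^ n \<le> exp (\<kappa> * real p) * x ^ q)"
proof -
  define x where "x = min 1 (\<kappa> / (2 * (real K + 1)))"
  \<comment> \<open>With \<open>1 - ln x\<close> instead of \<open>- ln x\<close> the denominator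
    stays positive for \<open>x = 1\<close>.\<close>
  define \<eta> where "\<eta> = \<kappa> / (2 * (1 - ln x))"
  have x: "0 < x" "x \<le> 1" using assms by (auto simp: x_def)
  then have lx: "ln x \<le> 0" by simp
  then have \<eta>: "0 < \<eta>" using assms by (simp add: \<eta>_def)
  have "real K * x \<le> real K * (\<kappa> / (2 * (real K + 1)))" by (intro mult_left_mono) (auto simp: x_def)
  also have "\<dots> \<le> \<kappa> / 2" using assms by (simp add: field_simps)
  finally have Kx: "real K * x \<le> \<kappa> / 2" .
  show ?thesis
  proof (rule exI[of _ x], rule exI[of _ \<eta>], intro conjI x \<eta> allI impI)
    fix p n q :: nat assume np: "n \<le> p" and q: "real q \<le> \<eta> * real p"
    have "(1 + real K * x) ^ n \<le> exp (real K * x) ^ n"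
      using x by (intro power_mono exp_ge_add_one_self) auto
    also have "\<dots> = exp (real n * (real K * x))" by (simp add: exp_of_nat_mult)
    also have "\<dots> \<le> exp (real p * (\<kappa> / 2))"
      using np Kx x by (intro exp_le_cancel_iff[THEN iffD2] mult_mono) auto
    also have "\<dots> \<le> exp (\<kappa> * real p + real q * ln x)"
    proof -
      have "real q * (- ln x) \<le> real q * (1 - ln x)" by (simp add: field_simps)
      also have "\<dots> \<le> \<eta> * real p * (1 - ln x)" using q lx by (intro mult_right_mono) auto
      also have "\<dots> = real p * (\<kappa> / 2)" using lx by (simp add: \<eta>_def field_simps)
      finally show ?thesis by (simp add: algebra_simps)
    qed
    also have "\<dots> = exp (\<kappa> * real p) * x ^ q"
      using x by (simp add: exp_add exp_of_nat_mult)
    finally show "(1 + real K * x) ^ n \<le> exp (\<kappa> * real p) * x ^ q" .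
  qed
qed

text \<open>Greedy choice: keep a point, discard the at most \<open>B\<close> points near it, and
  repeat. Each kept point accounts for at most \<open>B\<close> points of \<open>E\<close>.\<close>

lemma spread_subset:
  fixes B :: real
  assumes "finite E" and refl: "\<And>F. near F F" and sym: "\<And>F G. near F G \<Longrightarrow> near G F"
    and "\<And>G. G \<in> E \<Longrightarrow> real (card {F \<in> E. near F G}) \<le> B"
  shows "\<exists>D\<subseteq>E. (\<forall>F\<in>D. \<forall>G\<in>D. F \<noteq> G \<longrightarrow> \<not> near F G) \<and> real (card E) \<le> B * real (card D)"
  using assms(1,4)
proof (induction E rule: finite_psubset_induct)
  case (psubset E)
  show ?case
  proof (cases "E = {}")
    case False
    then obtain G where G: "G \<in> E" by auto
    define E' where "E' = {F \<in> E. \<not> near F G}"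
    have sub: "E' \<subset> E" using G refl by (auto simp: E'_def)
    have B: "real (card {F \<in> E'. near F H}) \<le> B" if "H \<in> E'" for H
    proof -
      have "card {F \<in> E'. near F H} \<le> card {F \<in> E. near F H}"
        using psubset.hyps by (intro card_mono) (auto simp: E'_def)
      then show ?thesis using psubset.prems[of H] that by (auto simp: E'_def)
    qed
    obtain D where D: "D \<subseteq> E'" "\<forall>F\<in>D. \<forall>G\<in>D. F \<noteq> G \<longrightarrow> \<not> near F G"
      "real (card E') \<le> B * real (card D)"
      using psubset.IH[OF sub B] by blast
    have "finite D" using finite_subset[OF D(1)] psubset.hyps by (simp add: E'_def)
    have "G \<notin> D" using D(1) refl by (auto simp: E'_def)
    have "{F \<in> E. near F G} \<union> E' = E" by (auto simp: E'_def)
    then have "card E \<le> card {F \<in> E. near F G} + card E'"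
      using card_Un_le[of "{F \<in> E. near F G}" E'] by simp
    then have "real (card E) \<le> B + B * real (card D)"
      using psubset.prems[OF G] D(3) by linarith
    also have "\<dots> = B * real (card (insert G D))"
      using \<open>finite D\<close> \<open>G \<notin> D\<close> by (simp add: algebra_simps)
    finally have "real (card E) \<le> B * real (card (insert G D))" .
    moreover have "\<not> near F G \<and> \<not> near G F" if "F \<in> D" for F
      using that D(1) sym by (auto simp: E'_def)
    moreover have "insert G D \<subseteq> E" using D(1) G by (auto simp: E'_def)
    ultimately show ?thesis using D(2) by (intro exI[of _ "insert G D"]) auto
  qed auto
qed

lemma eventually_linear_le_exp:
  fixes a C :: real
  assumes "0 < a" "0 \<le> C"
  shows "\<forall>\<^sub>F p in sequentially. C * (real p + 1) \<le> exp (a * real p)"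
proof (rule eventually_sequentiallyI)
  fix p :: nat assume p: "nat \<lceil>4 * C / a\<^sup>2\<rceil> + 1 \<le> p"
  then have "4 * C / a\<^sup>2 \<le> real p" by linarith
  then have "4 * C \<le> a\<^sup>2 * real p" using assms by (simp add: field_simps)
  then have "4 * C * real p \<le> a\<^sup>2 * real p * real p" by (intro mult_right_mono) auto
  moreover have "C * (real p + 1) \<le> 2 * C * real p"
    using p mult_left_mono[of 1 "real p" C] assms by (simp add: algebra_simps)
  ultimately have "C * (real p + 1) \<le> (a * real p)\<^sup>2 / 2"
    unfolding power_mult_distrib by (simp add: power2_eq_square)
  also have "\<dots> \<le> exp (a * real p)"
  proof -
    have "0 \<le> a * real p" using assms by simp
    then show ?thesis using exp_lower_Taylor_quadratic[of "a * real p"] by linarith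
  qed
  finally show "C * (real p + 1) \<le> exp (a * real p)" .
qed

lemma mismatch_comm: "mismatch f r n x y = mismatch f r n y x"
  by (simp add: mismatch_def dist_commute)

lemma mismatch_antimono:
  assumes "r \<le> r'"
  shows "mismatch f r' n x y \<le> mismatch f r n x y"
  unfolding mismatch_def using assms by (intro card_mono) auto

text \<open>Combines \<open>hamming_count\<close> and \<open>hamming_rate\<close> with the constants
  \<open>K\<close> and \<open>x\<close> hidden: points that follow a common reference sequence along
  \<open>I\<close> with at most \<open>\<eta> * p\<close> errors are, up to a factor
  \<open>exp (\<kappa> * p)\<close>, no more numerous than points indistinguishable along
  \<open>I\<close>. The reference \<open>v\<close> need not be an orbit, which
  \<open>self_overlap_card\<close> exploits, and \<open>I\<close> may be any window.\<close>

definition sparse_error_bound :: "'a::metric_space set \<Rightarrow> real \<Rightarrow> real \<Rightarrow> real \<Rightarrow> bool" where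
  "sparse_error_bound X r \<kappa> \<eta> \<longleftrightarrow>
     (\<forall>p I E (u :: 'a \<Rightarrow> nat \<Rightarrow> 'a) v N.
        finite I \<and> card I \<le> p \<and> finite E \<and> 0 \<le> N \<and> (\<forall>F\<in>E. \<forall>i\<in>I. u F i \<in> X) \<and>
        (\<forall>F\<in>E. real (card {i \<in> I. r / 2 \<le> dist (u F i) (v i)}) \<le> \<eta> * real p) \<and>
        (\<forall>D\<subseteq>E. (\<forall>F\<in>D. \<forall>G\<in>D. \<forall>i\<in>I. dist (u F i) (u G i) < r) \<longrightarrow> real (card D) \<le> N)
        \<longrightarrow> real (card E) \<le> exp (\<kappa> * real p) * N)"

lemma exists_sparse_error_bound:
  assumes "compact X" "0 < r" "0 < \<kappa>"
  shows "\<exists>\<eta>>0. sparse_error_bound X r \<kappa> \<eta>"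
proof -
  obtain K :: nat and c :: "'a \<Rightarrow> nat" where c: "1 \<le> K" "\<forall>y\<in>X. c y < K"
    "\<forall>y\<in>X. \<forall>z\<in>X. c y = c z \<longrightarrow> dist y z < r"
    using compact_cells[OF assms(1,2)] by blast
  obtain x \<eta> :: real where x: "0 < x" "x \<le> 1" "0 < \<eta>"
    and rate: "\<forall>p n q. n \<le> p \<longrightarrow> real q \<le> \<eta> * real p \<longrightarrow>
      (1 + real K * x) ^ n \<le> exp (\<kappa> * real p) * x ^ q"
    using hamming_rate[OF assms(3), of K] by blast
  have "sparse_error_bound X r \<kappa> \<eta>"
    unfolding sparse_error_bound_def
  proof (intro allI impI, elim conjE)
    fix p I E and u :: "'a \<Rightarrow> nat \<Rightarrow> 'a" and v N
    assume I: "finite I" "card I \<le> p" and E: "finite E" and N: "0 \<le> N"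
      and u: "\<forall>F\<in>E. \<forall>i\<in>I. u F i \<in> X"
      and q: "\<forall>F\<in>E. real (card {i \<in> I. r / 2 \<le> dist (u F i) (v i)}) \<le> \<eta> * real p"
      and D: "\<forall>D\<subseteq>E. (\<forall>F\<in>D. \<forall>G\<in>D. \<forall>i\<in>I. dist (u F i) (u G i) < r) \<longrightarrow> real (card D) \<le> N"
    define q' where "q' = nat \<lfloor>\<eta> * real p\<rfloor>"
    have q': "real q' \<le> \<eta> * real p" using x by (simp add: q'_def)
    have qb: "card {i \<in> I. r / 2 \<le> dist (u F i) (v i)} \<le> q'" if "F \<in> E" for F
      unfolding q'_def using q that by (intro le_nat_floor) auto
    have "real (card E) * x ^ q' \<le> (1 + real K * x) ^ card I * N"
      by (rule hamming_count[where u = u and v = v and c = c, OF I(1) E x(1,2) N c(2,3)[rule_format] _ qb])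
        (use u D in auto)
    also have "\<dots> \<le> exp (\<kappa> * real p) * x ^ q' * N"
      using rate[rule_format, OF I(2) q'] N by (intro mult_right_mono) auto
    finally have "real (card E) * x ^ q' \<le> (exp (\<kappa> * real p) * N) * x ^ q'"
      by (simp add: mult.commute mult.left_commute)
    then show "real (card E) \<le> exp (\<kappa> * real p) * N"
      using x by simp
  qed
  with x(3) show ?thesis by auto
qed

lemma sparse_error_boundD:
  fixes u :: "'a::metric_space \<Rightarrow> nat \<Rightarrow> 'a"
  assumes "sparse_error_bound X r \<kappa> \<eta>" "finite I" "card I \<le> p" "finite E" "0 \<le> N"
    "\<And>F i. F \<in> E \<Longrightarrow> i \<in> I \<Longrightarrow> u F i \<in> X"
    "\<And>F. F \<in> E \<Longrightarrow> real (card {i \<in> I. r / 2 \<le> dist (u F i) (v i)}) \<le> \<eta> * real p"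
    "\<And>D. D \<subseteq> E \<Longrightarrow> (\<And>F G i. F \<in> D \<Longrightarrow> G \<in> D \<Longrightarrow> i \<in> I \<Longrightarrow> dist (u F i) (u G i) < r) \<Longrightarrow>
        real (card D) \<le> N"
  shows "real (card E) \<le> exp (\<kappa> * real p) * N"
proof (rule assms(1)[unfolded sparse_error_bound_def, THEN spec, THEN spec, THEN spec, THEN spec,
      THEN spec, THEN spec, THEN mp])
  show "finite I \<and> card I \<le> p \<and> finite E \<and> 0 \<le> N \<and> (\<forall>F\<in>E. \<forall>i\<in>I. u F i \<in> X) \<and>
      (\<forall>F\<in>E. real (card {i \<in> I. r / 2 \<le> dist (u F i) (v i)}) \<le> \<eta> * real p) \<and>
      (\<forall>D\<subseteq>E. (\<forall>F\<in>D. \<forall>G\<in>D. \<forall>i\<in>I. dist (u F i) (u G i) < r) \<longrightarrow> real (card D) \<le> N)"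
    using assms(2-7) by (intro conjI allI impI assms(8)) auto
qed

section \<open>Blocks that overlap themselves or a given block\<close>

locale dynamics =
  fixes X :: "'a::metric_space set" and f :: "'a \<Rightarrow> 'a"
  assumes compact_X: "compact X" and cont_f: "continuous_on X f" and f_into: "f ` X \<subseteq> X"
begin

lemma orbit_mem: "x \<in> X \<Longrightarrow> (f ^^ i) x \<in> X"
  using funpow_mem[OF f_into] by blast

lemma funpow_shift: "(f ^^ i) ((f ^^ j) x) = (f ^^ (i + j)) x"
  by (simp add: funpow_add)

lemma separated_close_card:
  assumes "separated f n r E" "\<And>x y i. x \<in> E \<Longrightarrow> y \<in> E \<Longrightarrow> i < n \<Longrightarrow> dist ((f ^^ i) x) ((f ^^ i) y) < r"
  shows "card E \<le> 1"
proof -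
  have "\<forall>x\<in>E. \<forall>y\<in>E. x = y" using assms unfolding separated_def by (meson not_less)
  then show ?thesis by (cases "finite E") (auto simp: card_le_Suc0_iff_eq)
qed

text \<open>
  If the orbit of \<open>A\<close> is Hamming-close to its own shift by \<open>s\<close>, then on blocks of length \<open>J * s\<close>
  it is nearly \<open>s\<close>-periodic, so the first \<open>s\<close> entries of every block determine \<open>A\<close> up to sparse errors.
\<close>

lemma self_overlap_card:
  assumes "0 < r" "1 \<le> J" "0 < s"
    and c: "1 \<le> K" "\<And>y. y \<in> X \<Longrightarrow> c y < K"
      "\<And>y z. y \<in> X \<Longrightarrow> z \<in> X \<Longrightarrow> c y = c z \<Longrightarrow> dist y z < r / 4"
    and err: "sparse_error_bound X r \<kappa> \<eta>"
    and E: "finite E" "E \<subseteq> X" "separated f p r E"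
    and self: "\<And>A. A \<in> E \<Longrightarrow> real J * real (mismatch f (r / (4 * real J)) (p - s) ((f ^^ s) A) A) \<le> \<eta> * real p"
  shows "real (card E) \<le> exp (ln (real K) * (real p / real J + real s)) * exp (\<kappa> * real p)"
proof -
  \<comment> \<open>Position \<open>i\<close> is compared with \<open>base i\<close>, the place of
    the same residue modulo \<open>s\<close> among the first \<open>s\<close> entries of its block
    of length \<open>J * s\<close>. Fewer than \<open>J\<close> jumps by \<open>s\<close> lead from
    there to \<open>i\<close>, so jumps of distance below \<rho> add up to at most
    \<open>r / 4\<close>; the cells contribute another \<open>r / 4\<close>.\<close>
  define \<rho> where "\<rho> = r / (4 * real J)"
  define P where "P = {i. i < p \<and> i mod (J * s) < s}"
  define base where "base i = i - ((i mod (J * s)) div s) * s" for i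
  define code where "code A = restrict (\<lambda>i. c ((f ^^ i) A)) P" for A
  define S where "S = P \<rightarrow>\<^sub>E {..<K}"
  have \<rho>: "0 < \<rho>" using assms by (simp add: \<rho>_def)
  have finP: "finite P" by (simp add: P_def)
  have Js: "0 < J * s" using assms by simp
  have "card P \<le> card ({..p div (J * s)} \<times> {..<s})"
  proof (rule card_inj_on_le[where f = "\<lambda>i. (i div (J * s), i mod (J * s))"])
    show "inj_on (\<lambda>i. (i div (J * s), i mod (J * s))) P"
      by (rule inj_onI) (metis Pair_inject div_mult_mod_eq)
    show "(\<lambda>i. (i div (J * s), i mod (J * s))) ` P \<subseteq> {..p div (J * s)} \<times> {..<s}"
      by (auto simp: P_def intro!: div_le_mono)
  qed auto
  then have "card P \<le> Suc (p div (J * s)) * s" by simp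
  also have "real \<dots> \<le> real p / real J + real s"
  proof -
    have "p div (J * s) * (J * s) \<le> p" by (rule div_times_less_eq_dividend)
    then have "real (p div (J * s) * s) * real J \<le> real p"
      by (metis (no_types, lifting) mult.assoc mult.commute of_nat_le_iff of_nat_mult)
    then have "real (p div (J * s) * s) \<le> real p / real J"
      using assms by (simp add: field_simps)
    then show ?thesis by simp
  qed
  finally have cardP: "real (card P) \<le> real p / real J + real s" by simp
  have cardS: "real (card S) = real K ^ card P"
    unfolding S_def using finP by (simp add: card_PiE)
  also have "\<dots> = exp (real (card P) * ln (real K))"
    using c(1) by (simp add: exp_of_nat_mult)
  also have "\<dots> \<le> exp (ln (real K) * (real p / real J + real s))"
  proof -
    have "real (card P) * ln (real K) \<le> (real p / real J + real s) * ln (real K)"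
      using cardP c(1) by (intro mult_right_mono) auto
    then show ?thesis by (simp only: exp_le_cancel_iff mult.commute[of "ln (real K)"])
  qed
  finally have S: "real (card S) \<le> exp (ln (real K) * (real p / real J + real s))" .
  have base: "\<exists>j<J. i = base i + j * s \<and> base i \<in> P" if "i < p" for i
  proof -
    let ?m = "i mod (J * s)"
    have "?m div s < J" using mod_less_divisor[OF Js, of i] by (simp add: less_mult_imp_div_less)
    moreover have le: "(?m div s) * s \<le> ?m" "?m \<le> i" by (simp_all add: div_times_less_eq_dividend)
    moreover have "base i mod (J * s) = ?m mod s"
    proof -
      have "i = (i div (J * s)) * (J * s) + ((?m div s) * s + ?m mod s)"
        by (metis div_mult_mod_eq)
      then have "base i = (i div (J * s)) * (J * s) + ?m mod s"
        unfolding base_def by linarith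
      moreover have "?m mod s < J * s"
      proof (rule less_le_trans[OF mod_less_divisor[OF \<open>0 < s\<close>]])
        show "s \<le> J * s" using assms(2) by simp
      qed
      ultimately show ?thesis by simp
    qed
    ultimately show ?thesis
      using that assms(3) le[THEN order_trans] unfolding P_def
      by (intro exI[of _ "?m div s"]) (auto simp: base_def)
  qed
  have fib: "real (card {A \<in> E. code A = w}) \<le> exp (\<kappa> * real p)" for w
  proof (cases "{A \<in> E. code A = w} = {}")
    case False
    then obtain A' where A': "A' \<in> E" "code A' = w" by auto
    \<comment> \<open>A fibre has a common reference sequence, read off from any of its members
      \<open>A'\<close>. Members that cannot be told apart along \<open>{..<p}\<close> coincide by
      separation, hence the bound 1.\<close>
    have "real (card {A \<in> E. code A = w}) \<le> exp (\<kappa> * real p) * 1"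
    proof (rule sparse_error_boundD[OF err, where I = "{..<p}" and u = "\<lambda>A i. (f ^^ i) A"
          and v = "\<lambda>i. (f ^^ base i) A'"])
      fix A assume A: "A \<in> {A \<in> E. code A = w}"
      define Bd where "Bd = {i. i < p - s \<and> \<rho> \<le> dist ((f ^^ i) ((f ^^ s) A)) ((f ^^ i) A)}"
      have AX: "A \<in> X" "A' \<in> X" using A A' E by auto
      \<comment> \<open>Position \<open>i\<close> can be an error only if one of the jumps from
        \<open>base i\<close> to \<open>i\<close> is bad. Thus each bad jump spoils fewer than
        \<open>J\<close> positions, whence the factor \<open>J\<close> in the assumption on the
        self-mismatch.\<close>
      have sub: "{i \<in> {..<p}. r / 2 \<le> dist ((f ^^ i) A) ((f ^^ base i) A')}
          \<subseteq> (\<Union>k\<in>{1..<J}. (\<lambda>i. i + k * s) ` Bd)"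
      proof
        fix i assume i: "i \<in> {i \<in> {..<p}. r / 2 \<le> dist ((f ^^ i) A) ((f ^^ base i) A')}"
        obtain j where j: "j < J" "i = base i + j * s" "base i \<in> P" using base i by auto
        show "i \<in> (\<Union>k\<in>{1..<J}. (\<lambda>i. i + k * s) ` Bd)"
        proof (rule ccontr)
          assume no: "i \<notin> (\<Union>k\<in>{1..<J}. (\<lambda>i. i + k * s) ` Bd)"
          have "dist ((f ^^ (base i + l * s)) A) ((f ^^ base i) A) \<le> real l * \<rho>" if "l \<le> j" for l
            using that
          proof (induction l)
            case (Suc l)
            have i_eq: "i = (base i + l * s) + (j - l) * s"
            proof -
              have "j = l + (j - l)" using Suc.prems by simp
              then have "j * s = l * s + (j - l) * s" by (metis add_mult_distrib)
              then show ?thesis using j(2) by linarith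
            qed
            have "base i + l * s \<notin> Bd"
            proof
              assume "base i + l * s \<in> Bd"
              then have "i \<in> (\<lambda>i. i + (j - l) * s) ` Bd" using i_eq by (rule rev_image_eqI)
              then show False using no Suc.prems j(1) by force
            qed
            moreover have "base i + l * s < p - s"
            proof -
              have "1 * s \<le> (j - l) * s" using Suc.prems by (intro mult_le_mono1) simp
              moreover have "i < p" using i by simp
              ultimately show ?thesis using i_eq by linarith
            qed
            ultimately have "dist ((f ^^ (base i + l * s + s)) A) ((f ^^ (base i + l * s)) A) < \<rho>"
              by (simp add: Bd_def funpow_shift)
            then have "dist ((f ^^ (base i + Suc l * s)) A) ((f ^^ base i) A) \<le> \<rho> + real l * \<rho>"
              using Suc dist_triangle[of "(f ^^ (base i + Suc l * s)) A" "(f ^^ base i) A" "(f ^^ (base i + l * s)) A"]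
              by (simp add: add.commute add.left_commute)
            then show ?case by (simp add: algebra_simps)
          qed auto
          from this[of j] have "dist ((f ^^ i) A) ((f ^^ base i) A) \<le> real j * \<rho>"
            using j(2) by simp
          also have "\<dots> \<le> real J * \<rho>" using j(1) \<rho> by (intro mult_right_mono) auto
          also have "\<dots> = r / 4" using assms by (simp add: \<rho>_def)
          finally have 1: "dist ((f ^^ i) A) ((f ^^ base i) A) \<le> r / 4" .
          have "code A (base i) = code A' (base i)" using A A' by simp
          then have "dist ((f ^^ base i) A) ((f ^^ base i) A') < r / 4"
            using j(3) AX by (intro c(3) orbit_mem) (auto simp: code_def)
          then show False
            using 1 i dist_triangle[of "(f ^^ i) A" "(f ^^ base i) A'" "(f ^^ base i) A"] by simp
        qed
      qed
      have finB: "finite Bd" by (simp add: Bd_def)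
      have "card {i \<in> {..<p}. r / 2 \<le> dist ((f ^^ i) A) ((f ^^ base i) A')}
          \<le> card (\<Union>k\<in>{1..<J}. (\<lambda>i. i + k * s) ` Bd)"
        using finB by (intro card_mono[OF _ sub]) auto
      also have "\<dots> \<le> (\<Sum>k\<in>{1..<J}. card ((\<lambda>i. i + k * s) ` Bd))"
        by (rule card_UN_le) auto
      also have "\<dots> \<le> (\<Sum>k\<in>{1..<J}. card Bd)"
        by (intro sum_mono card_image_le finB)
      also have "\<dots> \<le> J * card Bd" by simp
      finally have "real (card {i \<in> {..<p}. r / 2 \<le> dist ((f ^^ i) A) ((f ^^ base i) A')})
          \<le> real J * real (card Bd)"
        by (simp only: of_nat_mult[symmetric] of_nat_le_iff)
      also have "\<dots> \<le> \<eta> * real p"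
        using self[of A] A by (simp add: mismatch_def Bd_def \<rho>_def)
      finally show "real (card {i \<in> {..<p}. r / 2 \<le> dist ((f ^^ i) A) ((f ^^ base i) A')}) \<le> \<eta> * real p" .
    next
      fix D assume D: "D \<subseteq> {A \<in> E. code A = w}"
        "\<And>F G i. F \<in> D \<Longrightarrow> G \<in> D \<Longrightarrow> i \<in> {..<p} \<Longrightarrow> dist ((f ^^ i) F) ((f ^^ i) G) < r"
      have "D \<subseteq> E" using D(1) by auto
      then have "card D \<le> 1"
        using D(2) by (intro separated_close_card[OF separated_subset[OF E(3)]]) auto
      then show "real (card D) \<le> 1" by simp
    qed (use E orbit_mem in auto)
    then show ?thesis by simp
  next
    case True
    then show ?thesis by (simp only: card.empty of_nat_0 exp_ge_zero)
  qed
  have "real (card E) \<le> real (card S) * exp (\<kappa> * real p)"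
  proof (rule card_le_fibres[where code = code])
    show "finite S" unfolding S_def using finP by (intro finite_PiE) auto
    show "code A \<in> S" if "A \<in> E" for A
      using that E c(2) orbit_mem by (auto simp: S_def code_def)
  qed (use E fib in auto)
  also have "\<dots> \<le> exp (ln (real K) * (real p / real J + real s)) * exp (\<kappa> * real p)"
    using S by (intro mult_right_mono) auto
  finally show ?thesis .
qed

text \<open>The last \<open>p - s\<close> entries of \<open>F\<close> follow the first
  \<open>p - s\<close> entries of \<open>A\<close> up to few errors. Blocks indistinguishable there
  must be separated within their first \<open>s\<close> entries, so only these entries remain free,
  and \<open>N\<close> bounds their number.\<close>

lemma overlap_left_card:
  assumes err: "sparse_error_bound X r \<kappa> \<eta>" and "\<rho> \<le> r / 2" "s \<le> p" "0 \<le> N"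
    and E: "finite E" "E \<subseteq> X"
    and small: "\<And>F. F \<in> E \<Longrightarrow> real (mismatch f \<rho> (p - s) ((f ^^ s) F) A) \<le> \<eta> * real p"
    and N: "\<And>D. D \<subseteq> E \<Longrightarrow> separated f s r D \<Longrightarrow> real (card D) \<le> N"
    and sep: "separated f p r E"
  shows "real (card E) \<le> exp (\<kappa> * real p) * N"
proof (rule sparse_error_boundD[OF err, where I = "{..<p - s}" and u = "\<lambda>F i. (f ^^ i) ((f ^^ s) F)"
      and v = "\<lambda>i. (f ^^ i) A"])
  fix F assume F: "F \<in> E"
  have "{i \<in> {..<p - s}. r / 2 \<le> dist ((f ^^ i) ((f ^^ s) F)) ((f ^^ i) A)}
      = {i. i < p - s \<and> r / 2 \<le> dist ((f ^^ i) ((f ^^ s) F)) ((f ^^ i) A)}" by auto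
  then show "real (card {i \<in> {..<p - s}. r / 2 \<le> dist ((f ^^ i) ((f ^^ s) F)) ((f ^^ i) A)}) \<le> \<eta> * real p"
    using small[OF F] mismatch_antimono[OF assms(2), of f "p - s" "(f ^^ s) F" A]
    by (simp add: mismatch_def)
next
  fix D assume D: "D \<subseteq> E" "\<And>F G i. F \<in> D \<Longrightarrow> G \<in> D \<Longrightarrow> i \<in> {..<p - s} \<Longrightarrow>
      dist ((f ^^ i) ((f ^^ s) F)) ((f ^^ i) ((f ^^ s) G)) < r"
  have "separated f s r D"
    unfolding separated_def
  proof (intro ballI impI)
    fix F G assume FG: "F \<in> D" "G \<in> D" "F \<noteq> G"
    then obtain i where i: "i < p" "r \<le> dist ((f ^^ i) F) ((f ^^ i) G)"
      using sep D(1) unfolding separated_def by blast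
    have "i < s"
    proof (rule ccontr)
      assume "\<not> i < s"
      then have "dist ((f ^^ (i - s)) ((f ^^ s) F)) ((f ^^ (i - s)) ((f ^^ s) G)) < r"
        using i FG by (intro D(2)) auto
      then show False using i \<open>\<not> i < s\<close> by (simp add: funpow_shift)
    qed
    then show "\<exists>i<s. r \<le> dist ((f ^^ i) F) ((f ^^ i) G)" using i by auto
  qed
  then show "real (card D) \<le> N" using N D(1) by blast
qed (use E assms orbit_mem in auto)

text \<open>Mirror image: the end of \<open>A\<close> fixes the first \<open>s\<close> entries of
  \<open>F\<close>. The free entries start at time \<open>s\<close>, so the count concerns the
  points \<open>(f ^^ s) F\<close>, for which separation is again measured from time 0; separation
  also makes \<open>f ^^ s\<close> injective on indistinguishable blocks.\<close>

lemma overlap_right_card: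
  assumes err: "sparse_error_bound X r \<kappa> \<eta>" and "\<rho> \<le> r / 2" "s \<le> p" "0 \<le> N" "0 < r"
    and E: "finite E" "E \<subseteq> X"
    and small: "\<And>F. F \<in> E \<Longrightarrow> real (mismatch f \<rho> s F ((f ^^ (p - s)) A)) \<le> \<eta> * real p"
    and N: "\<And>D. D \<subseteq> E \<Longrightarrow> separated f (p - s) r ((f ^^ s) ` D) \<Longrightarrow> real (card ((f ^^ s) ` D)) \<le> N"
    and sep: "separated f p r E"
  shows "real (card E) \<le> exp (\<kappa> * real p) * N"
proof (rule sparse_error_boundD[OF err, where I = "{..<s}" and u = "\<lambda>F i. (f ^^ i) F"
      and v = "\<lambda>i. (f ^^ i) ((f ^^ (p - s)) A)"])
  fix F assume F: "F \<in> E"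
  have "{i \<in> {..<s}. r / 2 \<le> dist ((f ^^ i) F) ((f ^^ i) ((f ^^ (p - s)) A))}
      = {i. i < s \<and> r / 2 \<le> dist ((f ^^ i) F) ((f ^^ i) ((f ^^ (p - s)) A))}" by auto
  then show "real (card {i \<in> {..<s}. r / 2 \<le> dist ((f ^^ i) F) ((f ^^ i) ((f ^^ (p - s)) A))}) \<le> \<eta> * real p"
    using small[OF F] mismatch_antimono[OF assms(2), of f s F "(f ^^ (p - s)) A"]
    by (simp add: mismatch_def)
next
  fix D assume D: "D \<subseteq> E" "\<And>F G i. F \<in> D \<Longrightarrow> G \<in> D \<Longrightarrow> i \<in> {..<s} \<Longrightarrow>
      dist ((f ^^ i) F) ((f ^^ i) G) < r"
  have far: "\<exists>i<p - s. r \<le> dist ((f ^^ i) ((f ^^ s) F)) ((f ^^ i) ((f ^^ s) G))"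
    if FG: "F \<in> D" "G \<in> D" "F \<noteq> G" for F G
  proof -
    obtain i where i: "i < p" "r \<le> dist ((f ^^ i) F) ((f ^^ i) G)"
      using sep D(1) FG unfolding separated_def by blast
    then have "s \<le> i" using D(2)[OF FG(1,2), of i] by force
    then show ?thesis using i by (intro exI[of _ "i - s"]) (auto simp: funpow_shift)
  qed
  have "inj_on (f ^^ s) D"
  proof (rule inj_onI, rule ccontr)
    fix F G assume "F \<in> D" "G \<in> D" "(f ^^ s) F = (f ^^ s) G" "F \<noteq> G"
    then show False using far[of F G] \<open>0 < r\<close> by auto
  qed
  moreover have "separated f (p - s) r ((f ^^ s) ` D)"
    unfolding separated_def using far by blast
  ultimately show "real (card D) \<le> N" using N[OF D(1)] by (simp add: card_image)
qed (use E assms orbit_mem in auto)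

end

section \<open>Markers\<close>

text \<open>
  The last three clauses ensure that, in a concatenation of blocks from \<open>insert A E\<close> without two
  adjacent copies of \<open>A\<close>, no window of length \<open>p\<close> other than the occurrences of \<open>A\<close> resembles \<open>A\<close>:
  such a window always has a long overlap with a block from \<open>E\<close>, unless it is
  a copy of \<open>A\<close> shifted by less than \<open>\<beta> * p\<close>.
\<close>

definition marked_family ::
  "('a::metric_space \<Rightarrow> 'a) \<Rightarrow> real \<Rightarrow> real \<Rightarrow> real \<Rightarrow> real \<Rightarrow> nat \<Rightarrow> 'a \<Rightarrow> 'a set \<Rightarrow> bool" where
  "marked_family f r \<rho> \<eta> \<beta> p A E \<longleftrightarrow>
     (\<forall>F\<in>E. \<forall>G\<in>E. F \<noteq> G \<longrightarrow> \<eta> * real p \<le> real (mismatch f (r / 2) p F G)) \<and>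
     (\<forall>F\<in>E. \<forall>s\<le>p. real s \<le> (1 - \<beta>) * real p \<longrightarrow>
        \<eta> * real p \<le> real (mismatch f \<rho> (p - s) ((f ^^ s) F) A)) \<and>
     (\<forall>F\<in>E. \<forall>s\<le>p. \<beta> * real p \<le> real s \<longrightarrow>
        \<eta> * real p \<le> real (mismatch f \<rho> s F ((f ^^ (p - s)) A))) \<and>
     (\<forall>s. 0 < s \<longrightarrow> real s < \<beta> * real p \<longrightarrow>
        \<eta> * real p \<le> real (mismatch f \<rho> (p - s) ((f ^^ s) A) A))"

lemma card_UN_le_real:
  fixes B :: real
  assumes "finite S" "\<And>s. s \<in> S \<Longrightarrow> real (card (A s)) \<le> B" "real (card S) \<le> n" "0 \<le> B"
  shows "real (card (\<Union>s\<in>S. A s)) \<le> n * B"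
proof -
  have "real (card (\<Union>s\<in>S. A s)) \<le> real (\<Sum>s\<in>S. card (A s))"
    using card_UN_le[OF assms(1), of A] by (simp only: of_nat_le_iff)
  also have "\<dots> = (\<Sum>s\<in>S. real (card (A s)))" by simp
  also have "\<dots> \<le> real (card S) * B" using assms(2) by (rule sum_bounded_above)
  also have "\<dots> \<le> n * B" using assms by (intro mult_right_mono) auto
  finally show ?thesis .
qed

context dynamics
begin

text \<open>From a large separated set everything that violates a clause is discarded; the discarded
  classes have exponential rates below \<open>h\<close>. The upper growth bound is required on the
  invariant set \<open>V\<close> because the shifted blocks in \<open>overlap_right_card\<close> may
  leave \<open>Y\<close>.\<close>

lemma exists_marked_family:
  assumes V: "V \<subseteq> X" "f ` V \<subseteq> V" and Y: "Y \<subseteq> V" and r: "0 < r" and h: "0 < h" "t < h"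
    and upper: "\<And>\<tau>. h < \<tau> \<Longrightarrow> \<exists>C. \<forall>n E. E \<subseteq> V \<longrightarrow> finite E \<longrightarrow> separated f n r E \<longrightarrow>
        real (card E) \<le> C * exp (\<tau> * real n)"
    and lower: "\<And>\<tau> p0. \<tau> < h \<Longrightarrow> \<exists>p\<ge>p0. \<exists>E\<subseteq>Y. L dvd p \<and> finite E \<and> separated f p r E \<and>
        exp (\<tau> * real p) \<le> real (card E)"
  shows "\<exists>\<rho> \<eta> \<beta>. 0 < \<rho> \<and> 0 < \<eta> \<and> 0 < \<beta> \<and> \<beta> < 1 / 2 \<and>
    (\<forall>p0. \<exists>p\<ge>p0. L dvd p \<and> (\<exists>A\<in>Y. \<exists>E\<subseteq>Y. finite E \<and> exp (t * real p) \<le> real (card E) \<and>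
       marked_family f r \<rho> \<eta> \<beta> p A E))"
proof -
  obtain K :: nat and c :: "'a \<Rightarrow> nat" where c: "1 \<le> K" "\<forall>y\<in>X. c y < K"
    "\<forall>y\<in>X. \<forall>z\<in>X. c y = c z \<longrightarrow> dist y z < r / 4"
    using compact_cells[OF compact_X, of "r / 4"] r by auto
  \<comment> \<open>\<open>J\<close> makes nearly periodic blocks rare: for
    \<open>s \<le> p / J\<close> the exponent \<open>ln K * (p / J + s)\<close> of
    \<open>self_overlap_card\<close> is at most \<open>h / 4 * p\<close>.\<close>
  define J where "J = nat \<lceil>8 * ln (real K) / h\<rceil> + 1"
  have J: "1 \<le> J" "ln (real K) * (2 / real J) \<le> h / 4"
  proof -
    have "8 * ln (real K) / h \<le> real J" unfolding J_def by linarith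
    then show "ln (real K) * (2 / real J) \<le> h / 4"
      using h by (simp add: J_def field_simps)
  qed (simp add: J_def)
  \<comment> \<open>Shifts below \<open>\<beta> * p\<close> satisfy \<open>s \<le> p / J\<close> and
    are handled by near periodicity; otherwise an overlap of length at least
    \<open>\<beta> * p\<close> with another block is available.\<close>
  define \<beta> where "\<beta> = 1 / (4 * real J)"
  have \<beta>: "0 < \<beta>" "\<beta> < 1 / 2" "\<beta> \<le> 1 / real J"
    using J(1) by (auto simp: \<beta>_def field_simps)
  \<comment> \<open>The three bounds serve, in order, the exclusion of overlaps with
    \<open>A\<close>, the existence of \<open>A\<close>, and the passage from the rate
    \<open>h - \<gamma>\<close> of \<open>E0\<close> to the rate \<open>t\<close> of the final
    set.\<close>
  define \<gamma> where "\<gamma> = min (h * \<beta> / 8) (min (h / 16) ((h - t) / 4))"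
  have \<gamma>: "0 < \<gamma>" "\<gamma> \<le> h * \<beta> / 8" "\<gamma> \<le> h / 16" "\<gamma> \<le> (h - t) / 4"
  proof -
    have "0 < h * \<beta>" using h \<beta> by simp
    then show "0 < \<gamma>" using h by (simp add: \<gamma>_def)
    show "\<gamma> \<le> h * \<beta> / 8" unfolding \<gamma>_def by (rule min.cobounded1)
    have "\<gamma> \<le> min (h / 16) ((h - t) / 4)" unfolding \<gamma>_def by (rule min.cobounded2)
    then show "\<gamma> \<le> h / 16" "\<gamma> \<le> (h - t) / 4" by (simp_all only: min.bounded_iff)
  qed
  obtain \<eta>0 where \<eta>0: "0 < \<eta>0" and err: "sparse_error_bound X r \<gamma> \<eta>0"
    using exists_sparse_error_bound[OF compact_X r \<gamma>(1)] by auto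
  obtain C where "\<forall>n E. E \<subseteq> V \<longrightarrow> finite E \<longrightarrow> separated f n r E \<longrightarrow>
        real (card E) \<le> C * exp ((h + \<gamma>) * real n)"
    using upper[of "h + \<gamma>"] \<gamma>(1) by auto
  note C = this[rule_format]
  have C0: "0 \<le> C" using C[of "{}" 0] by (simp add: separated_def)
  \<comment> \<open>The division by \<open>J\<close> pays for the factor \<open>J\<close> in
    \<open>self_overlap_card\<close>; the other counts only need
    \<open>\<eta> \<le> \<eta>0\<close>.\<close>
  define \<eta> where "\<eta> = \<eta>0 / real J"
  define \<rho> where "\<rho> = r / (4 * real J)"
  have \<eta>: "0 < \<eta>" "\<eta> \<le> \<eta>0" "real J * \<eta> = \<eta>0" using \<eta>0 J(1) by (auto simp: \<eta>_def field_simps)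
  have \<rho>: "0 < \<rho>" "\<rho> \<le> r / 2"
  proof -
    show "0 < \<rho>" using r J(1) by (simp add: \<rho>_def)
    have "r * 2 \<le> r * (4 * real J)" using r J(1) by (intro mult_left_mono) auto
    then show "\<rho> \<le> r / 2" using J(1) by (simp add: \<rho>_def field_simps)
  qed
  have "\<forall>\<^sub>F p in sequentially. 1 * (real p + 1) \<le> exp (h / 2 * real p) \<and>
      (4 * C) * (real p + 1) \<le> exp (h * \<beta> / 2 * real p) \<and> 2 * (real p + 1) \<le> exp ((h - t) / 2 * real p)"
    using h \<beta> C0 by (intro eventually_conj eventually_linear_le_exp) auto
  \<comment> \<open>The three exponentials absorb, in order, the number of shifts in the choice of
    \<open>A\<close>, the number of shifts in both kinds of overlap together with \<open>C\<close>,
    and a factor 2 in the final count.\<close>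
  then obtain p1 where p1': "\<forall>p\<ge>p1. 1 * (real p + 1) \<le> exp (h / 2 * real p) \<and>
      (4 * C) * (real p + 1) \<le> exp (h * \<beta> / 2 * real p) \<and> 2 * (real p + 1) \<le> exp ((h - t) / 2 * real p)"
    unfolding eventually_sequentially by blast
  have p1: "real p + 1 \<le> exp (h / 2 * real p)"
    "(4 * C) * (real p + 1) \<le> exp (h * \<beta> / 2 * real p)"
    "2 * (real p + 1) \<le> exp ((h - t) / 2 * real p)" if "p \<ge> p1" for p
    using p1'[rule_format, OF that] by simp_all
  have main: "\<exists>p\<ge>p0. L dvd p \<and> (\<exists>A\<in>Y. \<exists>E\<subseteq>Y. finite E \<and> exp (t * real p) \<le> real (card E) \<and>
       marked_family f r \<rho> \<eta> \<beta> p A E)" for p0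
  proof -
    obtain p E0 where p: "max p0 p1 \<le> p" "L dvd p" and E0: "E0 \<subseteq> Y" "finite E0" "separated f p r E0"
      "exp ((h - \<gamma>) * real p) \<le> real (card E0)"
      using lower[of "h - \<gamma>" "max p0 p1"] \<gamma>(1) by auto
    have E0V: "E0 \<subseteq> V" "E0 \<subseteq> X" using E0 Y V by auto
    note pp = p1[of p]
    \<comment> \<open>The blocks resembling one of their own small shifts do not exhaust
      \<open>E0\<close>, so some \<open>A\<close> remains. Only for this fixed \<open>A\<close> are
      overlaps with other blocks counted afterwards.\<close>
    define bad where "bad s = {A \<in> E0. real (mismatch f \<rho> (p - s) ((f ^^ s) A) A) < \<eta> * real p}" for s
    define S where "S = {s. 0 < s \<and> real s < \<beta> * real p}"
    have Sp: "S \<subseteq> {..<p}"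
    proof
      fix s assume "s \<in> S"
      then have "real s < \<beta> * real p" by (simp add: S_def)
      also have "\<dots> \<le> 1 * real p" using \<beta> by (intro mult_right_mono) auto
      finally show "s \<in> {..<p}" by simp
    qed
    have bad: "real (card (bad s)) \<le> exp ((h / 4 + \<gamma>) * real p)" if s: "s \<in> S" for s
    proof -
      have "real (card (bad s)) \<le> exp (ln (real K) * (real p / real J + real s)) * exp (\<gamma> * real p)"
      proof (rule self_overlap_card[OF r J(1) _ c(1) _ _ err])
        show "finite (bad s)" "bad s \<subseteq> X" using E0 E0V by (auto simp: bad_def)
        show "separated f p r (bad s)"
          by (rule separated_subset[OF E0(3)]) (auto simp: bad_def)
        show "real J * real (mismatch f (r / (4 * real J)) (p - s) ((f ^^ s) A) A) \<le> \<eta>0 * real p"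
          if "A \<in> bad s" for A
        proof -
          have "real J * real (mismatch f \<rho> (p - s) ((f ^^ s) A) A) \<le> real J * (\<eta> * real p)"
            using that by (intro mult_left_mono) (auto simp: bad_def)
          also have "\<dots> = \<eta>0 * real p" using \<eta>(3) by (simp add: mult.assoc[symmetric])
          finally show ?thesis by (simp add: \<rho>_def)
        qed
      qed (use s c in \<open>auto simp: S_def\<close>)
      also have "\<dots> = exp (ln (real K) * (real p / real J + real s) + \<gamma> * real p)"
        by (simp add: exp_add)
      also have "\<dots> \<le> exp ((h / 4 + \<gamma>) * real p)"
      proof -
        have "real s \<le> \<beta> * real p" using s by (simp add: S_def)
        also have "\<dots> \<le> 1 / real J * real p" using \<beta> by (intro mult_right_mono) auto
        finally have "real s \<le> real p / real J" by simp
        moreover have "2 / real J * real p = real p / real J + real p / real J" by simp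
        ultimately have "real p / real J + real s \<le> 2 / real J * real p" by linarith
        then have "ln (real K) * (real p / real J + real s) \<le> ln (real K) * (2 / real J * real p)"
          using c(1) by (intro mult_left_mono) auto
        also have "\<dots> = ln (real K) * (2 / real J) * real p" by simp
        also have "\<dots> \<le> h / 4 * real p" using J(2) by (rule mult_right_mono) simp
        finally show ?thesis by (simp add: algebra_simps)
      qed
      finally show ?thesis .
    qed
    have "real (card (\<Union>s\<in>S. bad s)) \<le> real p * exp ((h / 4 + \<gamma>) * real p)"
    proof (rule card_UN_le_real[OF _ bad])
      show "finite S" using Sp by (rule finite_subset) simp
      show "real (card S) \<le> real p" using card_mono[OF _ Sp] by simp
    qed auto
    also have "\<dots> < (real p + 1) * exp ((h / 4 + \<gamma>) * real p)" by simp
    also have "\<dots> \<le> exp (h / 2 * real p) * exp ((h / 4 + \<gamma>) * real p)"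
      using pp(1) p(1) by (intro mult_right_mono) auto
    also have "\<dots> = exp ((h / 2 + h / 4 + \<gamma>) * real p)" by (simp add: exp_add[symmetric] algebra_simps)
    also have "\<dots> \<le> exp ((h - \<gamma>) * real p)"
      using \<gamma> h by (auto intro!: mult_right_mono)
    finally have "real (card (\<Union>s\<in>S. bad s)) < real (card E0)" using E0(4) by linarith
    moreover have "card E0 \<le> card (\<Union>s\<in>S. bad s)" if "E0 \<subseteq> (\<Union>s\<in>S. bad s)"
      using that E0(2) finite_subset[OF Sp] by (intro card_mono) (auto simp: bad_def)
    ultimately obtain A where A: "A \<in> E0" "A \<notin> (\<Union>s\<in>S. bad s)" by fastforce
    \<comment> \<open>Bound for a single shift: at most \<open>(1 - \<beta>) * p\<close> entries of
      an overlapping block are free.\<close>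
    define B where "B = exp (\<gamma> * real p) * (C * exp ((h + \<gamma>) * ((1 - \<beta>) * real p)))"
    have B0: "0 \<le> B" using C0 by (simp add: B_def)
    have le_exp: "C * exp ((h + \<gamma>) * real n) \<le> C * exp ((h + \<gamma>) * ((1 - \<beta>) * real p))"
      if "real n \<le> (1 - \<beta>) * real p" for n
      using that C0 h \<gamma>(1) by (intro mult_left_mono) auto
    define bl where "bl s = {F \<in> E0. real (mismatch f \<rho> (p - s) ((f ^^ s) F) A) < \<eta> * real p}" for s
    define br where "br s = {F \<in> E0. real (mismatch f \<rho> s F ((f ^^ (p - s)) A)) < \<eta> * real p}" for s
    define Sl where "Sl = {s. s \<le> p \<and> real s \<le> (1 - \<beta>) * real p}"
    define Sr where "Sr = {s. s \<le> p \<and> \<beta> * real p \<le> real s}"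
    have \<eta>p: "\<eta> * real p \<le> \<eta>0 * real p" using \<eta>(2) by (intro mult_right_mono) auto
    have bl: "real (card (bl s)) \<le> B" if s: "s \<in> Sl" for s
      unfolding B_def
    proof (rule overlap_left_card[OF err \<rho>(2)])
      show "finite (bl s)" "bl s \<subseteq> X" using E0 E0V by (auto simp: bl_def)
      show "separated f p r (bl s)"
        by (rule separated_subset[OF E0(3)]) (auto simp: bl_def)
      show "real (mismatch f \<rho> (p - s) ((f ^^ s) F) A) \<le> \<eta>0 * real p" if "F \<in> bl s" for F
        using that \<eta>p by (auto simp: bl_def)
      show "real (card D) \<le> C * exp ((h + \<gamma>) * ((1 - \<beta>) * real p))" if "D \<subseteq> bl s" "separated f s r D" for D
      proof (rule order_trans[OF C le_exp])
        show "D \<subseteq> V" "finite D" using that(1) E0V E0(2) by (auto simp: bl_def intro: finite_subset)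
        show "real s \<le> (1 - \<beta>) * real p" using s by (simp add: Sl_def)
      qed (rule that(2))
    qed (use s C0 in \<open>auto simp: Sl_def\<close>)
    have br: "real (card (br s)) \<le> B" if s: "s \<in> Sr" for s
      unfolding B_def
    proof (rule overlap_right_card[OF err \<rho>(2)])
      show "finite (br s)" "br s \<subseteq> X" using E0 E0V by (auto simp: br_def)
      show "separated f p r (br s)"
        by (rule separated_subset[OF E0(3)]) (auto simp: br_def)
      show "real (mismatch f \<rho> s F ((f ^^ (p - s)) A)) \<le> \<eta>0 * real p" if "F \<in> br s" for F
        using that \<eta>p by (auto simp: br_def)
      show "real (card ((f ^^ s) ` D)) \<le> C * exp ((h + \<gamma>) * ((1 - \<beta>) * real p))"
        if "D \<subseteq> br s" "separated f (p - s) r ((f ^^ s) ` D)" for D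
      proof (rule order_trans[OF C le_exp])
        have "D \<subseteq> V" "finite D" using that(1) E0V E0(2) by (auto simp: br_def intro: finite_subset)
        then show "(f ^^ s) ` D \<subseteq> V" "finite ((f ^^ s) ` D)" using funpow_mem[OF V(2)] by auto
        show "real (p - s) \<le> (1 - \<beta>) * real p" using s by (simp add: Sr_def of_nat_diff algebra_simps)
      qed (rule that(2))
    qed (use s C0 r in \<open>auto simp: Sr_def\<close>)
    define bads where "bads = (\<Union>s\<in>Sl. bl s) \<union> (\<Union>s\<in>Sr. br s)"
    have fS: "finite Sl" "finite Sr" by (auto simp: Sl_def Sr_def)
    have cS: "real (card Sl) \<le> real p + 1" "real (card Sr) \<le> real p + 1"
    proof -
      have "Sl \<subseteq> {..p}" "Sr \<subseteq> {..p}" by (auto simp: Sl_def Sr_def)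
      then have "card Sl \<le> Suc p" "card Sr \<le> Suc p" by (metis card_atMost card_mono finite_atMost)+
      then show "real (card Sl) \<le> real p + 1" "real (card Sr) \<le> real p + 1" by linarith+
    qed
    have "card bads \<le> card (\<Union>s\<in>Sl. bl s) + card (\<Union>s\<in>Sr. br s)"
      unfolding bads_def by (rule card_Un_le)
    then have "real (card bads) \<le> (real p + 1) * B + (real p + 1) * B"
      using card_UN_le_real[of Sl bl B "real p + 1", OF fS(1) bl cS(1) B0]
        card_UN_le_real[of Sr br B "real p + 1", OF fS(2) br cS(2) B0] by linarith
    then have "2 * real (card bads) \<le> (4 * C * (real p + 1)) * exp ((\<gamma> + (h + \<gamma>) * (1 - \<beta>)) * real p)"
    proof -
      have "(\<gamma> + (h + \<gamma>) * (1 - \<beta>)) * real p = \<gamma> * real p + (h + \<gamma>) * ((1 - \<beta>) * real p)"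
        by (simp only: distrib_right[of \<gamma>] mult.assoc)
      then have B_eq: "B = C * exp ((\<gamma> + (h + \<gamma>) * (1 - \<beta>)) * real p)"
        unfolding B_def by (simp add: exp_add)
      have "2 * real (card bads) \<le> 4 * (real p + 1) * B"
        using \<open>real (card bads) \<le> _\<close> by linarith
      also have "\<dots> = (4 * C * (real p + 1)) * exp ((\<gamma> + (h + \<gamma>) * (1 - \<beta>)) * real p)"
        unfolding B_eq by simp
      finally show ?thesis .
    qed
    also have "\<dots> \<le> exp (h * \<beta> / 2 * real p) * exp ((\<gamma> + (h + \<gamma>) * (1 - \<beta>)) * real p)"
      using pp(2) p(1) by (intro mult_right_mono) auto
    also have "\<dots> = exp ((h * \<beta> / 2 + \<gamma> + (h + \<gamma>) * (1 - \<beta>)) * real p)"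
      by (simp add: exp_add[symmetric] algebra_simps)
    \<comment> \<open>Of the gain \<open>h * \<beta>\<close> from the overlap, one half was spent on
      the prefactor; the other half covers the terms in \<gamma>, as
      \<open>\<gamma> \<le> h * \<beta> / 8\<close>.\<close>
    also have "\<dots> \<le> exp ((h - \<gamma>) * real p)"
    proof -
      have "0 \<le> \<gamma> * \<beta>" "0 \<le> h * \<beta>" using \<gamma>(1) \<beta>(1) h by auto
      then have "h * \<beta> / 2 + \<gamma> + (h + \<gamma>) * (1 - \<beta>) \<le> h - \<gamma>"
        using \<gamma>(2) by (simp add: algebra_simps)
      then show ?thesis by (simp add: mult_right_mono)
    qed
    finally have bads: "2 * real (card bads) \<le> exp ((h - \<gamma>) * real p)" .
    define E1 where "E1 = E0 - bads"
    have "card E0 \<le> card (E1 \<union> bads)"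
      using E0(2) fS by (intro card_mono) (auto simp: E1_def bads_def bl_def br_def)
    also have "\<dots> \<le> card E1 + card bads" by (rule card_Un_le)
    finally have E1: "exp ((h - \<gamma>) * real p) \<le> 2 * real (card E1)"
      using E0(4) bads by linarith
    \<comment> \<open>\<open>E0\<close> is separated only in the Bowen sense, where one entry
      suffices. A Hamming ball at threshold \<open>r / 2\<close> contains at most
      \<open>exp (\<gamma> * p)\<close> of its blocks, so passing to a Hamming-separated subset is
      cheap.\<close>
    define near where "near F G \<longleftrightarrow> real (mismatch f (r / 2) p F G) \<le> \<eta>0 * real p" for F G
    have "\<exists>D\<subseteq>E1. (\<forall>F\<in>D. \<forall>G\<in>D. F \<noteq> G \<longrightarrow> \<not> near F G) \<and> real (card E1) \<le> exp (\<gamma> * real p) * real (card D)"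
    proof (rule spread_subset)
      show "finite E1" using E0(2) by (simp add: E1_def)
      show "near F F" for F using r \<eta>0 by (simp add: near_def mismatch_def)
      show "near G F" if "near F G" for F G using that by (simp add: near_def mismatch_comm)
      fix G
      have "real (card {F \<in> E1. near F G}) \<le> exp (\<gamma> * real p) * 1"
      proof (rule sparse_error_boundD[OF err, where I = "{..<p}" and u = "\<lambda>F i. (f ^^ i) F"
            and v = "\<lambda>i. (f ^^ i) G"])
        show "real (card {i \<in> {..<p}. r / 2 \<le> dist ((f ^^ i) F) ((f ^^ i) G)}) \<le> \<eta>0 * real p"
          if "F \<in> {F \<in> E1. near F G}" for F
          using that by (simp add: near_def mismatch_def)
        fix D assume D: "D \<subseteq> {F \<in> E1. near F G}" "\<And>F G i. F \<in> D \<Longrightarrow> G \<in> D \<Longrightarrow> i \<in> {..<p} \<Longrightarrow>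
          dist ((f ^^ i) F) ((f ^^ i) G) < r"
        have "card D \<le> 1"
          using D by (intro separated_close_card[OF separated_subset[OF E0(3)]]) (auto simp: E1_def)
        then show "real (card D) \<le> 1" by simp
      qed (use E0(2) E0V orbit_mem in \<open>auto simp: E1_def\<close>)
      then show "real (card {F \<in> E1. near F G}) \<le> exp (\<gamma> * real p)" by simp
    qed
    then obtain D where D: "D \<subseteq> E1" "\<And>F G. F \<in> D \<Longrightarrow> G \<in> D \<Longrightarrow> F \<noteq> G \<Longrightarrow> \<not> near F G"
      "real (card E1) \<le> exp (\<gamma> * real p) * real (card D)" by blast
    have "exp (t * real p) * exp (\<gamma> * real p) * 2 \<le> exp ((h - \<gamma>) * real p)"
    proof -
      have "2 \<le> exp ((h - t) / 2 * real p)" using pp(3) p(1) by simp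
      then have "exp (t * real p) * exp (\<gamma> * real p) * 2
          \<le> exp (t * real p) * exp (\<gamma> * real p) * exp ((h - t) / 2 * real p)"
        by (intro mult_left_mono) auto
      also have "\<dots> = exp ((t + \<gamma> + (h - t) / 2) * real p)"
        by (simp add: exp_add[symmetric] algebra_simps add_divide_distrib diff_divide_distrib)
      also have "\<dots> \<le> exp ((h - \<gamma>) * real p)"
      proof -
        have "t + \<gamma> + (h - t) / 2 \<le> h - \<gamma>" using \<gamma>(4) by (simp add: field_simps)
        then show ?thesis by (simp add: mult_right_mono)
      qed
      finally show ?thesis .
    qed
    also have "\<dots> \<le> exp (\<gamma> * real p) * real (card D) * 2" using E1 D(3) by linarith
    finally have "exp (\<gamma> * real p) * (exp (t * real p) * 2) \<le> exp (\<gamma> * real p) * (real (card D) * 2)"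
      by (simp add: mult.commute mult.left_commute)
    then have cardD: "exp (t * real p) \<le> real (card D)" by simp
    have "marked_family f r \<rho> \<eta> \<beta> p A D"
      unfolding marked_family_def
    proof (intro conjI ballI allI impI)
      fix F G assume "F \<in> D" "G \<in> D" "F \<noteq> G"
      then show "\<eta> * real p \<le> real (mismatch f (r / 2) p F G)"
        using D(2)[of F G] \<eta>p by (simp add: near_def)
    next
      fix F s assume "F \<in> D" "s \<le> p" "real s \<le> (1 - \<beta>) * real p"
      then have "F \<in> E0" "F \<notin> bl s" using D(1) by (auto simp: E1_def bads_def Sl_def)
      then show "\<eta> * real p \<le> real (mismatch f \<rho> (p - s) ((f ^^ s) F) A)" by (simp add: bl_def)
    next
      fix F s assume "F \<in> D" "s \<le> p" "\<beta> * real p \<le> real s"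
      then have "F \<in> E0" "F \<notin> br s" using D(1) by (auto simp: E1_def bads_def Sr_def)
      then show "\<eta> * real p \<le> real (mismatch f \<rho> s F ((f ^^ (p - s)) A))" by (simp add: br_def)
    next
      fix s :: nat assume "0 < s" "real s < \<beta> * real p"
      then have "A \<notin> bad s" using A(2) by (auto simp: S_def)
      then show "\<eta> * real p \<le> real (mismatch f \<rho> (p - s) ((f ^^ s) A) A)" using A(1) by (simp add: bad_def)
    qed
    moreover have "finite D" using D(1) E0(2) by (auto simp: E1_def intro: finite_subset)
    moreover have "A \<in> Y" "D \<subseteq> Y" using A(1) D(1) E0(1) by (auto simp: E1_def)
    ultimately show ?thesis using p cardD by (intro exI[of _ p]) auto
  qed
  show ?thesis
    by (rule exI[of _ \<rho>], rule exI[of _ \<eta>], rule exI[of _ \<beta>]) (use \<rho>(1) \<eta>(1) \<beta>(1,2) main in auto)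
qed

end

section \<open>Entropy of correlated points\<close>

lemma mismatch_triangle:
  "mismatch f r n x z \<le> mismatch f (r / 2) n x y + mismatch f (r / 2) n y z"
proof -
  let ?S = "\<lambda>u v. {i. i < n \<and> r / 2 \<le> dist ((f ^^ i) u) ((f ^^ i) v)}"
  have "{i. i < n \<and> r \<le> dist ((f ^^ i) x) ((f ^^ i) z)} \<subseteq> ?S x y \<union> ?S y z"
  proof
    fix i assume i: "i \<in> {i. i < n \<and> r \<le> dist ((f ^^ i) x) ((f ^^ i) z)}"
    then have "r \<le> dist ((f ^^ i) x) ((f ^^ i) y) + dist ((f ^^ i) y) ((f ^^ i) z)"
      using dist_triangle[of "(f ^^ i) x" "(f ^^ i) z" "(f ^^ i) y"] by simp
    then have "r / 2 \<le> dist ((f ^^ i) x) ((f ^^ i) y) \<or> r / 2 \<le> dist ((f ^^ i) y) ((f ^^ i) z)"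
      by linarith
    then show "i \<in> ?S x y \<union> ?S y z" using i by auto
  qed
  then have "mismatch f r n x z \<le> card (?S x y \<union> ?S y z)"
    unfolding mismatch_def by (intro card_mono) auto
  also have "\<dots> \<le> card (?S x y) + card (?S y z)" by (rule card_Un_le)
  finally show ?thesis by (simp add: mismatch_def)
qed

lemma mismatch_window:
  assumes "s + n \<le> p"
  shows "mismatch f r n ((f ^^ s) x) ((f ^^ s) y) \<le> mismatch f r p x y"
  unfolding mismatch_def
proof (rule card_inj_on_le[where f = "\<lambda>i. i + s"])
  show "(\<lambda>i. i + s) ` {i. i < n \<and> r \<le> dist ((f ^^ i) ((f ^^ s) x)) ((f ^^ i) ((f ^^ s) y))}
      \<subseteq> {i. i < p \<and> r \<le> dist ((f ^^ i) x) ((f ^^ i) y)}"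
    using assms by (auto simp: funpow_add)
qed auto

text \<open>The window at offset \<open>s\<close> meets the last \<open>p - s\<close> entries of
  block \<open>j\<close> and the first \<open>s\<close> entries of block \<open>j + 1\<close>. One
  of these parts falls under a clause of \<open>marked_family\<close> and has
  \<open>\<eta> * p\<close> mismatches with \<open>A\<close>, of which shadowing can hide at most
  half. Such a clause always exists because no two copies of \<open>A\<close> are adjacent.\<close>

lemma marked_family_window:
  assumes mf: "marked_family f r \<rho> \<eta> \<beta> p A E" and \<beta>: "\<beta> < 1 / 2"
    and \<omega>: "\<And>j. \<omega> j \<in> insert A E" "\<And>j. \<omega> j = A \<Longrightarrow> \<omega> (Suc j) \<in> E"
    and shadow: "\<And>j. real (mismatch f (\<rho> / 2) p ((f ^^ (j * p)) x) (\<omega> j)) \<le> \<eta> / 2 * real p"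
    and s: "s < p" "s = 0 \<Longrightarrow> \<omega> j \<in> E"
  shows "\<eta> / 2 * real p \<le> real (mismatch f (\<rho> / 2) p ((f ^^ (j * p + s)) x) A)"
proof -
  let ?y = "(f ^^ (j * p + s)) x"
  have left: ?thesis if "\<eta> * real p \<le> real (mismatch f \<rho> (p - s) ((f ^^ s) (\<omega> j)) A)"
  proof -
    have y: "?y = (f ^^ s) ((f ^^ (j * p)) x)" by (metis add.commute comp_apply funpow_add)
    have "mismatch f \<rho> (p - s) ((f ^^ s) (\<omega> j)) A
        \<le> mismatch f (\<rho> / 2) (p - s) ((f ^^ s) (\<omega> j)) ?y + mismatch f (\<rho> / 2) (p - s) ?y A"
      by (rule mismatch_triangle)
    moreover have "mismatch f (\<rho> / 2) (p - s) ((f ^^ s) (\<omega> j)) ?y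
        \<le> mismatch f (\<rho> / 2) p (\<omega> j) ((f ^^ (j * p)) x)"
      unfolding y using s by (intro mismatch_window) simp
    moreover have "mismatch f (\<rho> / 2) p (\<omega> j) ((f ^^ (j * p)) x) = mismatch f (\<rho> / 2) p ((f ^^ (j * p)) x) (\<omega> j)"
      by (rule mismatch_comm)
    moreover have "mismatch f (\<rho> / 2) (p - s) ?y A \<le> mismatch f (\<rho> / 2) p ?y A"
      using mismatch_window[of 0 "p - s" p f "\<rho> / 2" ?y A] by simp
    ultimately show ?thesis using that shadow[of j] by linarith
  qed
  have right: ?thesis if "\<eta> * real p \<le> real (mismatch f \<rho> s (\<omega> (Suc j)) ((f ^^ (p - s)) A))"
  proof -
    let ?z = "(f ^^ (Suc j * p)) x"
    have z: "?z = (f ^^ (p - s)) ?y"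
    proof -
      have "Suc j * p = (p - s) + (j * p + s)" using s(1) by simp
      then show ?thesis by (metis comp_apply funpow_add)
    qed
    have "mismatch f \<rho> s (\<omega> (Suc j)) ((f ^^ (p - s)) A)
        \<le> mismatch f (\<rho> / 2) s (\<omega> (Suc j)) ?z + mismatch f (\<rho> / 2) s ?z ((f ^^ (p - s)) A)"
      by (rule mismatch_triangle)
    moreover have "mismatch f (\<rho> / 2) s (\<omega> (Suc j)) ?z \<le> mismatch f (\<rho> / 2) p (\<omega> (Suc j)) ?z"
      using mismatch_window[of 0 s p f "\<rho> / 2" "\<omega> (Suc j)" ?z] s(1) by simp
    moreover have "mismatch f (\<rho> / 2) p (\<omega> (Suc j)) ?z = mismatch f (\<rho> / 2) p ?z (\<omega> (Suc j))"
      by (rule mismatch_comm)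
    moreover have "mismatch f (\<rho> / 2) s ?z ((f ^^ (p - s)) A) \<le> mismatch f (\<rho> / 2) p ?y A"
      unfolding z using s(1) by (intro mismatch_window) simp
    ultimately show ?thesis using that shadow[of "Suc j"] by linarith
  qed
  have mf1: "F \<in> E \<Longrightarrow> real s \<le> (1 - \<beta>) * real p \<Longrightarrow>
      \<eta> * real p \<le> real (mismatch f \<rho> (p - s) ((f ^^ s) F) A)" for F
    using mf s(1) unfolding marked_family_def by (meson less_imp_le)
  have mf2: "F \<in> E \<Longrightarrow> \<beta> * real p \<le> real s \<Longrightarrow>
      \<eta> * real p \<le> real (mismatch f \<rho> s F ((f ^^ (p - s)) A))" for F
    using mf s(1) unfolding marked_family_def by (meson less_imp_le)
  have mf3: "0 < s' \<Longrightarrow> real s' < \<beta> * real p \<Longrightarrow>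
      \<eta> * real p \<le> real (mismatch f \<rho> (p - s') ((f ^^ s') A) A)" for s'
    using mf unfolding marked_family_def by blast
  \<comment> \<open>Because \<open>\<beta> < 1 / 2\<close>, an offset beyond
    \<open>(1 - \<beta>) * p\<close> is at least \<open>\<beta> * p\<close>, so the next block can
    be used when the current one cannot.\<close>
  have half: "\<beta> * real p \<le> (1 - \<beta>) * real p" using \<beta> by (intro mult_right_mono) auto
  show ?thesis
  proof (cases "\<omega> j \<in> E")
    case True
    show ?thesis
    proof (cases "real s \<le> (1 - \<beta>) * real p")
      case True
      then show ?thesis using left mf1 \<open>\<omega> j \<in> E\<close> by blast
    next
      case big: False
      show ?thesis
      proof (cases "\<omega> (Suc j) \<in> E")
        case True
        then show ?thesis using right mf2 big half by (meson le_less_trans less_imp_le not_le)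
      next
        case False
        then have "\<omega> (Suc j) = A" using \<omega>(1)[of "Suc j"] by blast
        \<comment> \<open>The next block is \<open>A\<close>, and the window starts
          \<open>p - s\<close> steps before this copy; the self-overlap clause applies to that small
          shift.\<close>
        moreover have "real (p - s) < \<beta> * real p" using big s(1) by (simp add: of_nat_diff algebra_simps)
        ultimately show ?thesis
          using right mf3[of "p - s"] s(1) by (simp add: mismatch_comm[of f \<rho> s A])
      qed
    qed
  next
    case False
    then have A: "\<omega> j = A" using \<omega>(1)[of j] by blast
    show ?thesis
    proof (cases "real s < \<beta> * real p")
      case True
      moreover have "0 < s" using s(2) False by blast
      ultimately show ?thesis using left mf3 A by blast
    next
      case False
      then show ?thesis using right mf2 \<omega>(2)[OF A] by (meson not_le)
    qed
  qed
qed

section \<open>Entropy from below by mass distribution\<close>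

lemma emeasure_UN_le_infsum:
  assumes "countable I" "\<And>i. i \<in> I \<Longrightarrow> C i \<in> sets M"
  shows "emeasure M (\<Union>i\<in>I. C i) \<le> (\<Sum>\<^sub>\<infinity>i\<in>I. emeasure M (C i))"
proof (cases "finite I")
  case True
  have "emeasure M (\<Union>i\<in>I. C i) \<le> (\<Sum>i\<in>I. emeasure M (C i))"
    using True assms(2) by (intro emeasure_subadditive_finite) auto
  then show ?thesis using True by simp
next
  case False
  define g where "g = from_nat_into I"
  have g: "bij_betw g UNIV I" unfolding g_def using assms(1) False by (rule bij_betw_from_nat_into)
  then have gI: "g n \<in> I" for n by (auto simp: bij_betw_def)
  have "(\<Union>i\<in>I. C i) = (\<Union>n. C (g n))" using g by (auto simp: bij_betw_def)
  then have "emeasure M (\<Union>i\<in>I. C i) \<le> (\<Sum>n. emeasure M (C (g n)))"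
    using assms(2) gI by (simp only:) (intro emeasure_subadditive_countably, auto)
  also have "\<dots> \<le> (\<Sum>\<^sub>\<infinity>i\<in>I. emeasure M (C i))"
    unfolding suminf_eq_SUP
  proof (rule SUP_least)
    fix n
    have "inj_on g {..<n}" using g by (auto simp: bij_betw_def intro: inj_on_subset)
    then have "(\<Sum>k<n. emeasure M (C (g k))) = (\<Sum>i\<in>g ` {..<n}. emeasure M (C i))"
      by (simp add: sum.reindex)
    also have "\<dots> \<le> (\<Sum>\<^sub>\<infinity>i\<in>I. emeasure M (C i))"
      using gI by (intro sum_le_infsum_ennreal) auto
    finally show "(\<Sum>k<n. emeasure M (C (g k))) \<le> (\<Sum>\<^sub>\<infinity>i\<in>I. emeasure M (C i))" .
  qed
  finally show ?thesis .
qed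

text \<open>At most \<open>M / Q + 1\<close> multiples of \<open>Q\<close> lie below
  \<open>M\<close>; the extra 1 stands for the multiple 0.\<close>

lemma card_non_multiples:
  assumes "2 \<le> Q"
  shows "real M * (1 - 1 / real Q) - 1 \<le> real (card {j. j < M \<and> \<not> Q dvd j})"
proof -
  have "{j. j < M \<and> Q dvd j} \<subseteq> (\<lambda>l. Q * l) ` {..M div Q}"
  proof
    fix j assume "j \<in> {j. j < M \<and> Q dvd j}"
    then obtain l where l: "j = Q * l" "Q * l < M" by auto
    then have "Q * l div Q \<le> M div Q" by (intro div_le_mono) simp
    then have "l \<le> M div Q" using assms by simp
    then show "j \<in> (\<lambda>l. Q * l) ` {..M div Q}" using l by auto
  qed
  then have "card {j. j < M \<and> Q dvd j} \<le> card ((\<lambda>l. Q * l) ` {..M div Q})" by (intro card_mono) auto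
  also have "\<dots> \<le> card {..M div Q}" by (rule card_image_le) simp
  finally have "card {j. j < M \<and> Q dvd j} \<le> M div Q + 1" by simp
  moreover have "real (M div Q) \<le> real M / real Q"
    by (metis floor_divide_of_nat_eq of_int_floor_le of_int_of_nat_eq)
  moreover have "M = card {j. j < M \<and> Q dvd j} + card {j. j < M \<and> \<not> Q dvd j}"
  proof -
    have "{..<M} = {j. j < M \<and> Q dvd j} \<union> {j. j < M \<and> \<not> Q dvd j}" by auto
    then have "card {..<M} = card ({j. j < M \<and> Q dvd j} \<union> {j. j < M \<and> \<not> Q dvd j})" by simp
    also have "\<dots> = card {j. j < M \<and> Q dvd j} + card {j. j < M \<and> \<not> Q dvd j}"
      by (rule card_Un_disjoint) auto
    finally show ?thesis by simp
  qed
  ultimately have "real M - (real M / real Q + 1) \<le> real (card {j. j < M \<and> \<not> Q dvd j})" by linarith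
  then show ?thesis by (simp add: algebra_simps)
qed

text \<open>
  A mass distribution argument: the uniform Bernoulli measure on \<open>\<nat> \<Rightarrow> E\<close> gives every Bowen ball of
  length \<open>u\<close> mass at most a constant times \<open>exp (- t * u)\<close>.
\<close>

lemma htop_scale_coded_ge:
  fixes z :: "(nat \<Rightarrow> 'b) \<Rightarrow> 'a::metric_space"
  assumes E: "finite E" "E \<noteq> {}" and p: "0 < p" and Q: "2 \<le> Q"
    and t: "t * real p \<le> (1 - 1 / real Q) * ln (real (card E))"
    and code: "\<And>\<omega> \<omega>' j. \<omega> \<in> UNIV \<rightarrow>\<^sub>E E \<Longrightarrow> \<omega>' \<in> UNIV \<rightarrow>\<^sub>E E \<Longrightarrow> \<not> Q dvd j \<Longrightarrow> \<omega> j \<noteq> \<omega>' j \<Longrightarrow>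
      \<exists>i<Suc j * p. 2 * r \<le> dist ((f ^^ i) (z \<omega>)) ((f ^^ i) (z \<omega>'))"
  shows "ereal t \<le> htop_scale X f (z ` (UNIV \<rightarrow>\<^sub>E E)) r"
proof (rule htop_scale_geI)
  fix s :: real assume s: "0 \<le> s" "s < t"
  define W where "W = z ` (UNIV \<rightarrow>\<^sub>E E)"
  define N where "N = card E"
  have N: "1 \<le> N" using E by (simp add: N_def Suc_le_eq card_gt_0_iff)
  define M where "M = PiM (UNIV :: nat set) (\<lambda>_. uniform_count_measure E)"
  interpret product_prob_space "\<lambda>_. uniform_count_measure E" "UNIV :: nat set"
    by (intro product_prob_spaceI prob_space_uniform_count_measure E)
  have spM: "space M = UNIV \<rightarrow>\<^sub>E E" by (simp add: M_def space_PiM space_uniform_count_measure)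
  \<comment> \<open>The coordinates readable from the first \<open>u\<close> times: only complete
    blocks count, and multiples of \<open>Q\<close> are left out because \<open>code\<close> says
    nothing about them.\<close>
  define Js where "Js u = {j. j < u div p \<and> \<not> Q dvd j}" for u
  \<comment> \<open>\<open>z\<close> need not be measurable, so the preimage of a ball is enlarged
    to a cylinder through one of its codes: points in a common ball of radius \<open>r\<close> stay
    closer than \<open>2 * r\<close> up to time \<open>u\<close>, so their codes agree on
    \<open>Js u\<close>.\<close>
  define cyl where "cyl = (\<lambda>(x, u). if \<exists>\<omega>\<in>space M. z \<omega> \<in> bowen_ball X f u x r
      then {\<omega>' \<in> space M. \<forall>j\<in>Js u. \<omega>' j \<in> {(SOME \<omega>. \<omega> \<in> space M \<and> z \<omega> \<in> bowen_ball X f u x r) j}}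
      else {})"
  have finJ: "finite (Js u)" for u by (simp add: Js_def)
  have cylM: "cyl i \<in> sets M \<and> emeasure M (cyl i) \<le> ennreal (real N ^ 2) * ennreal (exp (- s * real (snd i)))" for i
  proof -
    obtain x u where i: "i = (x, u)" by (cases i)
    show ?thesis
    proof (cases "\<exists>\<omega>\<in>space M. z \<omega> \<in> bowen_ball X f u x r")
      case False
      then show ?thesis by (simp add: cyl_def i)
    next
      case True
      define \<omega> where "\<omega> = (SOME \<omega>. \<omega> \<in> space M \<and> z \<omega> \<in> bowen_ball X f u x r)"
      have \<omega>: "\<omega> \<in> space M" "z \<omega> \<in> bowen_ball X f u x r"
        using someI_ex[of "\<lambda>\<omega>. \<omega> \<in> space M \<and> z \<omega> \<in> bowen_ball X f u x r"] True by (auto simp: \<omega>_def)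
      then have \<omega>E: "\<omega> j \<in> E" for j by (auto simp: spM)
      have cyl: "cyl i = {\<omega>' \<in> space M. \<forall>j\<in>Js u. \<omega>' j \<in> {\<omega> j}}"
        using True by (simp add: cyl_def i \<omega>_def)
      have "emeasure M (cyl i) = (\<Prod>j\<in>Js u. emeasure (uniform_count_measure E) {\<omega> j})"
        unfolding cyl M_def
        by (rule emeasure_PiM_Collect) (use finJ \<omega>E in \<open>auto simp: sets_uniform_count_measure\<close>)
      also have "\<dots> = ennreal ((1 / real N) ^ card (Js u))"
        using E(1) \<omega>E by (simp add: emeasure_uniform_count_measure N_def ennreal_power)
      also have "\<dots> \<le> ennreal (real N ^ 2 * exp (- s * real u))"
      proof (rule ennreal_leI)
        have "real u / real p - 1 \<le> real (u div p)"
        proof -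
          have "u < (u div p + 1) * p" using p by (metis add.commute dividend_less_times_div mult.commute plus_1_eq_Suc mult_Suc_right)
          then have "real u < real ((u div p + 1) * p)" by (simp only: of_nat_less_iff)
          then have "real u / real p < real (u div p + 1)" using p by (simp add: field_simps)
          then show ?thesis by simp
        qed
        then have "(real u / real p - 1) * (1 - 1 / real Q) \<le> real (u div p) * (1 - 1 / real Q)"
          using Q by (intro mult_right_mono) auto
        moreover have "real u / real p * (1 - 1 / real Q) - 1 \<le> (real u / real p - 1) * (1 - 1 / real Q)"
          by (simp add: algebra_simps)
        \<comment> \<open>One unit is lost by rounding \<open>u / p\<close>, the other by the
          multiple 0 of \<open>Q\<close>; together they become the constant
          \<open>N ^ 2\<close>.\<close>
        ultimately have cJ: "real u / real p * (1 - 1 / real Q) - 2 \<le> real (card (Js u))"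
          using card_non_multiples[OF Q, of "u div p"] unfolding Js_def by linarith
        have "s * real u \<le> t * real u" using s by (intro mult_right_mono) auto
        also have "\<dots> = (t * real p) * (real u / real p)" using p by simp
        also have "\<dots> \<le> (1 - 1 / real Q) * ln (real N) * (real u / real p)"
          using t by (intro mult_right_mono) (auto simp: N_def)
        also have "\<dots> = ln (real N) * (real u / real p * (1 - 1 / real Q))" by simp
        also have "\<dots> \<le> ln (real N) * (real (card (Js u)) + 2)"
          using cJ N by (intro mult_left_mono) auto
        finally have "- (ln (real N) * real (card (Js u))) \<le> 2 * ln (real N) + (- s * real u)"
          by (simp add: algebra_simps)
        then have "exp (- (ln (real N) * real (card (Js u)))) \<le> exp (2 * ln (real N) + (- s * real u))" by simp
        also have "\<dots> = real N ^ 2 * exp (- s * real u)"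
          unfolding exp_add using N exp_of_nat_mult[of 2 "ln (real N)"] by simp
        also have "exp (- (ln (real N) * real (card (Js u)))) = (1 / real N) ^ card (Js u)"
          using N exp_of_nat_mult[of "card (Js u)" "- ln (real N)"]
          by (simp add: exp_minus mult.commute inverse_eq_divide)
        finally show "(1 / real N) ^ card (Js u) \<le> real N ^ 2 * exp (- s * real u)" .
      qed
      also have "\<dots> = ennreal (real N ^ 2) * ennreal (exp (- s * real (snd i)))"
        by (simp add: i ennreal_mult)
      finally have "emeasure M (cyl i) \<le> ennreal (real N ^ 2) * ennreal (exp (- s * real (snd i)))" .
      moreover have "cyl i \<in> sets M"
        unfolding cyl M_def
        by (rule sets.sets_Collect_finite_All[OF _ finJ], rule sets_Collect_single)
           (use \<omega>E in \<open>auto simp: sets_uniform_count_measure\<close>)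
      ultimately show ?thesis by blast
    qed
  qed
  have cover: "1 \<le> ennreal (real N ^ 2) * (\<Sum>\<^sub>\<infinity>(x, u)\<in>I. ennreal (exp (- s * real u)))"
    if I: "I \<in> bowen_covers X f W 0 r" for I
  proof -
    have "space M \<subseteq> (\<Union>i\<in>I. cyl i)"
    proof
      fix \<omega> assume \<omega>: "\<omega> \<in> space M"
      then have "z \<omega> \<in> W" by (simp add: W_def spM)
      then obtain x u where xu: "(x, u) \<in> I" "z \<omega> \<in> bowen_ball X f u x r"
        using I unfolding bowen_covers_def by blast
      define \<omega>0 where "\<omega>0 = (SOME \<omega>. \<omega> \<in> space M \<and> z \<omega> \<in> bowen_ball X f u x r)"
      have \<omega>0: "\<omega>0 \<in> space M" "z \<omega>0 \<in> bowen_ball X f u x r"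
        using someI_ex[of "\<lambda>\<omega>. \<omega> \<in> space M \<and> z \<omega> \<in> bowen_ball X f u x r"] \<omega> xu by (auto simp: \<omega>0_def)
      have "\<omega> j = \<omega>0 j" if j: "j \<in> Js u" for j
      proof (rule ccontr)
        assume "\<omega> j \<noteq> \<omega>0 j"
        then obtain i where i: "i < Suc j * p" "2 * r \<le> dist ((f ^^ i) (z \<omega>)) ((f ^^ i) (z \<omega>0))"
          using code[of \<omega> \<omega>0 j] \<omega> \<omega>0(1) j by (auto simp: spM Js_def)
        have "Suc j * p \<le> (u div p) * p" using j by (intro mult_le_mono1) (simp add: Js_def)
        also have "\<dots> \<le> u" by (rule div_times_less_eq_dividend)
        finally have "i < u" using i(1) by simp
        then have "dist ((f ^^ i) x) ((f ^^ i) (z \<omega>)) < r" "dist ((f ^^ i) x) ((f ^^ i) (z \<omega>0)) < r"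
          using xu(2) \<omega>0(2) by (auto simp: bowen_ball_def)
        then show False
          using i(2) dist_triangle3[of "(f ^^ i) (z \<omega>)" "(f ^^ i) (z \<omega>0)" "(f ^^ i) x"] by linarith
      qed
      then have "\<omega> \<in> cyl (x, u)" using \<omega> xu(2) by (auto simp: cyl_def \<omega>0_def[symmetric])
      then show "\<omega> \<in> (\<Union>i\<in>I. cyl i)" using xu(1) by blast
    qed
    then have "emeasure M (space M) \<le> emeasure M (\<Union>i\<in>I. cyl i)"
      using I cylM by (intro emeasure_mono sets.countable_UN') (auto simp: bowen_covers_def)
    also have "\<dots> \<le> (\<Sum>\<^sub>\<infinity>i\<in>I. emeasure M (cyl i))"
      using I cylM by (intro emeasure_UN_le_infsum) (auto simp: bowen_covers_def)
    also have "\<dots> \<le> (\<Sum>\<^sub>\<infinity>i\<in>I. ennreal (real N ^ 2) * ennreal (exp (- s * real (snd i))))"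
      using cylM by (intro infsum_mono nonneg_summable_on_complete) auto
    also have "\<dots> \<le> ennreal (real N ^ 2) * (\<Sum>\<^sub>\<infinity>(x, u)\<in>I. ennreal (exp (- s * real u)))"
    proof (subst nonneg_infsum_complete, simp, rule SUP_least, clarify)
      fix F assume "finite F" "F \<subseteq> I"
      then show "(\<Sum>i\<in>F. ennreal (real N ^ 2) * ennreal (exp (- s * real (snd i))))
          \<le> ennreal (real N ^ 2) * (\<Sum>\<^sub>\<infinity>(x, u)\<in>I. ennreal (exp (- s * real u)))"
        unfolding sum_distrib_left[symmetric] case_prod_beta
        by (intro mult_left_mono sum_le_infsum_ennreal) auto
    qed
    finally show ?thesis using P.emeasure_space_1 by (simp add: M_def)
  qed
  \<comment> \<open>A cover of sum below \<open>1 / (2 * N ^ 2)\<close> would cover a probability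
    space by cylinders of total mass at most \<open>1 / 2\<close>. Minimal length 0 suffices, as
    \<open>bowen_C\<close> dominates this value.\<close>
  have "bowen_C_n X f W s 0 r \<noteq> 0"
  proof
    assume "bowen_C_n X f W s 0 r = 0"
    then have "(INF I\<in>bowen_covers X f W 0 r. \<Sum>\<^sub>\<infinity>(x, u)\<in>I. ennreal (exp (- s * real u))) < ennreal (1 / (2 * real N ^ 2))"
      using N by (simp add: bowen_C_n_def)
    then obtain I where I: "I \<in> bowen_covers X f W 0 r"
      "(\<Sum>\<^sub>\<infinity>(x, u)\<in>I. ennreal (exp (- s * real u))) < ennreal (1 / (2 * real N ^ 2))"
      by (auto simp: INF_less_iff)
    have "1 \<le> ennreal (real N ^ 2) * ennreal (1 / (2 * real N ^ 2))"
      using cover[OF I(1)] I(2) by (meson less_imp_le mult_left_mono order_trans zero_le)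
    also have "\<dots> = ennreal (1 / 2)"
      using N by (simp add: ennreal_mult[symmetric])
    also have "\<dots> < ennreal 1" by (rule ennreal_lessI) auto
    finally show False by simp
  qed
  then show "bowen_C X f (z ` (UNIV \<rightarrow>\<^sub>E E)) s r \<noteq> 0"
    using bowen_C_n_le[of X f W s 0 r] unfolding W_def by (metis le_zero_eq)
qed

section \<open>Bump functions, residue classes and correlation\<close>

context dynamics
begin

text \<open>\<open>S\<close> counts mismatches through truncated distances and is therefore
  continuous. Every mismatch at threshold \<rho> adds 1, so \<open>\<eta> * p\<close> of them push
  \<open>1 - S / (\<eta> * p)\<close> down to 0. If all but \<open>\<eta> / 4 * p\<close> entries
  are within \<open>\<rho> * \<eta> / 4\<close>, the exceptions and the remaining entries add at
  most \<open>\<eta> / 4 * p\<close> each.\<close>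

lemma exists_bump:
  assumes "A \<in> X" "0 < \<rho>" "0 < \<eta>" "0 < p"
  shows "\<exists>\<phi> :: 'a \<Rightarrow> real. continuous_on X \<phi> \<and> (\<forall>y. 0 \<le> \<phi> y) \<and>
    (\<forall>y. \<eta> * real p \<le> real (mismatch f \<rho> p y A) \<longrightarrow> \<phi> y = 0) \<and>
    (\<forall>y. real (mismatch f (\<rho> * \<eta> / 4) p y A) \<le> \<eta> / 4 * real p \<longrightarrow> 1 / 2 \<le> \<phi> y)"
proof -
  define S where "S y = (\<Sum>i<p. min 1 (dist ((f ^^ i) y) ((f ^^ i) A) / \<rho>))" for y
  define \<phi> where "\<phi> y = max 0 (1 - S y / (\<eta> * real p))" for y
  have \<eta>p: "0 < \<eta> * real p" using assms by simp
  have "continuous_on X \<phi>"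
    unfolding \<phi>_def S_def using \<eta>p assms(2,4)
    by (intro continuous_intros continuous_on_funpow[OF cont_f f_into]) auto
  moreover have "\<phi> y = 0" if "\<eta> * real p \<le> real (mismatch f \<rho> p y A)" for y
  proof -
    let ?B = "{i. i < p \<and> \<rho> \<le> dist ((f ^^ i) y) ((f ^^ i) A)}"
    have "real (mismatch f \<rho> p y A) = (\<Sum>i\<in>?B. 1)" by (simp add: mismatch_def)
    also have "\<dots> \<le> (\<Sum>i\<in>?B. min 1 (dist ((f ^^ i) y) ((f ^^ i) A) / \<rho>))"
      using assms(2) by (intro sum_mono) (auto simp: min_def)
    also have "\<dots> \<le> S y"
      unfolding S_def using assms(2) by (intro sum_mono2) auto
    finally have "\<eta> * real p \<le> S y" using that by linarith
    then show ?thesis using \<eta>p by (simp add: \<phi>_def)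
  qed
  moreover have "1 / 2 \<le> \<phi> y" if "real (mismatch f (\<rho> * \<eta> / 4) p y A) \<le> \<eta> / 4 * real p" for y
  proof -
    let ?B = "{i. i < p \<and> \<rho> * \<eta> / 4 \<le> dist ((f ^^ i) y) ((f ^^ i) A)}"
    have "S y \<le> (\<Sum>i<p. (if i \<in> ?B then 1 else 0) + \<eta> / 4)"
      unfolding S_def
    proof (rule sum_mono)
      fix i assume "i \<in> {..<p}"
      show "min 1 (dist ((f ^^ i) y) ((f ^^ i) A) / \<rho>) \<le> (if i \<in> ?B then 1 else 0) + \<eta> / 4"
      proof (cases "i \<in> ?B")
        case False
        then have "dist ((f ^^ i) y) ((f ^^ i) A) < \<rho> * \<eta> / 4" using \<open>i \<in> {..<p}\<close> by auto
        then have "dist ((f ^^ i) y) ((f ^^ i) A) / \<rho> \<le> \<eta> / 4" using assms(2) by (simp add: field_simps)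
        then have "min 1 (dist ((f ^^ i) y) ((f ^^ i) A) / \<rho>) \<le> \<eta> / 4" by (rule min.coboundedI2)
        then show ?thesis using False by (simp only: if_False add_0)
      qed (use assms in auto)
    qed
    also have "\<dots> = (\<Sum>i<p. if i \<in> ?B then 1 else 0) + real p * (\<eta> / 4)"
      by (simp only: sum.distrib sum_constant card_lessThan)
    also have "(\<Sum>i<p. if i \<in> ?B then 1 else 0) = real (card ?B)"
    proof -
      have B: "{..<p} \<inter> ?B = ?B" by auto
      show ?thesis unfolding sum.inter_restrict[OF finite_lessThan, symmetric] B by simp
    qed
    also have "real (card ?B) + real p * (\<eta> / 4) \<le> \<eta> * real p / 2"
      using that by (simp add: mismatch_def)
    finally have "S y / (\<eta> * real p) \<le> 1 / 2" using \<eta>p by (simp add: field_simps)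
    then have "1 / 2 \<le> 1 - S y / (\<eta> * real p)" by linarith
    then show ?thesis unfolding \<phi>_def by (rule max.coboundedI2)
  qed
  ultimately show ?thesis by (intro exI[of _ \<phi>]) (auto simp: \<phi>_def)
qed

end

text \<open>For each \<open>N\<close> the sum of absolute values splits by sign and residue into
  \<open>2 * P\<close> sums, one of which has at least the share \<open>1 / (2 * P)\<close>. As
  there are finitely many classes, one of them serves infinitely many \<open>N\<close>.\<close>

lemma nontrivial_weight_residue:
  assumes "nontrivial_weight \<theta>" "0 < P"
  shows "\<exists>\<sigma>\<in>{1, -1 :: real}. \<exists>c<P. \<exists>a>0. \<exists>\<^sub>F N in sequentially.
    a * real N \<le> (\<Sum>n\<in>{n \<in> {..<N}. n mod P = c}. max 0 (\<sigma> * \<theta> n))"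
proof -
  have "0 < limsup (\<lambda>N. ereal ((\<Sum>n<N. \<bar>\<theta> n\<bar>) / real N))"
    using assms(1) by (simp add: nontrivial_weight_def)
  then obtain d where d: "0 < ereal d" "ereal d < limsup (\<lambda>N. ereal ((\<Sum>n<N. \<bar>\<theta> n\<bar>) / real N))"
    using ereal_dense2 by blast
  then have d0: "0 < d" by simp
  have freq: "\<exists>\<^sub>F N in sequentially. d < (\<Sum>n<N. \<bar>\<theta> n\<bar>) / real N"
  proof (rule ccontr)
    assume "\<not> ?thesis"
    then have "\<forall>\<^sub>F N in sequentially. ereal ((\<Sum>n<N. \<bar>\<theta> n\<bar>) / real N) \<le> ereal d"
      by (simp add: not_frequently not_less)
    then have "limsup (\<lambda>N. ereal ((\<Sum>n<N. \<bar>\<theta> n\<bar>) / real N)) \<le> ereal d" by (rule Limsup_bounded)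
    then show False using d(2) by simp
  qed
  define a where "a = d / (2 * real P)"
  define S where "S = (\<lambda>(\<sigma>, c) N. \<Sum>n\<in>{n \<in> {..<N}. n mod P = c}. max 0 (\<sigma> * \<theta> n))"
  have ex: "\<exists>y\<in>{1, -1 :: real} \<times> {..<P}. a * real N \<le> S y N" if N: "d < (\<Sum>n<N. \<bar>\<theta> n\<bar>) / real N" for N
  proof (rule ccontr)
    assume neg: "\<not> ?thesis"
    have "0 < N" using N d0 by (cases N) auto
    have grp: "(\<Sum>c<P. S (\<sigma>, c) N) = (\<Sum>n<N. max 0 (\<sigma> * \<theta> n))" for \<sigma>
      unfolding S_def prod.case using assms(2) by (intro sum.group) auto
    have "(\<Sum>y\<in>{1, -1 :: real} \<times> {..<P}. S y N) = (\<Sum>\<sigma>\<in>{1, -1 :: real}. \<Sum>c<P. S (\<sigma>, c) N)"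
      by (simp add: sum.cartesian_product)
    also have "\<dots> = (\<Sum>n<N. max 0 (\<theta> n) + max 0 (- \<theta> n))"
      by (simp add: grp sum.distrib)
    also have "\<dots> = (\<Sum>n<N. \<bar>\<theta> n\<bar>)" by (intro sum.cong) auto
    finally have "(\<Sum>n<N. \<bar>\<theta> n\<bar>) = (\<Sum>y\<in>{1, -1 :: real} \<times> {..<P}. S y N)" by simp
    also have "\<dots> \<le> real (card ({1, -1 :: real} \<times> {..<P})) * (a * real N)"
      using neg by (intro sum_bounded_above) (auto simp: not_le less_imp_le)
    also have "\<dots> = d * real N" using assms(2) by (simp add: a_def card_cartesian_product)
    finally show False using N \<open>0 < N\<close> by (simp add: field_simps)
  qed
  have "\<exists>\<^sub>F N in sequentially. \<exists>y\<in>{1, -1 :: real} \<times> {..<P}. a * real N \<le> S y N"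
    by (rule frequently_mono[OF _ freq]) (use ex in blast)
  then have "\<exists>y\<in>{1, -1 :: real} \<times> {..<P}. \<exists>\<^sub>F N in sequentially. a * real N \<le> S y N"
    by (intro frequently_bex_finite) auto
  then obtain \<sigma> c where "\<sigma> \<in> {1, -1 :: real}" "c < P" "\<exists>\<^sub>F N in sequentially. a * real N \<le> S (\<sigma>, c) N"
    by auto
  moreover have "0 < a" using d0 assms(2) by (simp add: a_def)
  ultimately show ?thesis unfolding S_def prod.case by blast
qed

context dynamics
begin

text \<open>Every code \<omega> over \<open>E\<close> gives a shadowing point
  \<open>z \<omega>\<close>. Markers overwrite the code at some multiples of \<open>Q\<close> and
  make all these points correlate through one test function; the other places remain free and carry
  the entropy.\<close>

lemma correlated_points_entropy_ge:
  assumes V: "V \<subseteq> X" "f ` V \<subseteq> V" and Y: "Y \<subseteq> V" and r: "0 < r" and t: "0 \<le> t" "t < h"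
    and upper: "\<And>\<tau>. h < \<tau> \<Longrightarrow> \<exists>C. \<forall>n E. E \<subseteq> V \<longrightarrow> finite E \<longrightarrow> separated f n r E \<longrightarrow>
        real (card E) \<le> C * exp (\<tau> * real n)"
    and lower: "\<And>\<tau> p0. \<tau> < h \<Longrightarrow> \<exists>p\<ge>p0. \<exists>E\<subseteq>Y. L dvd p \<and> finite E \<and> separated f p r E \<and>
        exp (\<tau> * real p) \<le> real (card E)"
    and shadow: "\<And>\<epsilon> \<delta>. 0 < \<epsilon> \<Longrightarrow> 0 < \<delta> \<Longrightarrow> \<exists>p0. \<forall>p\<ge>p0. L dvd p \<longrightarrow> (\<forall>\<omega>. range \<omega> \<subseteq> Y \<longrightarrow>
        (\<exists>x\<in>X. \<forall>j. real (mismatch f \<epsilon> p ((f ^^ (j * p)) x) (\<omega> j)) \<le> \<delta> * real p))"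
    and \<theta>: "nontrivial_weight \<theta>"
  shows "ereal t \<le> htop X f (correlated_points \<theta> f X)"
proof -
  define t1 where "t1 = (t + h) / 2"
  have t1: "t < t1" "t1 < h" "0 < t1" using t by (auto simp: t1_def)
  \<comment> \<open>Reserving a fraction \<open>1 / Q\<close> of the places for markers may cost no
    more than the gap between \<open>t1\<close> and \<open>t\<close>; \<open>2 \<le> Q\<close>
    prevents adjacent markers.\<close>
  define Q where "Q = nat \<lceil>t1 / (t1 - t)\<rceil> + 2"
  have Q: "2 \<le> Q" "t \<le> (1 - 1 / real Q) * t1"
  proof -
    have "t1 / (t1 - t) \<le> real Q" unfolding Q_def by linarith
    then have "t1 \<le> real Q * (t1 - t)" using t1 by (simp add: field_simps)
    then have "real Q * t \<le> (real Q - 1) * t1" by (simp add: algebra_simps)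
    moreover have "0 < real Q" by (simp add: Q_def)
    ultimately show "t \<le> (1 - 1 / real Q) * t1" by (simp add: field_simps)
  qed (simp add: Q_def)
  have h: "0 < h" using t by simp
  obtain \<rho> \<eta> \<beta> where \<rho>: "0 < \<rho>" and \<eta>: "0 < \<eta>" and \<beta>: "0 < \<beta>" "\<beta> < 1 / 2"
    and marked: "\<forall>p0. \<exists>p\<ge>p0. L dvd p \<and> (\<exists>A\<in>Y. \<exists>E\<subseteq>Y. finite E \<and>
       exp (t1 * real p) \<le> real (card E) \<and> marked_family f r \<rho> \<eta> \<beta> p A E)"
    using exists_marked_family[OF V Y r h t1(2) upper lower] by blast
  \<comment> \<open>The three bounds serve, in order, the recognition of \<open>A\<close> by the
    bump function, the decoding of blocks, and the vanishing of the bump function on other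
    windows.\<close>
  define \<epsilon> where "\<epsilon> = min (min (\<rho> / 2 * (\<eta> / 2) / 4) (r / 8)) (\<rho> / 2)"
  have \<epsilon>: "0 < \<epsilon>" "\<epsilon> \<le> \<rho> / 2 * (\<eta> / 2) / 4" "\<epsilon> \<le> r / 8" "\<epsilon> \<le> \<rho> / 2"
    using \<rho> \<eta> r by (auto simp: \<epsilon>_def min.coboundedI1)
  obtain p0 where p0: "\<forall>p\<ge>p0. L dvd p \<longrightarrow> (\<forall>\<omega>. range \<omega> \<subseteq> Y \<longrightarrow>
        (\<exists>x\<in>X. \<forall>j. real (mismatch f \<epsilon> p ((f ^^ (j * p)) x) (\<omega> j)) \<le> \<eta> / 8 * real p))"
    using shadow[OF \<epsilon>(1), of "\<eta> / 8"] \<eta> by auto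
  obtain p A E where p: "max p0 1 \<le> p" "L dvd p" and A: "A \<in> Y" and E: "E \<subseteq> Y" "finite E"
      "exp (t1 * real p) \<le> real (card E)" and mf: "marked_family f r \<rho> \<eta> \<beta> p A E"
    using marked by meson
  have pos: "0 < p" using p(1) by simp
  have \<eta>p: "0 < \<eta> * real p" using \<eta> pos by simp
  have E0: "E \<noteq> {}" using E(3) by (metis card.empty exp_gt_zero not_less of_nat_0)
  have "A \<notin> E"
  proof
    assume "A \<in> E"
    have "\<forall>F\<in>E. \<forall>s\<le>p. real s \<le> (1 - \<beta>) * real p \<longrightarrow>
        \<eta> * real p \<le> real (mismatch f \<rho> (p - s) ((f ^^ s) F) A)"
      using mf unfolding marked_family_def by blast
    from this[rule_format, OF \<open>A \<in> E\<close>, of 0]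
    have "\<eta> * real p \<le> real (mismatch f \<rho> (p - 0) ((f ^^ 0) A) A)" using \<beta> by simp
    then show False using \<eta>p \<rho> by (simp add: mismatch_def)
  qed
  define P where "P = Q * p"
  have P: "0 < P" using Q pos by (simp add: P_def)
  obtain \<sigma> c a where \<sigma>: "\<sigma> \<in> {1, -1 :: real}" and c: "c < P" and a: "0 < a"
    and freq: "\<exists>\<^sub>F N in sequentially. a * real N \<le> (\<Sum>n\<in>{n \<in> {..<N}. n mod P = c}. max 0 (\<sigma> * \<theta> n))"
    using nontrivial_weight_residue[OF \<theta> P] by blast
  \<comment> \<open>Weights of residue \<open>c\<close> must meet markers at multiples of
    \<open>P\<close>. Since \<open>f\<close> need not be invertible, the orbit is not moved back;
    instead the test function looks \<open>k\<close> steps ahead: index \<open>n\<close> sees time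
    \<open>n + k\<close>, a multiple of \<open>P\<close> exactly when
    \<open>n mod P = c\<close>.\<close>
  define k where "k = P - c"
  have k: "c + k = P" using c by (simp add: k_def)
  have AX: "A \<in> X" using A Y V by auto
  obtain \<phi> :: "'a \<Rightarrow> real" where \<phi>: "continuous_on X \<phi>" "\<And>y. 0 \<le> \<phi> y"
    "\<And>y. \<eta> / 2 * real p \<le> real (mismatch f (\<rho> / 2) p y A) \<Longrightarrow> \<phi> y = 0"
    "\<And>y. real (mismatch f (\<rho> / 2 * (\<eta> / 2) / 4) p y A) \<le> \<eta> / 2 / 4 * real p \<Longrightarrow> 1 / 2 \<le> \<phi> y"
  proof -
    have "0 < \<rho> / 2" "0 < \<eta> / 2" using \<rho> \<eta> by auto
    from exists_bump[OF AX this pos] show ?thesis using that by blast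
  qed
  \<comment> \<open>A marker is placed only where it meets a weight of sign \<sigma>. The condition
    \<open>k \<le> j * p\<close> makes the subtraction exact.\<close>
  define mark where "mark j \<longleftrightarrow> Q dvd j \<and> k \<le> j * p \<and> 0 < \<sigma> * \<theta> (j * p - k)" for j
  define w where "w \<omega> j = (if mark j then A else \<omega> j)" for \<omega> :: "nat \<Rightarrow> 'a" and j
  define z where "z \<omega> = (SOME x. x \<in> X \<and>
    (\<forall>j. real (mismatch f \<epsilon> p ((f ^^ (j * p)) x) (w \<omega> j)) \<le> \<eta> / 8 * real p))" for \<omega>
  have z: "z \<omega> \<in> X" "\<And>j. real (mismatch f \<epsilon> p ((f ^^ (j * p)) (z \<omega>)) (w \<omega> j)) \<le> \<eta> / 8 * real p"
    if \<omega>: "\<omega> \<in> UNIV \<rightarrow>\<^sub>E E" for \<omega>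
  proof -
    have wY: "range (w \<omega>) \<subseteq> Y" using \<omega> E(1) A by (auto simp: w_def)
    have "p0 \<le> p" using p(1) by simp
    from p0[rule_format, OF this p(2) wY]
    have "\<exists>x. x \<in> X \<and> (\<forall>j. real (mismatch f \<epsilon> p ((f ^^ (j * p)) x) (w \<omega> j)) \<le> \<eta> / 8 * real p)"
      by blast
    from someI_ex[OF this] show "z \<omega> \<in> X"
      "\<And>j. real (mismatch f \<epsilon> p ((f ^^ (j * p)) (z \<omega>)) (w \<omega> j)) \<le> \<eta> / 8 * real p"
      by (auto simp: z_def)
  qed
  have off: "\<phi> ((f ^^ (j * p + s)) (z \<omega>)) = 0"
    if \<omega>: "\<omega> \<in> UNIV \<rightarrow>\<^sub>E E" and s: "s < p" "s = 0 \<Longrightarrow> \<not> mark j" for \<omega> j s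
  proof (rule \<phi>(3), rule marked_family_window[OF mf \<beta>(2)])
    show "w \<omega> i \<in> insert A E" for i using \<omega> by (auto simp: w_def)
    show "w \<omega> (Suc i) \<in> E" if "w \<omega> i = A" for i
    proof -
      have "mark i" using that \<omega> \<open>A \<notin> E\<close> by (auto simp: w_def split: if_splits)
      then have "\<not> mark (Suc i)" using Q(1) by (auto simp: mark_def dest: dvd_diff_nat[of Q "Suc i" i])
      then show ?thesis using \<omega> by (auto simp: w_def)
    qed
    show "real (mismatch f (\<rho> / 2) p ((f ^^ (i * p)) (z \<omega>)) (w \<omega> i)) \<le> \<eta> / 2 * real p" for i
    proof -
      have "real (mismatch f (\<rho> / 2) p ((f ^^ (i * p)) (z \<omega>)) (w \<omega> i))
          \<le> real (mismatch f \<epsilon> p ((f ^^ (i * p)) (z \<omega>)) (w \<omega> i))"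
        using mismatch_antimono[OF \<epsilon>(4)] by simp
      then show ?thesis using z(2)[OF \<omega>, of i] \<eta>p by simp
    qed
    show "w \<omega> j \<in> E" if "s = 0" using s(2) that \<omega> by (auto simp: w_def)
  qed (use s in auto)
  have on: "1 / 2 \<le> \<phi> ((f ^^ (j * p)) (z \<omega>))" if \<omega>: "\<omega> \<in> UNIV \<rightarrow>\<^sub>E E" and "mark j" for \<omega> j
  proof (rule \<phi>(4))
    have "real (mismatch f (\<rho> / 2 * (\<eta> / 2) / 4) p ((f ^^ (j * p)) (z \<omega>)) A)
        \<le> real (mismatch f \<epsilon> p ((f ^^ (j * p)) (z \<omega>)) A)"
      using mismatch_antimono[OF \<epsilon>(2)] by simp
    also have "\<dots> \<le> \<eta> / 8 * real p" using z(2)[OF \<omega>, of j] that(2) by (simp add: w_def)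
    finally show "real (mismatch f (\<rho> / 2 * (\<eta> / 2) / 4) p ((f ^^ (j * p)) (z \<omega>)) A) \<le> \<eta> / 2 / 4 * real p"
      by simp
  qed
  define \<psi> where "\<psi> y = \<phi> ((f ^^ k) y)" for y
  have "continuous_on X \<psi>"
    unfolding \<psi>_def
    by (rule continuous_on_compose2[OF \<phi>(1) continuous_on_funpow[OF cont_f f_into]]) (use orbit_mem in auto)
  \<comment> \<open>Nothing cancels: \<psi> vanishes away from the markers and is at least
    \<open>1 / 2\<close> at a marker, where \<open>\<sigma> * \<theta> n\<close> is positive. A time
    of residue \<open>c\<close> without a marker has \<open>\<sigma> * \<theta> n \<le> 0\<close>,
    so the left side vanishes there too.\<close>
  have term_ge: "(if n mod P = c then max 0 (\<sigma> * \<theta> n) else 0) / 2 \<le> \<sigma> * (\<theta> n * \<psi> ((f ^^ n) (z \<omega>)))"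
    if \<omega>: "\<omega> \<in> UNIV \<rightarrow>\<^sub>E E" for \<omega> n
  proof -
    define j s where "j = (k + n) div p" and "s = (k + n) mod p"
    have js: "k + n = j * p + s" "s < p" using pos by (auto simp: j_def s_def)
    have \<psi>: "\<psi> ((f ^^ n) (z \<omega>)) = \<phi> ((f ^^ (j * p + s)) (z \<omega>))"
      by (simp add: \<psi>_def funpow_shift js)
    show ?thesis
    proof (cases "s = 0 \<and> mark j")
      case True
      then have sg: "0 < \<sigma> * \<theta> n" using js by (auto simp: mark_def) (metis add_diff_cancel_left')
      have "1 / 2 * (\<sigma> * \<theta> n) \<le> \<psi> ((f ^^ n) (z \<omega>)) * (\<sigma> * \<theta> n)"
        using on[OF \<omega>, of j] True sg unfolding \<psi> by (intro mult_right_mono) auto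
      then show ?thesis using sg by (simp add: mult.commute mult.left_commute)
    next
      case False
      then have 0: "\<psi> ((f ^^ n) (z \<omega>)) = 0" unfolding \<psi> using off[OF \<omega> js(2)] by blast
      have "\<sigma> * \<theta> n \<le> 0" if "n mod P = c"
      proof -
        have "n = n div P * P + c" using that by (metis div_mult_mod_eq)
        then have "k + n = (n div P + 1) * P" using k by (simp add: algebra_simps)
        then have kn: "k + n = ((n div P + 1) * Q) * p" by (simp only: P_def mult.assoc)
        then have "s = 0" "j = (n div P + 1) * Q" using pos by (auto simp: j_def s_def)
        then have "\<not> mark j" using False by simp
        moreover have "Q dvd j" "k \<le> j * p" "j * p - k = n"
          using kn js \<open>s = 0\<close> \<open>j = (n div P + 1) * Q\<close> by auto
        ultimately show ?thesis by (simp add: mark_def not_less)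
      qed
      then show ?thesis using 0 by auto
    qed
  qed
  have corr: "z \<omega> \<in> correlated_points \<theta> f X" if \<omega>: "\<omega> \<in> UNIV \<rightarrow>\<^sub>E E" for \<omega>
  proof -
    define S where "S N = \<bar>\<Sum>n<N. \<theta> n * \<psi> ((f ^^ n) (z \<omega>))\<bar> / real N" for N
    have S: "a / 2 \<le> S N" if N: "0 < N" "a * real N \<le> (\<Sum>n\<in>{n \<in> {..<N}. n mod P = c}. max 0 (\<sigma> * \<theta> n))" for N
    proof -
      have "a * real N / 2 \<le> (\<Sum>n\<in>{n \<in> {..<N}. n mod P = c}. max 0 (\<sigma> * \<theta> n)) / 2"
        using N by simp
      also have "\<dots> = (\<Sum>n<N. (if n mod P = c then max 0 (\<sigma> * \<theta> n) else 0) / 2)"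
        by (subst sum.inter_filter) (simp_all only: finite_lessThan sum_divide_distrib)
      also have "\<dots> \<le> (\<Sum>n<N. \<sigma> * (\<theta> n * \<psi> ((f ^^ n) (z \<omega>))))"
        using term_ge[OF \<omega>] by (intro sum_mono)
      also have "\<dots> = \<sigma> * (\<Sum>n<N. \<theta> n * \<psi> ((f ^^ n) (z \<omega>)))" by (simp add: sum_distrib_left)
      also have "\<dots> \<le> \<bar>\<Sum>n<N. \<theta> n * \<psi> ((f ^^ n) (z \<omega>))\<bar>" using \<sigma> by auto
      finally show ?thesis using N(1) by (simp add: S_def field_simps)
    qed
    have "0 < limsup (\<lambda>N. ereal (S N))"
    proof (rule ccontr)
      assume "\<not> 0 < limsup (\<lambda>N. ereal (S N))"
      then have "limsup (\<lambda>N. ereal (S N)) < ereal (a / 2)"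
        using a by (metis ereal_less(2) half_gt_zero le_less_trans not_le)
      then have "\<forall>\<^sub>F N in sequentially. ereal (S N) < ereal (a / 2)" by (rule Limsup_lessD)
      then have "\<forall>\<^sub>F N in sequentially. \<not> a * real N \<le> (\<Sum>n\<in>{n \<in> {..<N}. n mod P = c}. max 0 (\<sigma> * \<theta> n))"
        using eventually_gt_at_top[of "0::nat"]
      proof eventually_elim
        case (elim N)
        show ?case
        proof
          assume "a * real N \<le> (\<Sum>n\<in>{n \<in> {..<N}. n mod P = c}. max 0 (\<sigma> * \<theta> n))"
          then have "a / 2 \<le> S N" using S elim(2) by blast
          then show False using elim(1) by simp
        qed
      qed
      then show False using freq by (simp add: frequently_def)
    qed
    then show ?thesis
      using z(1)[OF \<omega>] \<open>continuous_on X \<psi>\<close> unfolding correlated_points_def S_def by blast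
  qed
  \<comment> \<open>Decoding passes from \<open>\<omega> j\<close> to the orbit of
    \<open>z \<omega>\<close>, to that of \<open>z \<omega>'\<close> and on to
    \<open>\<omega>' j\<close>. Two triangle inequalities turn the threshold \<open>r / 2\<close>
    into \<open>r / 8\<close>, which is twice the radius \<open>r / 16\<close>.\<close>
  have "ereal t \<le> htop_scale X f (z ` (UNIV \<rightarrow>\<^sub>E E)) (r / 16)"
  proof (rule htop_scale_coded_ge[OF E(2) E0 pos Q(1)])
    have "t1 * real p \<le> ln (real (card E))"
      using E(3) by (metis exp_gt_zero exp_le_cancel_iff exp_ln less_le_trans)
    then have "(1 - 1 / real Q) * (t1 * real p) \<le> (1 - 1 / real Q) * ln (real (card E))"
      using Q(1) by (intro mult_left_mono) auto
    moreover have "t * real p \<le> (1 - 1 / real Q) * t1 * real p"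
      using Q(2) by (intro mult_right_mono) auto
    ultimately show "t * real p \<le> (1 - 1 / real Q) * ln (real (card E))" by simp
  next
    fix \<omega> \<omega>' j assume \<omega>: "\<omega> \<in> UNIV \<rightarrow>\<^sub>E E" "\<omega>' \<in> UNIV \<rightarrow>\<^sub>E E" "\<not> Q dvd j" "\<omega> j \<noteq> \<omega>' j"
    show "\<exists>i<Suc j * p. 2 * (r / 16) \<le> dist ((f ^^ i) (z \<omega>)) ((f ^^ i) (z \<omega>'))"
    proof (rule ccontr)
      assume no: "\<not> ?thesis"
      let ?x = "(f ^^ (j * p)) (z \<omega>)" and ?y = "(f ^^ (j * p)) (z \<omega>')"
      have w: "w \<omega> j = \<omega> j" "w \<omega>' j = \<omega>' j" using \<omega>(3) by (auto simp: w_def mark_def)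
      have "i + j * p < Suc j * p" if "i < p" for i using that by simp
      then have "{i. i < p \<and> r / 2 / 2 / 2 \<le> dist ((f ^^ i) ?x) ((f ^^ i) ?y)} = {}"
        using no by (auto simp: funpow_shift)
      then have xy: "mismatch f (r / 2 / 2 / 2) p ?x ?y = 0" unfolding mismatch_def by (simp only: card.empty)
      have "\<eta> * real p \<le> real (mismatch f (r / 2) p (\<omega> j) (\<omega>' j))"
        using mf \<omega> unfolding marked_family_def by (metis PiE_mem UNIV_I)
      also have "mismatch f (r / 2) p (\<omega> j) (\<omega>' j)
          \<le> mismatch f (r / 2 / 2) p (\<omega> j) ?x + mismatch f (r / 2 / 2) p ?x (\<omega>' j)"
        by (rule mismatch_triangle)
      also have "mismatch f (r / 2 / 2) p ?x (\<omega>' j)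
          \<le> mismatch f (r / 2 / 2 / 2) p ?x ?y + mismatch f (r / 2 / 2 / 2) p ?y (\<omega>' j)"
        by (rule mismatch_triangle)
      finally have "\<eta> * real p \<le> real (mismatch f (r / 2 / 2) p (\<omega> j) ?x) + real (mismatch f (r / 2 / 2 / 2) p ?y (\<omega>' j))"
        using xy by simp
      moreover have "mismatch f (r / 2 / 2) p (\<omega> j) ?x \<le> mismatch f \<epsilon> p ?x (\<omega> j)"
        unfolding mismatch_comm[of f "r / 2 / 2" p "\<omega> j"] using \<epsilon>(3) r by (intro mismatch_antimono) simp
      moreover have "mismatch f (r / 2 / 2 / 2) p ?y (\<omega>' j) \<le> mismatch f \<epsilon> p ?y (\<omega>' j)"
        using \<epsilon>(3) r by (intro mismatch_antimono) simp
      ultimately show False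
        using z(2)[OF \<omega>(1), of j] z(2)[OF \<omega>(2), of j] \<eta>p unfolding w by linarith
    qed
  qed
  also have "\<dots> \<le> htop X f (z ` (UNIV \<rightarrow>\<^sub>E E))" using r by (intro htop_scale_le_htop) simp
  also have "\<dots> \<le> htop X f (correlated_points \<theta> f X)" using corr by (intro htop_mono) auto
  finally show ?thesis .
qed

end

section \<open>Growth of separated sets\<close>

context dynamics
begin

lemma separated_card_le_power:
  assumes "0 < r"
  shows "\<exists>K::nat\<ge>1. \<forall>n E. E \<subseteq> X \<longrightarrow> finite E \<longrightarrow> separated f n r E \<longrightarrow> card E \<le> K ^ n"
proof -
  obtain K :: nat and c :: "'a \<Rightarrow> nat" where c: "1 \<le> K" "\<forall>y\<in>X. c y < K"
    "\<forall>y\<in>X. \<forall>z\<in>X. c y = c z \<longrightarrow> dist y z < r"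
    using compact_cells[OF compact_X assms] by blast
  have "card E \<le> K ^ n" if E: "E \<subseteq> X" "separated f n r E" for n E
  proof -
    define code where "code x = restrict (\<lambda>i. c ((f ^^ i) x)) {..<n}" for x
    have "inj_on code E"
    proof (rule inj_onI, rule ccontr)
      fix x y assume xy: "x \<in> E" "y \<in> E" "code x = code y" "x \<noteq> y"
      then obtain i where i: "i < n" "r \<le> dist ((f ^^ i) x) ((f ^^ i) y)"
        using E(2) unfolding separated_def by blast
      have "code x i = code y i" using xy(3) by simp
      then have "c ((f ^^ i) x) = c ((f ^^ i) y)" using i(1) by (simp add: code_def)
      then have "dist ((f ^^ i) x) ((f ^^ i) y) < r" using c(3) orbit_mem xy(1,2) E(1) by blast
      then show False using i(2) by simp
    qed
    moreover have "code x \<in> {..<n} \<rightarrow>\<^sub>E {..<K}" if "x \<in> E" for x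
      using that c(2) orbit_mem E(1) by (auto simp: code_def)
    then have "code ` E \<subseteq> {..<n} \<rightarrow>\<^sub>E {..<K}" by blast
    ultimately have "card E \<le> card ({..<n} \<rightarrow>\<^sub>E {..<K})"
      by (rule card_inj_on_le) (simp add: finite_PiE)
    then show ?thesis by (simp add: card_PiE)
  qed
  with c(1) show ?thesis by blast
qed

text \<open>\<open>h\<close> is the infimum of the nonnegative rates that admit an upper bound.
  Below \<open>h\<close> every constant \<open>C\<close> fails; this freedom is kept because a
  suitable \<open>C\<close> later forces the length \<open>n\<close> to be large.\<close>

lemma growth_rate:
  assumes "V \<subseteq> X" "0 < r"
  shows "\<exists>h\<ge>0.
    (\<forall>\<tau>>h. \<exists>C. \<forall>n E. E \<subseteq> V \<longrightarrow> finite E \<longrightarrow> separated f n r E \<longrightarrow> real (card E) \<le> C * exp (\<tau> * real n)) \<and>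
    (\<forall>\<tau> C. 0 \<le> \<tau> \<longrightarrow> \<tau> < h \<longrightarrow>
       (\<exists>n E. E \<subseteq> V \<and> finite E \<and> separated f n r E \<and> C * exp (\<tau> * real n) < real (card E)))"
proof -
  define bd where "bd \<tau> C \<longleftrightarrow> (\<forall>n E. E \<subseteq> V \<longrightarrow> finite E \<longrightarrow> separated f n r E \<longrightarrow>
    real (card E) \<le> C * exp (\<tau> * real n))" for \<tau> C
  define G where "G = {\<tau>. 0 \<le> \<tau> \<and> (\<exists>C. bd \<tau> C)}"
  obtain K :: nat where K: "1 \<le> K" "\<forall>n E. E \<subseteq> X \<longrightarrow> finite E \<longrightarrow> separated f n r E \<longrightarrow> card E \<le> K ^ n"
    using separated_card_le_power[OF assms(2)] by blast
  have "bd (ln (real K)) 1"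
    unfolding bd_def
  proof (intro allI impI)
    fix n E assume "E \<subseteq> V" "finite E" "separated f n r E"
    then have "card E \<le> K ^ n" using K(2) assms(1) by blast
    then have "real (card E) \<le> real K ^ n" by (metis of_nat_le_iff of_nat_power)
    also have "\<dots> = exp (ln (real K) * real n)"
      using K(1) exp_of_nat_mult[of n "ln (real K)"] by (simp add: mult.commute)
    finally show "real (card E) \<le> 1 * exp (ln (real K) * real n)" by simp
  qed
  moreover have "0 \<le> ln (real K)" using K(1) by simp
  ultimately have "ln (real K) \<in> G" unfolding G_def by blast
  then have G: "G \<noteq> {}" by blast
  have bdd: "bdd_below G" by (rule bdd_belowI[of _ 0]) (simp add: G_def)
  have "0 \<le> Inf G" using G by (intro cInf_greatest) (auto simp: G_def)
  moreover have "\<exists>C. bd \<tau> C" if lt: "Inf G < \<tau>" for \<tau>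
  proof -
    obtain g where g: "g \<in> G" "g < \<tau>" using cInf_lessD[OF G lt] by blast
    then obtain C where C: "bd g C" by (auto simp: G_def)
    have "0 \<le> C" using C[unfolded bd_def, rule_format, of "{}" 0] by (simp add: separated_def)
    then have "C * exp (g * real n) \<le> C * exp (\<tau> * real n)" for n
      using g(2) by (intro mult_left_mono) (auto intro!: mult_right_mono)
    then have "bd \<tau> C" using C unfolding bd_def by (meson order_trans)
    then show ?thesis by blast
  qed
  moreover have "\<not> bd \<tau> C" if "0 \<le> \<tau>" "\<tau> < Inf G" for \<tau> C
    using that cInf_lower[OF _ bdd, of \<tau>] by (auto simp: G_def)
  ultimately show ?thesis
    unfolding bd_def by (intro exI[of _ "Inf G"]) (auto simp: not_le)
qed

text \<open>A separated subset of \<open>V\<close> has at least the share \<open>1 / L\<close> in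
  one image of \<open>Y\<close> under \<open>f ^^ i\<close>. Preimages in \<open>Y\<close> are
  separated once \<open>i\<close> more steps are allowed, and the length is then enlarged to a
  multiple of \<open>L\<close>.\<close>

lemma separated_in_base:
  assumes V: "V = (\<Union>i<L. (f ^^ i) ` Y)" "V \<subseteq> X" and L: "1 \<le> L" and r: "0 < r" and h: "0 < h"
    and big: "\<And>\<tau> C. 0 \<le> \<tau> \<Longrightarrow> \<tau> < h \<Longrightarrow>
       \<exists>n E. E \<subseteq> V \<and> finite E \<and> separated f n r E \<and> C * exp (\<tau> * real n) < real (card E)"
    and "\<tau> < h"
  shows "\<exists>p\<ge>p0. \<exists>E\<subseteq>Y. L dvd p \<and> finite E \<and> separated f p r E \<and> exp (\<tau> * real p) \<le> real (card E)"
proof -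
  obtain K :: nat where K: "1 \<le> K" "\<forall>n E. E \<subseteq> X \<longrightarrow> finite E \<longrightarrow> separated f n r E \<longrightarrow> card E \<le> K ^ n"
    using separated_card_le_power[OF r] by blast
  define \<tau>' where "\<tau>' = max \<tau> 0"
  have \<tau>': "0 \<le> \<tau>'" "\<tau>' < h" "\<tau> \<le> \<tau>'" using assms(7) h by (auto simp: \<tau>'_def)
  \<comment> \<open>The first term pays for the pigeonhole factor \<open>L\<close> and for at most
    \<open>2 * L\<close> added steps. The second bounds all separated sets of length below
    \<open>p0\<close> and so forces \<open>p0 \<le> n\<close>.\<close>
  define C where "C = max (real L * exp (2 * real L * \<tau>')) (real K ^ p0)"
  obtain n E where E: "E \<subseteq> V" "finite E" "separated f n r E" "C * exp (\<tau>' * real n) < real (card E)"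
    using big[OF \<tau>'(1,2)] by blast
  have C0: "0 \<le> C" by (simp add: C_def max.coboundedI1)
  have n: "p0 \<le> n"
  proof (rule ccontr)
    assume "\<not> p0 \<le> n"
    have "real (card E) \<le> real K ^ n"
      using K(2) E V(2) by (metis of_nat_le_iff of_nat_power order_trans)
    also have "\<dots> \<le> real K ^ p0" using K(1) \<open>\<not> p0 \<le> n\<close> by (intro power_increasing) auto
    also have "\<dots> \<le> C * 1" by (simp add: C_def)
    also have "\<dots> \<le> C * exp (\<tau>' * real n)" using C0 \<tau>'(1) by (intro mult_left_mono) auto
    finally show False using E(4) by simp
  qed
  have "\<exists>i<L. real (card E) \<le> real L * real (card (E \<inter> (f ^^ i) ` Y))"
  proof (rule ccontr)
    assume no: "\<not> ?thesis"
    have "E = (\<Union>i\<in>{..<L}. E \<inter> (f ^^ i) ` Y)" using E(1) V(1) by auto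
    then have "real (card E) = real (card (\<Union>i\<in>{..<L}. E \<inter> (f ^^ i) ` Y))" by simp
    also have "\<dots> \<le> real (\<Sum>i<L. card (E \<inter> (f ^^ i) ` Y))"
      unfolding of_nat_le_iff by (rule card_UN_le) simp
    finally have "real L * real (card E) \<le> (\<Sum>i<L. real L * real (card (E \<inter> (f ^^ i) ` Y)))"
      by (simp add: sum_distrib_left[symmetric] mult_left_mono)
    also have "\<dots> < (\<Sum>i<L. real (card E))"
      using no L by (intro sum_strict_mono) (auto simp: not_le lessThan_empty_iff)
    finally show False by simp
  qed
  then obtain i where i: "i < L" "real (card E) \<le> real L * real (card (E \<inter> (f ^^ i) ` Y))" by blast
  have "E \<inter> (f ^^ i) ` Y \<subseteq> (f ^^ i) ` Y" by blast
  then obtain D where D: "D \<subseteq> Y" "inj_on (f ^^ i) D" "E \<inter> (f ^^ i) ` Y = (f ^^ i) ` D"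
    unfolding subset_image_inj by blast
  have finD: "finite D" using D(2,3) E(2) by (metis finite_Int finite_imageD)
  define p where "p = L * (n div L + 2)"
  have p: "n + L \<le> p" "p \<le> n + 2 * L"
  proof -
    have 1: "L * (n div L) + n mod L = n" by (rule mult_div_mod_eq)
    have 2: "n mod L < L" using L by simp
    have 3: "p = L * (n div L) + 2 * L" by (simp add: p_def algebra_simps)
    show "n + L \<le> p" "p \<le> n + 2 * L" using 1 2 3 by linarith+
  qed
  have "separated f p r D"
    unfolding separated_def
  proof (intro ballI impI)
    fix x y assume xy: "x \<in> D" "y \<in> D" "x \<noteq> y"
    then have "(f ^^ i) x \<in> E" "(f ^^ i) y \<in> E" "(f ^^ i) x \<noteq> (f ^^ i) y"
      using D(2,3) by (blast, blast, auto simp: inj_on_def)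
    then obtain k where k: "k < n" "r \<le> dist ((f ^^ k) ((f ^^ i) x)) ((f ^^ k) ((f ^^ i) y))"
      using E(3) unfolding separated_def by blast
    then show "\<exists>k<p. r \<le> dist ((f ^^ k) x) ((f ^^ k) y)"
      using i(1) p(1) by (intro exI[of _ "k + i"]) (auto simp: funpow_shift)
  qed
  moreover have "exp (\<tau> * real p) \<le> real (card D)"
  proof -
    have "\<tau> * real p \<le> \<tau>' * real p" using \<tau>'(3) by (intro mult_right_mono) auto
    also have "\<dots> \<le> \<tau>' * (real n + 2 * real L)" using p(2) \<tau>'(1) by (intro mult_left_mono) linarith+
    finally have "exp (\<tau> * real p) \<le> exp (2 * real L * \<tau>') * exp (\<tau>' * real n)"
      by (simp add: exp_add[symmetric] algebra_simps)
    then have "real L * exp (\<tau> * real p) \<le> (real L * exp (2 * real L * \<tau>')) * exp (\<tau>' * real n)"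
      by (simp add: mult_left_mono mult.assoc)
    also have "\<dots> \<le> C * exp (\<tau>' * real n)" by (intro mult_right_mono) (auto simp: C_def)
    also have "\<dots> \<le> real L * real (card D)" using E(4) i(2) D(2,3) by (simp add: card_image)
    finally show ?thesis using L by simp
  qed
  ultimately show ?thesis
    using n p(1) D(1) finD by (intro exI[of _ p] conjI exI[of _ D]) (auto simp: p_def)
qed

lemma openin_bowen_ball: "openin (top_of_set X) (bowen_ball X f n x r)"
proof (induction n)
  case 0
  then show ?case by (simp add: bowen_ball_def)
next
  case (Suc n)
  have "bowen_ball X f (Suc n) x r = bowen_ball X f n x r \<inter> (X \<inter> (f ^^ n) -` ball ((f ^^ n) x) r)"
    by (auto simp: bowen_ball_def less_Suc_eq)
  moreover have "openin (top_of_set X) (X \<inter> (f ^^ n) -` ball ((f ^^ n) x) r)"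
    by (intro continuous_openin_preimage_gen continuous_on_funpow cont_f f_into open_ball)
  ultimately show ?case using Suc by auto
qed

text \<open>Bowen balls about a maximal separated subset of \<open>V\<close> form an open
  neighbourhood of \<open>V\<close>, which all of \<open>X\<close> enters after a fixed number
  \<open>k\<close> of steps. From then on each stretch of \<open>n\<close> steps has one of
  \<open>card Z\<close> itineraries, while the first \<open>k\<close> steps cost only a
  constant.\<close>

lemma htop_scale_le_growth_rate:
  assumes V: "V \<subseteq> X" and r: "0 < r" and h: "0 \<le> h" "h < t"
    and upper: "\<And>\<tau>. h < \<tau> \<Longrightarrow> \<exists>C. \<forall>n E. E \<subseteq> V \<longrightarrow> finite E \<longrightarrow> separated f n r E \<longrightarrow>
        real (card E) \<le> C * exp (\<tau> * real n)"
    and attract: "\<And>U. openin (top_of_set X) U \<Longrightarrow> V \<subseteq> U \<Longrightarrow> \<exists>k. (f ^^ k) ` X \<subseteq> U"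
  shows "htop_scale X f X (2 * r) \<le> ereal t"
proof (rule htop_scale_leI)
  show "0 \<le> t" using h by simp
  obtain K :: nat where K: "1 \<le> K" "\<forall>n E. E \<subseteq> X \<longrightarrow> finite E \<longrightarrow> separated f n r E \<longrightarrow> card E \<le> K ^ n"
    using separated_card_le_power[OF r] by blast
  obtain K' :: nat and c :: "'a \<Rightarrow> nat" where c: "1 \<le> K'" "\<forall>y\<in>X. c y < K'"
    "\<forall>y\<in>X. \<forall>z\<in>X. c y = c z \<longrightarrow> dist y z < r"
    using compact_cells[OF compact_X r] by blast
  define \<tau> where "\<tau> = (h + t) / 2"
  have \<tau>: "h < \<tau>" "\<tau> < t" using h by (auto simp: \<tau>_def)
  obtain C where C: "\<forall>n E. E \<subseteq> V \<longrightarrow> finite E \<longrightarrow> separated f n r E \<longrightarrow>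
        real (card E) \<le> C * exp (\<tau> * real n)" using upper[OF \<tau>(1)] by blast
  have "0 \<le> C" using C[rule_format, of "{}" 0] by (simp add: separated_def)
  then have "\<forall>\<^sub>F n in sequentially. C * (real n + 1) \<le> exp ((t - \<tau>) * real n)"
    using \<tau> by (intro eventually_linear_le_exp) auto
  then obtain n0 where n0: "\<forall>n\<ge>n0. C * (real n + 1) \<le> exp ((t - \<tau>) * real n)"
    by (auto simp: eventually_sequentially)
  \<comment> \<open>At this length \<open>C * exp (\<tau> * n) < exp (t * n)\<close>, so each
    stretch contributes a factor \<open>a < 1\<close> and the sum tends to 0 as the number
    \<open>q\<close> of stretches grows.\<close>
  define n where "n = n0 + 1"
  have n: "0 < n" by (simp add: n_def)
  have Cn: "C * exp (\<tau> * real n) < exp (t * real n)"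
  proof -
    have "C * (real n + 1) \<le> exp ((t - \<tau>) * real n)" using n0[rule_format, of n] by (simp add: n_def)
    moreover have "C < C * (real n + 1) \<or> C = 0" using \<open>0 \<le> C\<close> n by (auto simp: algebra_simps)
    ultimately have "C < exp ((t - \<tau>) * real n)" using exp_gt_zero by (metis less_le_trans)
    then have "C * exp (\<tau> * real n) < exp ((t - \<tau>) * real n) * exp (\<tau> * real n)" by simp
    then show ?thesis by (simp add: exp_add[symmetric] algebra_simps)
  qed
  define good where "good Z \<longleftrightarrow> Z \<subseteq> V \<and> finite Z \<and> separated f n r Z" for Z
  have "good {}" by (simp add: good_def separated_def)
  then obtain Z where Z: "good Z" "\<And>Z'. good Z' \<Longrightarrow> card Z' \<le> card Z"
    using ex_has_greatest_nat[of good "{}" card "K ^ n + 1"] K(2) V unfolding good_def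
    by (metis (no_types, lifting) le_imp_less_Suc order_trans Suc_eq_plus1)
  have span: "\<exists>z\<in>Z. v \<in> bowen_ball X f n z r" if v: "v \<in> V" for v
  proof (rule ccontr)
    assume no: "\<not> ?thesis"
    then have far: "\<exists>i<n. r \<le> dist ((f ^^ i) z) ((f ^^ i) v)" if "z \<in> Z" for z
      using that v V by (auto simp: bowen_ball_def not_less)
    have "v \<notin> Z" using far[of v] r by auto
    moreover have "good (insert v Z)"
      using Z(1) v far unfolding good_def separated_def by (auto simp: dist_commute)
    ultimately show False using Z(2)[of "insert v Z"] Z(1) by (simp add: good_def)
  qed
  define U where "U = (\<Union>z\<in>Z. bowen_ball X f n z r)"
  have "openin (top_of_set X) U" unfolding U_def by (intro openin_Union) (auto simp: openin_bowen_ball)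
  moreover have "V \<subseteq> U" using span by (auto simp: U_def)
  ultimately obtain k where k: "(f ^^ k) ` X \<subseteq> U" using attract by blast
  define w where "w y = (SOME z. z \<in> Z \<and> y \<in> bowen_ball X f n z r)" for y
  have w: "w y \<in> Z" "y \<in> bowen_ball X f n (w y) r" if "y \<in> U" for y
  proof -
    have "\<exists>z. z \<in> Z \<and> y \<in> bowen_ball X f n z r" using that by (auto simp: U_def)
    from someI_ex[OF this] show "w y \<in> Z" "y \<in> bowen_ball X f n (w y) r" by (auto simp: w_def)
  qed
  have kU: "(f ^^ (k + i)) x \<in> U" if "x \<in> X" for x i
  proof -
    have "(f ^^ (k + i)) x = (f ^^ k) ((f ^^ i) x)" by (simp add: funpow_add)
    then show ?thesis using k orbit_mem[OF that] by auto
  qed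
  have cardZ: "real (card Z) \<le> C * exp (\<tau> * real n)" using C Z(1) by (simp add: good_def)
  have finZ: "finite Z" using Z(1) by (simp add: good_def)
  define a where "a = real (card Z) * exp (- t * real n)"
  have a: "0 \<le> a" "a < 1"
  proof -
    have "real (card Z) < exp (t * real n)" using cardZ Cn by linarith
    then have "a < exp (t * real n) * exp (- t * real n)" unfolding a_def by simp
    then show "a < 1" by (simp add: exp_minus)
  qed (simp add: a_def)
  \<comment> \<open>A sequence of points of \<open>Z\<close> need not be followed by any of these
    points for long, so the balls are centred at a representative of each itinerary; this doubles
    the radius.\<close>
  have cover: "bowen_C_n X f X t m (2 * r) \<le> ennreal (real K' ^ k * exp (- t * real k) * a ^ q)"
    if q: "m \<le> q" for m q
  proof -
    define S where "S = ({..<k} \<rightarrow>\<^sub>E {..<K'}) \<times> ({..<q} \<rightarrow>\<^sub>E Z)"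
    define code where "code x = (restrict (\<lambda>i. c ((f ^^ i) x)) {..<k},
        restrict (\<lambda>j. w ((f ^^ (k + j * n)) x)) {..<q})" for x
    define rep where "rep s = (SOME x. x \<in> X \<and> code x = s)" for s
    have rep: "rep s \<in> X" "code (rep s) = s" if "s \<in> code ` X" for s
    proof -
      have "\<exists>x. x \<in> X \<and> code x = s" using that by auto
      from someI_ex[OF this] show "rep s \<in> X" "code (rep s) = s" by (auto simp: rep_def)
    qed
    have finS: "finite S" unfolding S_def using finZ by (auto intro!: finite_PiE)
    have "code x \<in> S" if "x \<in> X" for x
      using that c(2) orbit_mem w(1) kU by (auto simp: code_def S_def)
    then have codeS: "code ` X \<subseteq> S" by blast
    show ?thesis
    proof (rule bowen_C_n_le_family[where J = "code ` X" and x = rep and u = "\<lambda>_. k + q * n"])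
      show "countable (code ` X)" using codeS finS by (meson countable_finite finite_subset)
      show "m \<le> k + q * n" for s
      proof -
        have "q * 1 \<le> q * n" using n by (intro mult_le_mono2) simp
        then show ?thesis using q unfolding mult_1_right by linarith
      qed
      show "X \<subseteq> (\<Union>s\<in>code ` X. bowen_ball X f (k + q * n) (rep s) (2 * r))"
      proof
        fix x assume x: "x \<in> X"
        define y where "y = rep (code x)"
        have y: "y \<in> X" "code y = code x" using rep[of "code x"] x by (auto simp: y_def)
        have "dist ((f ^^ i) y) ((f ^^ i) x) < 2 * r" if i: "i < k + q * n" for i
        proof (cases "i < k")
          case True
          have "fst (code y) i = fst (code x) i" using y(2) by simp
          then have "c ((f ^^ i) y) = c ((f ^^ i) x)" using True by (simp add: code_def)
          then have "dist ((f ^^ i) y) ((f ^^ i) x) < r" using c(3) orbit_mem x y(1) by blast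
          then show ?thesis using r by simp
        next
          case False
          define j l where "j = (i - k) div n" and "l = (i - k) mod n"
          have jl: "i = l + (k + j * n)" "l < n" using False n by (auto simp: j_def l_def)
          have "i - k < q * n" using i False by linarith
          then have "j < q" unfolding j_def by (rule less_mult_imp_div_less)
          have "snd (code y) j = snd (code x) j" using y(2) by simp
          then have eq: "w ((f ^^ (k + j * n)) y) = w ((f ^^ (k + j * n)) x)"
            using \<open>j < q\<close> by (simp add: code_def)
          let ?z = "w ((f ^^ (k + j * n)) x)"
          have "dist ((f ^^ l) ?z) ((f ^^ l) ((f ^^ (k + j * n)) x)) < r"
            "dist ((f ^^ l) ?z) ((f ^^ l) ((f ^^ (k + j * n)) y)) < r"
            using w(2)[OF kU[OF x]] w(2)[OF kU[OF y(1)], of "j * n"] jl(2) unfolding eq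
            by (auto simp: bowen_ball_def)
          then show ?thesis
            unfolding jl(1) funpow_shift
            using dist_triangle3[of "(f ^^ (l + (k + j * n))) y" "(f ^^ (l + (k + j * n))) x" "(f ^^ l) ?z"]
            by linarith
        qed
        then have "x \<in> bowen_ball X f (k + q * n) y (2 * r)" using x by (simp add: bowen_ball_def)
        then show "x \<in> (\<Union>s\<in>code ` X. bowen_ball X f (k + q * n) (rep s) (2 * r))"
          using x unfolding y_def by blast
      qed
      fix F assume F: "finite F" "F \<subseteq> code ` X"
      have "card F \<le> card S" using F codeS finS by (intro card_mono) auto
      also have "\<dots> = K' ^ k * card Z ^ q" by (simp add: S_def card_cartesian_product card_PiE)
      finally have cardF: "real (card F) \<le> real K' ^ k * real (card Z) ^ q"
        by (metis of_nat_le_iff of_nat_mult of_nat_power)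
      have "(\<Sum>j\<in>F. ennreal (exp (- t * real (k + q * n)))) = ennreal (real (card F) * exp (- t * real (k + q * n)))"
        by (simp add: ennreal_mult ennreal_of_nat_eq_real_of_nat)
      also have "\<dots> \<le> ennreal (real K' ^ k * real (card Z) ^ q * exp (- t * real (k + q * n)))"
        using cardF by (intro ennreal_leI mult_right_mono) auto
      also have "real K' ^ k * real (card Z) ^ q * exp (- t * real (k + q * n))
          = real K' ^ k * exp (- t * real k) * a ^ q"
      proof -
        have "- t * real (k + q * n) = - t * real k + real q * (- t * real n)" by (simp add: algebra_simps)
        then have "exp (- t * real (k + q * n)) = exp (- t * real k) * exp (- t * real n) ^ q"
          by (simp only: exp_add exp_of_nat_mult)
        then show ?thesis by (simp add: a_def power_mult_distrib)
      qed
      finally show "(\<Sum>j\<in>F. ennreal (exp (- t * real (k + q * n))))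
          \<le> ennreal (real K' ^ k * exp (- t * real k) * a ^ q)" .
    qed (use rep in auto)
  qed
  have "bowen_C X f X t (2 * r) \<le> 0"
  proof (rule bowen_C_le)
    fix m
    have "(\<lambda>q. ennreal (real K' ^ k * exp (- t * real k) * a ^ q)) \<longlonglongrightarrow> ennreal (real K' ^ k * exp (- t * real k) * 0)"
      using a by (intro tendsto_ennrealI tendsto_mult tendsto_const LIMSEQ_power_zero) simp
    then show "bowen_C_n X f X t m (2 * r) \<le> 0"
      by (rule LIMSEQ_le_const[THEN order_trans]) (use cover in auto)
  qed
  then show "bowen_C X f X t (2 * r) = 0" by simp
qed

end

section \<open>Shadowing by almost specification\<close>

lemma mistake_ball_shadow:
  assumes "z \<in> mistake_ball Y T n k x \<epsilon>"
  shows "\<exists>B\<subseteq>{..<n}. card B \<le> k \<and> (\<forall>i\<in>{..<n} - B. dist ((T ^^ i) x) ((T ^^ i) z) \<le> \<epsilon>)"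
proof -
  obtain \<Lambda> where \<Lambda>: "\<Lambda> \<subseteq> {..<n}" "n \<le> card \<Lambda> + k" "\<forall>i\<in>\<Lambda>. dist ((T ^^ i) x) ((T ^^ i) z) < \<epsilon>"
    using assms by (auto simp: mistake_ball_def)
  have "card ({..<n} - \<Lambda>) = n - card \<Lambda>"
    using \<Lambda>(1) by (subst card_Diff_subset) (auto intro: finite_subset)
  then show ?thesis using \<Lambda> by (intro exI[of _ "{..<n} - \<Lambda>"]) (auto simp: less_imp_le)
qed

text \<open>Compactness passes from finitely to infinitely many blocks. For this the strict
  inequality of the mistake ball is relaxed to \<open>\<le>\<close>: for fixed error sets the
  conditions are closed, and each block has only finitely many error sets.\<close>

lemma specification_infinite:
  fixes T :: "'a::metric_space \<Rightarrow> 'a"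
  assumes Y: "compact Y" "continuous_on Y T" "T ` Y \<subseteq> Y" and "1 \<le> n"
    and fin: "\<And>m (x :: nat \<Rightarrow> 'a). 1 \<le> m \<Longrightarrow> (\<And>j. j \<in> {1..m} \<Longrightarrow> x j \<in> A) \<Longrightarrow>
      (\<Inter>j\<in>{1..m}. {z \<in> Y. (T ^^ ((j - 1) * n)) z \<in> mistake_ball Y T n k (x j) \<epsilon>}) \<noteq> {}"
    and \<omega>: "range \<omega> \<subseteq> A"
  shows "\<exists>z\<in>Y. \<forall>j. \<exists>B\<subseteq>{..<n}. card B \<le> k \<and>
    (\<forall>i\<in>{..<n} - B. dist ((T ^^ i) (\<omega> j)) ((T ^^ (j * n + i)) z) \<le> \<epsilon>)"
proof -
  define F where "F j = (\<Union>B\<in>{B. B \<subseteq> {..<n} \<and> card B \<le> k}. \<Inter>i\<in>{..<n} - B.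
      Y \<inter> (T ^^ (j * n + i)) -` cball ((T ^^ i) (\<omega> j)) \<epsilon>)" for j
  have cl: "closed (F j)" for j
    unfolding F_def
  proof (intro closed_UN closed_INT ballI)
    show "finite {B. B \<subseteq> {..<n} \<and> card B \<le> k}" by (rule finite_subset[of _ "Pow {..<n}"]) auto
  qed (intro continuous_closed_preimage continuous_on_funpow Y compact_imp_closed closed_cball)
  have ne: "Y \<inter> (\<Inter>j\<in>I. F j) \<noteq> {}" if I: "finite I" for I
  proof -
    define m where "m = Suc (Max (insert 0 I))"
    \<comment> \<open>Specification numbers the blocks from 1, the sequence \<omega> from 0.\<close>
    have "(\<Inter>j\<in>{1..m}. {z \<in> Y. (T ^^ ((j - 1) * n)) z \<in> mistake_ball Y T n k (\<omega> (j - 1)) \<epsilon>}) \<noteq> {}"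
      by (rule fin[of m "\<lambda>j. \<omega> (j - 1)"]) (use \<omega> in \<open>auto simp: m_def\<close>)
    then obtain z where z: "\<And>j. j \<in> {1..m} \<Longrightarrow>
        z \<in> Y \<and> (T ^^ ((j - 1) * n)) z \<in> mistake_ball Y T n k (\<omega> (j - 1)) \<epsilon>"
      by blast
    have "z \<in> Y" using z[of 1] by (auto simp: m_def)
    moreover have "z \<in> F j" if "j \<in> I" for j
    proof -
      have "j \<le> Max (insert 0 I)" using I that by (intro Max_ge) auto
      then have "Suc j \<in> {1..m}" by (simp add: m_def)
      then have "(T ^^ (j * n)) z \<in> mistake_ball Y T n k (\<omega> j) \<epsilon>" using z[of "Suc j"] by simp
      from mistake_ball_shadow[OF this] obtain B where B: "B \<subseteq> {..<n}" "card B \<le> k"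
        "\<forall>i\<in>{..<n} - B. dist ((T ^^ i) (\<omega> j)) ((T ^^ i) ((T ^^ (j * n)) z)) \<le> \<epsilon>" by blast
      have "(T ^^ i) ((T ^^ (j * n)) z) = (T ^^ (j * n + i)) z" for i
        by (metis add.commute comp_apply funpow_add)
      then have "z \<in> (\<Inter>i\<in>{..<n} - B. Y \<inter> (T ^^ (j * n + i)) -` cball ((T ^^ i) (\<omega> j)) \<epsilon>)"
        using B(3) \<open>z \<in> Y\<close> by auto
      then show ?thesis using B(1,2) unfolding F_def by blast
    qed
    ultimately show ?thesis by blast
  qed
  have "Y \<inter> (\<Inter>j. F j) \<noteq> {}"
    by (rule compact_imp_fip_image[OF Y(1) cl ne])
  then obtain z where z: "z \<in> Y" "\<And>j. z \<in> F j" by blast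
  show ?thesis
  proof (intro bexI[of _ z] allI z(1))
    fix j
    from z(2)[of j] obtain B where B: "B \<subseteq> {..<n}" "card B \<le> k"
      "z \<in> (\<Inter>i\<in>{..<n} - B. Y \<inter> (T ^^ (j * n + i)) -` cball ((T ^^ i) (\<omega> j)) \<epsilon>)"
      unfolding F_def by blast
    have "dist ((T ^^ i) (\<omega> j)) ((T ^^ (j * n + i)) z) \<le> \<epsilon>" if "i \<in> {..<n} - B" for i
      using INT_D[OF B(3) that] by simp
    then show "\<exists>B\<subseteq>{..<n}. card B \<le> k \<and>
        (\<forall>i\<in>{..<n} - B. dist ((T ^^ i) (\<omega> j)) ((T ^^ (j * n + i)) z) \<le> \<epsilon>)"
      using B(1,2) by (intro exI[of _ B]) auto
  qed
qed

context dynamics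
begin

text \<open>A mistake at one time of \<open>f ^^ L\<close> spoils at most \<open>L\<close> times of
  \<open>f\<close>, so among \<open>p = L * n\<close> times the fraction of errors is at most
  \<open>g n e / n\<close>, which tends to 0. After a time without mistake, uniform continuity
  controls the following \<open>L - 1\<close> steps.\<close>

lemma specification_shadowing:
  assumes L: "1 \<le> L" and Y: "compact Y" "Y \<subseteq> X" "(f ^^ L) ` Y \<subseteq> Y"
    and spec: "modified_almost_specification Y (f ^^ L)"
    and \<epsilon>: "0 < \<epsilon>" and \<delta>: "0 < (\<delta>::real)"
  shows "\<exists>p0. \<forall>p\<ge>p0. L dvd p \<longrightarrow> (\<forall>\<omega>. range \<omega> \<subseteq> (\<Inter>i. ((f ^^ L) ^^ i) ` Y) \<longrightarrow>
    (\<exists>x\<in>X. \<forall>j. real (mismatch f \<epsilon> p ((f ^^ (j * p)) x) (\<omega> j)) \<le> \<delta> * real p))"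
proof -
  define T where "T = f ^^ L"
  have T: "(T ^^ i) = f ^^ (L * i)" for i by (simp add: T_def funpow_mult)
  obtain \<epsilon>0 g kg where g: "mistake_function \<epsilon>0 g" "\<forall>\<epsilon>>0. (1::nat) \<le> kg \<epsilon>"
    and fin: "\<forall>m\<ge>1. \<forall>\<epsilon>>0. \<forall>x :: nat \<Rightarrow> 'a. (\<forall>j\<in>{1..m}. x j \<in> (\<Inter>i. (T ^^ i) ` Y)) \<longrightarrow>
      (\<forall>n\<ge>kg \<epsilon>. (\<Inter>j\<in>{1..m}. {z \<in> Y. (T ^^ ((j - 1) * n)) z
         \<in> mistake_ball Y T n (mistake_ext \<epsilon>0 g n \<epsilon>) (x j) \<epsilon>}) \<noteq> {})"
    using spec unfolding modified_almost_specification_def T_def by blast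
  obtain d where d: "0 < d" "\<And>x y l. x \<in> X \<Longrightarrow> y \<in> X \<Longrightarrow> l < L \<Longrightarrow> dist x y < d \<Longrightarrow>
    dist ((f ^^ l) x) ((f ^^ l) y) < \<epsilon>"
    using uniform_funpow[OF compact_X cont_f f_into \<epsilon>, of L] by metis
  \<comment> \<open>\<open>e \<le> \<epsilon>0\<close> keeps the scale where the growth of
    \<open>g\<close> is controlled, and \<open>mistake_ext\<close> reduces to
    \<open>g\<close>.\<close>
  define e where "e = min (d / 2) \<epsilon>0"
  have e: "0 < e" "e < d" "e \<le> \<epsilon>0" using d(1) g(1) by (auto simp: e_def mistake_function_def)
  have "(\<lambda>n. real (g n e) / real n) \<longlonglongrightarrow> 0"
    using g(1) e by (auto simp: mistake_function_def)
  then have "\<forall>\<^sub>F n in sequentially. real (g n e) / real n < \<delta>"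
    using \<delta> by (rule order_tendstoD(2))
  then obtain n1 where n1: "\<forall>n\<ge>n1. real (g n e) / real n < \<delta>"
    by (auto simp: eventually_sequentially)
  show ?thesis
  proof (intro exI[of _ "L * (n1 + kg e)"] allI impI)
    fix p and \<omega> :: "nat \<Rightarrow> 'a"
    assume p: "L * (n1 + kg e) \<le> p" "L dvd p" and \<omega>: "range \<omega> \<subseteq> (\<Inter>i. ((f ^^ L) ^^ i) ` Y)"
    obtain n where n: "p = L * n" using p(2) by blast
    have nn: "n1 \<le> n" "kg e \<le> n" using p(1) L unfolding n by auto
    then have n0: "1 \<le> n" using g(2) e(1) by (meson order_trans)
    have cT: "continuous_on Y T"
      unfolding T_def by (rule continuous_on_subset[OF continuous_on_funpow[OF cont_f f_into] Y(2)])
    have "\<exists>z\<in>Y. \<forall>j. \<exists>B\<subseteq>{..<n}. card B \<le> g n e \<and>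
        (\<forall>i\<in>{..<n} - B. dist ((T ^^ i) (\<omega> j)) ((T ^^ (j * n + i)) z) \<le> e)"
    proof (rule specification_infinite[OF Y(1) cT _ n0])
      show "range \<omega> \<subseteq> (\<Inter>i. (T ^^ i) ` Y)" using \<omega> by (simp add: T_def)
      show "(\<Inter>j\<in>{1..m}. {z \<in> Y. (T ^^ ((j - 1) * n)) z \<in> mistake_ball Y T n (g n e) (x j) e}) \<noteq> {}"
        if "1 \<le> m" "\<And>j. j \<in> {1..m} \<Longrightarrow> x j \<in> (\<Inter>i. (T ^^ i) ` Y)" for m and x :: "nat \<Rightarrow> 'a"
        using fin[rule_format, OF that(1) e(1) that(2) nn(2)] e(3) by (simp add: mistake_ext_def)
    qed (use Y(3) in \<open>simp add: T_def\<close>)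
    then obtain z where z: "z \<in> Y" "\<And>j. \<exists>B\<subseteq>{..<n}. card B \<le> g n e \<and>
        (\<forall>i\<in>{..<n} - B. dist ((T ^^ i) (\<omega> j)) ((T ^^ (j * n + i)) z) \<le> e)" by blast
    have zX: "z \<in> X" using z(1) Y(2) by blast
    have "real (mismatch f \<epsilon> p ((f ^^ (j * p)) z) (\<omega> j)) \<le> \<delta> * real p" for j
    proof -
      obtain B where B: "B \<subseteq> {..<n}" "card B \<le> g n e"
        "\<forall>i\<in>{..<n} - B. dist ((T ^^ i) (\<omega> j)) ((T ^^ (j * n + i)) z) \<le> e" using z(2) by blast
      have finB: "finite B" using B(1) finite_subset by blast
      have "\<omega> j \<in> ((f ^^ L) ^^ 0) ` Y" using \<omega> by blast
      then have \<omega>X: "\<omega> j \<in> X" using Y(2) by auto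
      let ?M = "{i. i < p \<and> \<epsilon> \<le> dist ((f ^^ i) ((f ^^ (j * p)) z)) ((f ^^ i) (\<omega> j))}"
      have "card ?M \<le> card (B \<times> {..<L})"
      proof (rule card_inj_on_le[where f = "\<lambda>i. (i div L, i mod L)"])
        show "inj_on (\<lambda>i. (i div L, i mod L)) ?M"
          by (rule inj_onI) (metis Pair_inject div_mult_mod_eq)
        show "(\<lambda>i. (i div L, i mod L)) ` ?M \<subseteq> B \<times> {..<L}"
        proof clarify
          fix i assume i: "i < p" "\<epsilon> \<le> dist ((f ^^ i) ((f ^^ (j * p)) z)) ((f ^^ i) (\<omega> j))"
          let ?q = "i div L" and ?l = "i mod L"
          have l: "?l < L" using L by simp
          have "?q < n" using i(1) L by (simp add: n less_mult_imp_div_less mult.commute)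
          have "?q \<in> B"
          proof (rule ccontr)
            assume "?q \<notin> B"
            then have "dist ((T ^^ ?q) (\<omega> j)) ((T ^^ (j * n + ?q)) z) < d"
              using B(3) \<open>?q < n\<close> e(2) by force
            then have "dist ((f ^^ ?l) ((f ^^ (L * ?q)) (\<omega> j))) ((f ^^ ?l) ((f ^^ (L * (j * n + ?q))) z)) < \<epsilon>"
              unfolding T using \<omega>X zX l by (intro d(2) orbit_mem)
            moreover have "?l + L * ?q = i" by simp
            moreover have "?l + L * (j * n + ?q) = i + j * p"
            proof -
              have "L * (j * n + ?q) = j * p + L * ?q" by (simp add: n algebra_simps)
              then show ?thesis using \<open>?l + L * ?q = i\<close> by linarith
            qed
            ultimately have "dist ((f ^^ i) (\<omega> j)) ((f ^^ (i + j * p)) z) < \<epsilon>"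
              by (simp only: funpow_shift)
            then show False using i(2) by (simp add: funpow_shift dist_commute)
          qed
          then show "?q \<in> B \<and> ?l \<in> {..<L}" using l by simp
        qed
      qed (use finB in auto)
      also have "\<dots> = card B * L" by (simp add: card_cartesian_product)
      finally have "real (card ?M) \<le> real (card B) * real L"
        by (simp only: of_nat_mult[symmetric] of_nat_le_iff)
      also have "\<dots> \<le> real (g n e) * real L" using B(2) by (intro mult_right_mono) auto
      also have "\<dots> \<le> (\<delta> * real n) * real L"
      proof (rule mult_right_mono)
        have "real (g n e) / real n < \<delta>" using n1 nn(1) by blast
        then show "real (g n e) \<le> \<delta> * real n" using n0 by (simp add: field_simps)
      qed simp
      finally show ?thesis by (simp add: mismatch_def n mult.commute mult.left_commute)
    qed
    then show "\<exists>x\<in>X. \<forall>j. real (mismatch f \<epsilon> p ((f ^^ (j * p)) x) (\<omega> j)) \<le> \<delta> * real p"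
      using zX by blast
  qed
qed

section \<open>Attraction to the core\<close>

lemma funpow_core_subset:
  assumes "T ` Y \<subseteq> Y"
  shows "T ` (\<Inter>i. (T ^^ i) ` Y) \<subseteq> (\<Inter>i. (T ^^ i) ` Y)"
proof clarify
  fix y i assume y: "y \<in> (\<Inter>i. (T ^^ i) ` Y)"
  show "T y \<in> (T ^^ i) ` Y"
  proof (cases i)
    case 0
    have "y \<in> (T ^^ 0) ` Y" using y by blast
    then show ?thesis using 0 assms by auto
  next
    case (Suc k)
    have "y \<in> (T ^^ k) ` Y" using y by blast
    then show ?thesis using Suc by auto
  qed
qed

text \<open>If all images of \<open>Y\<close> met the compact set of points that
  \<open>f ^^ i\<close> sends outside \<open>U\<close>, their nested intersection would contain such
  a point, contradicting the assumption on the core. As only finitely many \<open>i\<close> occur,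
  one number of iterates serves them all.\<close>

lemma core_attracts:
  assumes L: "1 \<le> L" and Y: "compact Y" "Y \<subseteq> X" "(f ^^ L) ` Y \<subseteq> Y"
    and X: "X = (\<Union>i<L. (f ^^ i) ` Y)"
    and U: "openin (top_of_set X) U" "(\<Union>i<L. (f ^^ i) ` (\<Inter>q. ((f ^^ L) ^^ q) ` Y)) \<subseteq> U"
  shows "\<exists>k. (f ^^ k) ` X \<subseteq> U"
proof -
  define T where "T = f ^^ L"
  have T: "(T ^^ i) = f ^^ (L * i)" for i by (simp add: T_def funpow_mult)
  have cT: "continuous_on Y (T ^^ q)" for q
    unfolding T by (rule continuous_on_subset[OF continuous_on_funpow[OF cont_f f_into] Y(2)])
  have TY: "(T ^^ q) ` Y \<subseteq> Y" for q using funpow_mem[of T Y] Y(3) by (auto simp: T_def)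
  have dec: "(T ^^ q') ` Y \<subseteq> (T ^^ q) ` Y" if "q \<le> q'" for q q'
  proof -
    have "(T ^^ q') ` Y = (T ^^ q) ` ((T ^^ (q' - q)) ` Y)"
      using that by (simp add: image_comp funpow_add[symmetric])
    then show ?thesis using TY by blast
  qed
  have "\<exists>q. (f ^^ i) ` (T ^^ q) ` Y \<subseteq> U" if i: "i < L" for i
  proof -
    define Z where "Z = Y \<inter> (f ^^ i) -` (X - U)"
    have "closedin (top_of_set X) (X - U)" using U(1) by (simp add: closedin_def openin_subset[THEN subset_trans] double_diff openin_imp_subset)
    then have "closed (X - U)" using compact_X by (meson closedin_compact compact_imp_closed)
    then have "closed Z"
      unfolding Z_def
      by (rule continuous_closed_preimage[OF
            continuous_on_subset[OF continuous_on_funpow[OF cont_f f_into] Y(2)] compact_imp_closed[OF Y(1)]])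
    moreover have "Y \<inter> Z = Z" by (auto simp: Z_def)
    ultimately have Z: "compact Z" using compact_Int_closed[OF Y(1), of Z] by simp
    have "\<exists>q. Z \<inter> (T ^^ q) ` Y = {}"
    proof (rule ccontr)
      assume no: "\<not> ?thesis"
      have "Z \<inter> (\<Inter>q. (T ^^ q) ` Y) \<noteq> {}"
      proof (rule compact_imp_fip_image[OF Z])
        show "closed ((T ^^ q) ` Y)" for q
          using compact_continuous_image[OF cT Y(1)] by (rule compact_imp_closed)
        fix I :: "nat set" assume I: "finite I"
        have "(T ^^ Max (insert 0 I)) ` Y \<subseteq> (\<Inter>q\<in>I. (T ^^ q) ` Y)"
          using I by (intro INT_greatest dec Max_ge) auto
        moreover have "Z \<inter> (T ^^ Max (insert 0 I)) ` Y \<noteq> {}" using no by blast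
        ultimately show "Z \<inter> (\<Inter>q\<in>I. (T ^^ q) ` Y) \<noteq> {}" by blast
      qed
      then obtain y where "y \<in> Z" "y \<in> (\<Inter>q. (T ^^ q) ` Y)" by blast
      then have "(f ^^ i) y \<in> U" using U(2) i unfolding T_def by blast
      then show False using \<open>y \<in> Z\<close> by (simp add: Z_def)
    qed
    then obtain q where q: "Z \<inter> (T ^^ q) ` Y = {}" by blast
    have "(f ^^ i) y \<in> U" if "y \<in> (T ^^ q) ` Y" for y
    proof -
      have "y \<in> Y" using that TY by blast
      then have "(f ^^ i) y \<in> X" using Y(2) orbit_mem by blast
      then show ?thesis using q that \<open>y \<in> Y\<close> unfolding Z_def by blast
    qed
    then show ?thesis by blast
  qed
  then obtain q where q: "\<And>i. i < L \<Longrightarrow> (f ^^ i) ` (T ^^ q i) ` Y \<subseteq> U" by metis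
  define q' where "q' = Max (q ` {..<L})"
  have q': "(f ^^ i) ` (T ^^ q') ` Y \<subseteq> U" if "i < L" for i
  proof -
    have "q i \<le> q'" using that unfolding q'_def by (intro Max_ge) auto
    then show ?thesis using q[OF that] dec by blast
  qed
  have "(f ^^ (L * q')) x \<in> U" if x: "x \<in> X" for x
  proof -
    obtain i y where i: "i < L" "y \<in> Y" "x = (f ^^ i) y" using x X by blast
    have "(f ^^ (L * q')) x = (f ^^ i) ((T ^^ q') y)"
      unfolding i(3) T funpow_shift by (simp add: add.commute)
    then show ?thesis using q'[OF i(1)] i(2) by blast
  qed
  then show ?thesis by blast
qed

end

section \<open>Entropy equalities and Bohr chaoticity\<close>

lemma htop_empty_le: "htop X f {} \<le> 0"
proof (rule htop_le)
  fix r :: real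
  have "bowen_C X f {} 0 r \<le> 0"
    by (intro bowen_C_le bowen_C_n_le_family[where J = "{}"]) auto
  then have "htop_scale X f {} r \<le> ereal 0" by (intro htop_scale_leI) auto
  then show "htop_scale X f {} r \<le> 0" by (simp add: zero_ereal_def)
qed

theorem theoremC:
  fixes X Y :: "'a::metric_space set" and f :: "'a \<Rightarrow> 'a" and L :: nat
  assumes "tds X f"
    and "1 \<le> L"
    and "subsystem X (f ^^ L) Y"
    and "modified_almost_specification Y (f ^^ L)"
    and "htop X (f ^^ L) Y > 0"
    and "X = (\<Union>i\<in>{0..L-1}. (f ^^ i) ` Y)"
  shows "(\<forall>\<theta>. nontrivial_weight \<theta> \<longrightarrow>
            htop X f (correlated_points \<theta> f X) = htop X f X \<and>
            htop X f X = ereal (1 / real L) * htop X (f ^^ L) Y \<and>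
            ereal (1 / real L) * htop X (f ^^ L) Y > 0) \<and>
         bohr_chaotic X f"
proof -
  interpret dynamics X f
    using assms(1) by unfold_locales (auto simp: tds_def)
  note L = assms(2)
  have Y: "compact Y" "Y \<subseteq> X" "(f ^^ L) ` Y \<subseteq> Y" using assms(3) by (auto simp: subsystem_def)
  have "{0..L-1} = {..<L}" using L by auto
  then have X: "X = (\<Union>i<L. (f ^^ i) ` Y)" using assms(6) by simp
  \<comment> \<open>Blocks must lie in the core \<open>Y'\<close> to be shadowed. \<open>V\<close>,
    the smallest forward invariant set containing it, is where separated sets are counted.\<close>
  define Y' where "Y' = (\<Inter>q. ((f ^^ L) ^^ q) ` Y)"
  define V where "V = (\<Union>i<L. (f ^^ i) ` Y')"
  have "Y' \<subseteq> ((f ^^ L) ^^ 0) ` Y" unfolding Y'_def by blast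
  then have Y'Y: "Y' \<subseteq> Y" by simp
  have TY': "(f ^^ L) ` Y' \<subseteq> Y'" unfolding Y'_def using Y(3) by (rule funpow_core_subset)
  have VX: "V \<subseteq> X" using Y'Y X by (auto simp: V_def)
  have Y'V: "Y' \<subseteq> V" using L by (force simp: V_def intro: bexI[of _ 0])
  have fV: "f ` V \<subseteq> V"
  proof clarify
    fix x assume "x \<in> V"
    then obtain i y where i: "i < L" "y \<in> Y'" "x = (f ^^ i) y" by (auto simp: V_def)
    show "f x \<in> V"
    proof (cases "Suc i < L")
      case True
      then show ?thesis using i by (auto simp: V_def intro!: bexI[of _ "Suc i"])
    next
      case False
      then have "f x = (f ^^ L) y" using i by (metis Suc_lessI comp_apply funpow.simps(2))
      then show ?thesis using TY' Y'V i(2) by blast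
    qed
  qed
  have le: "htop X f X \<le> ereal (1 / real L) * htop X (f ^^ L) Y"
    by (rule htop_le_funpow[OF compact_X cont_f f_into L X Y(2)])
  have "htop X (f ^^ L) Y \<le> ereal (real L) * htop X f Y" by (rule htop_funpow_le[OF L])
  also have "\<dots> \<le> ereal (real L) * htop X f X"
    using htop_mono[OF Y(2)] by (intro ereal_mult_left_mono) auto
  finally have "ereal (1 / real L) * htop X (f ^^ L) Y \<le> ereal (1 / real L) * (ereal (real L) * htop X f X)"
    by (intro ereal_mult_left_mono) auto
  moreover have "ereal (1 / real L) * (ereal (real L) * a) = a" for a
    using L by (cases a) auto
  ultimately have eq: "htop X f X = ereal (1 / real L) * htop X (f ^^ L) Y"
    using le by (intro antisym) auto
  have pos: "0 < ereal (1 / real L) * htop X (f ^^ L) Y"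
    using assms(5) L by (cases "htop X (f ^^ L) Y") auto
  have ge: "ereal t \<le> htop X f (correlated_points \<theta> f X)"
    if \<theta>: "nontrivial_weight \<theta>" and t: "0 \<le> t" "ereal t < htop X f X" for \<theta> t
  proof -
    obtain r where r: "0 < r" "ereal t < htop_scale X f X r"
      using htop_le[of X f X "ereal t"] t(2) by (meson not_le)
    obtain h where h: "0 \<le> h"
      and upper: "\<forall>\<tau>>h. \<exists>C. \<forall>n E. E \<subseteq> V \<longrightarrow> finite E \<longrightarrow> separated f n (r / 2) E \<longrightarrow>
        real (card E) \<le> C * exp (\<tau> * real n)"
      and big: "\<forall>\<tau> C. 0 \<le> \<tau> \<longrightarrow> \<tau> < h \<longrightarrow>
       (\<exists>n E. E \<subseteq> V \<and> finite E \<and> separated f n (r / 2) E \<and> C * exp (\<tau> * real n) < real (card E))"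
      using growth_rate[OF VX, of "r / 2"] r(1) by auto
    \<comment> \<open>By attraction, the entropy of \<open>X\<close> at scale \<open>r\<close> is at
      most the growth rate of \<open>V\<close> at scale \<open>r / 2\<close>.\<close>
    have "t < h"
    proof (rule ccontr)
      assume "\<not> t < h"
      obtain t' where t': "ereal t < ereal t'" "ereal t' < htop_scale X f X r"
        using ereal_dense2[OF r(2)] by blast
      have "htop_scale X f X (2 * (r / 2)) \<le> ereal t'"
      proof (rule htop_scale_le_growth_rate[OF VX _ h _ upper[rule_format]])
        show "h < t'" using t'(1) \<open>\<not> t < h\<close> by simp
        show "\<exists>k. (f ^^ k) ` X \<subseteq> U" if "openin (top_of_set X) U" "V \<subseteq> U" for U
          using core_attracts[OF L Y X that(1)] that(2) by (simp add: V_def Y'_def)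
      qed (use r in auto)
      then show False using t'(2) by simp
    qed
    have h0: "0 < h" using t(1) \<open>t < h\<close> by simp
    show ?thesis
    proof (rule correlated_points_entropy_ge[OF VX fV Y'V _ t(1) \<open>t < h\<close> upper[rule_format] _ _ \<theta>])
      show "\<exists>p\<ge>p0. \<exists>E\<subseteq>Y'. L dvd p \<and> finite E \<and> separated f p (r / 2) E \<and> exp (\<tau> * real p) \<le> real (card E)"
        if "\<tau> < h" for \<tau> p0
        by (rule separated_in_base[OF V_def VX L _ h0 big[rule_format] that]) (use r in auto)
      show "\<exists>p0. \<forall>p\<ge>p0. L dvd p \<longrightarrow> (\<forall>\<omega>. range \<omega> \<subseteq> Y' \<longrightarrow>
          (\<exists>x\<in>X. \<forall>j. real (mismatch f \<epsilon> p ((f ^^ (j * p)) x) (\<omega> j)) \<le> \<delta> * real p))"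
        if "0 < \<epsilon>" "0 < \<delta>" for \<epsilon> \<delta> :: real
        unfolding Y'_def by (rule specification_shadowing[OF L Y assms(4) that])
    qed (use r in auto)
  qed
  have main: "htop X f (correlated_points \<theta> f X) = htop X f X" if \<theta>: "nontrivial_weight \<theta>" for \<theta>
  proof (rule antisym)
    show "htop X f (correlated_points \<theta> f X) \<le> htop X f X"
      by (rule htop_mono) (auto simp: correlated_points_def)
    show "htop X f X \<le> htop X f (correlated_points \<theta> f X)"
    proof (rule dense_le)
      fix x assume x: "x < htop X f X"
      have "0 < htop X f X" using eq pos by simp
      \<comment> \<open>\<open>ge\<close> needs a nonnegative real rate below the entropy of
        \<open>X\<close>; positivity of the entropy leaves room for one above both \<open>x\<close>
        and 0, also when the entropy is infinite.\<close>
      then have "max x 0 < htop X f X" using x by simp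
      then obtain t where t: "max x 0 < ereal t" "ereal t < htop X f X" using ereal_dense2 by blast
      then have "0 \<le> t" by simp
      then show "x \<le> htop X f (correlated_points \<theta> f X)"
        using ge[OF \<theta> _ t(2)] t(1) by (meson less_imp_le max.cobounded1 order_trans)
    qed
  qed
  \<comment> \<open>The empty set has entropy at most 0, so positive entropy of the correlated
    points yields one.\<close>
  have "bohr_chaotic X f"
    unfolding bohr_chaotic_def
  proof (intro allI impI notI)
    fix \<theta> assume "nontrivial_weight \<theta>" "correlated_points \<theta> f X = {}"
    then have "htop X f X \<le> 0" using main[of \<theta>] htop_empty_le[of X f] by simp
    then show False using eq pos by simp
  qed
  then show ?thesis using main eq pos by auto
qed

end
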